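(* Let $\psi$ be a continuous, strictly positive probability density on $\mathbb{R}$ with $\psi(s)=\psi(-s)$ and $\psi(s)$, $s\ge 0$, decreasing. Let $\delta>0$, $\gamma>0$, $\vartheta_0\in(0,1)$, and let $\boldsymbol{X}$ be a process with sample paths in $\bar C^-[0,1]$ whose distribution depends on $\vartheta\in(0,1)$ and satisfies the neighborhood condition (C) with exponent $\delta$ and the expansion (D) at $\vartheta_0$ with constants $L$ and $\gamma$ (both spelled out in the context). Let $c_n<0$, $c_n\uparrow 0$, with $n|c_n|\to\infty$ and $n|c_n|^{1+2\min(\delta,\gamma)}\to 0$ as $n\to\infty$. Suppose in addition that one of the following holds: (a) under each $\vartheta$, $\boldsymbol{X}$ is a standard generalized Pareto process corresponding to the $\beta$ with $\vartheta=2\Psi(-\beta/2)$; or (b) under each $\vartheta$, $\boldsymbol{X}=\left(\max(-Y/Z_t,M)\right)_{t\in[0,1]}$, where $M<0$ is a constant, $\boldsymbol{Z}=(Z_t)_{t\in[0,1]}$ is a generator of the $D$-norm corresponding to $\vartheta$ (see context), and $Y>0$ is a random variable independent of $\boldsymbol{Z}$ with continuous distribution function $H$ satisfying $H(u)=u+Au^{1+\delta}+\rho(u)$, $0<u<1$, for some constant $A\in\mathbb{R}$, where $\rho(u)=o(u^{1+\delta})$ as $u\downarrow0$ and $\rho$ is differentiable on $(0,1)$ with bounded derivative and $\rho'(u)=o(u^\delta)$ as $u\downarrow0$. Then $\widehat\vartheta_n:=\tau(n)/(n|c_n|)$, $n\in\mathbb{N}$, where $\tau(n)$ is the number of those $i\le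 n$ with $\boldsymbol{X}^{(i)}>c_n$, is a regular estimator sequence with asymptotic minimum variance $\vartheta_0$ within the class of regular estimators (of $\vartheta_0$, based on $N_{n,c_n}$).
   Context: Notation. $\Psi(x)=\int_{-\infty}^x\psi(s)\,ds$, $\psi_\beta(s)=\beta\psi(\beta s)$. The parameter $\beta>0$ is replaced by $\vartheta:=2\Psi(-\beta/2)\in(0,1)$; $P_\vartheta$ denotes probability when the parameter is $\vartheta$. $\bar C^-[0,1]=\{f\in C[0,1]:f\le 0\}$. $E[0,1]$ is the set of bounded functions on $[0,1]$ with a finite number of discontinuities, $\bar E^-[0,1]$ its subset of functions with values in $(-\infty,0]$; $\|f\|_\infty=\sup_t|f(t)|$. Inequalities between functions hold pointwise for all $t\in[0,1]$; a constant also denotes the constant function. Generalized Pareto process. A standard extreme value process (EVP) with parameter $\beta$ is a process $\boldsymbol{\eta}$ with paths in $C[0,1]$, $P(\eta_t\le x)=e^x$ for $x\le0$, which is max-stable ($P(\boldsymbol{\eta}\le f/n)^n=P(\boldsymbol{\eta}\le f)$, $f\in\bar E^-[0,1]$, $n\in\mathbb{N}$) and satisfies $P(\eta_{t_j}\le x_j,1\le j\le d)=\exp\left(-\int_{-\infty}^\infty\max_{j\le d}(|x_j|\psi_\beta(s-t_j))\,ds\right)$ for $x_j\le0$, $t_j\in[0,1]$, $d\in\mathbb{N}$. The corresponding $D$-norm is $\|f\|_D=\int_{-\infty}^\infty\sup_{t\in[0,1]}(|f(t)|\psi(s-\beta t))\,ds$, $f\in E[0,1]$. A standard generalized Pareto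 process (GPP) corresponding to $\beta$ is a process $\boldsymbol{V}$ with paths in $C[0,1]$ for which there is $x_0>0$ with $P(\boldsymbol{V}\le f)=1+\log P(\boldsymbol{\eta}\le f)=1-\|f\|_D$ for all $f\in\bar E^-[0,1]$ with $\|f\|_\infty\le x_0$. A generator of the $D$-norm is a process $\boldsymbol{Z}$ with continuous sample paths such that $0\le Z_t\le m$ and $E(Z_t)=1$ for all $t\in[0,1]$, for some constant $m\ge1$, and $\|f\|_D=E\left(\sup_{t\in[0,1]}(|f(t)|Z_t)\right)$ for all $f\in E[0,1]$. (If $Z_t=0$, then $\max(-Y/Z_t,M)=M$.) Condition (C) (under each parameter $\vartheta$, with $\boldsymbol{V}$ a GPP corresponding to the $\beta$ with $\vartheta=2\Psi(-\beta/2)$; $K$ and $r$ may depend on $\vartheta$): for some $\varepsilon_0>0$ there are $K:\bar E^-[0,1]\to\mathbb{R}$ and $r(c,f)=o(c^\delta)$ as $c\to0$ such that $P_\vartheta(\boldsymbol{X}>cf)=P_\vartheta(\boldsymbol{V}>cf)(1+c^\delta K(f)+r(c,f))$ for all $c\in(0,1)$ and $f\in\bar E^-[0,1]$ with $\|f\|_\infty\le\varepsilon_0$. Condition (D): for some $c_0<0$, for all $s\in(0,1)$, $c_0\le c<0$ and $\vartheta$ close to $\vartheta_0$, the derivatives $f_{\vartheta,c}(s):=\frac{d}{ds}P_\vartheta(\boldsymbol{X}>sc)$ satisfy $$\frac{f_{\vartheta,c}(s)}{f_{\vartheta_0,c}(s)}=1+L(\vartheta-\vartheta_0)+r_{\vartheta_0}(s,\vartheta,c),\qquad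 r_{\vartheta_0}(s,\vartheta,c)=o(|\vartheta-\vartheta_0|)+O(|c|^\gamma)$$ uniformly for $s\in(0,1)$, $c_0\le c<0$ and $\vartheta$ close to $\vartheta_0$; the constants $L\in\mathbb{R}$ and $\gamma>0$ may depend on $\vartheta_0$. Point process of exceedances. $\boldsymbol{X}^{(1)},\dots,\boldsymbol{X}^{(n)}$ are independent copies of $\boldsymbol{X}$, and for $c<0$, $N_{n,c}(B)=\sum_{i=1}^n\varepsilon_{\sup_{t\in[0,1]}(X_t^{(i)}/c)}(B\cap[0,1))$ for Borel sets $B\subset\mathbb{R}$, with $\varepsilon_x$ the Dirac measure at $x$. Note that $\sup_t X_t/c<1$ if and only if $\boldsymbol{X}>c$, so $\tau(n)=N_{n,c_n}([0,1))$. Regular estimators. Put $\vartheta_n(\xi)=\vartheta_0+\xi(n|c_n|)^{-1/2}$, $\xi\in\mathbb{R}$. An estimator sequence $\widetilde\vartheta_n$ (a measurable function of $N_{n,c_n}$) is regular if for every $\xi\in\mathbb{R}$, $(n|c_n|)^{1/2}(\widetilde\vartheta_n-\vartheta_n(\xi))$ converges in distribution under $\vartheta_n(\xi)$, as $n\to\infty$, to a limit distribution $Q_{\vartheta_0}$ not depending on $\xi$. "Asymptotic minimum variance $\vartheta_0$ within the class of regular estimators" means that the limit distribution of $\widehat\vartheta_n$ has variance $\vartheta_0$ and that no regular estimator sequence has a limit distribution $Q_{\vartheta_0}$ with smaller variance. *)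

theory Defs
  imports "HOL-Probability.Probability" "HOL-Library.Landau_Symbols"
begin

text \<open>
  Processes on \<open>[0,1]\<close> are functions \<open>X :: real \<Rightarrow> 'a \<Rightarrow> real\<close> (time, outcome); only times
  in \<open>{0..1}\<close> matter.
\<close>

definition continuous_process :: "'a measure \<Rightarrow> (real \<Rightarrow> 'a \<Rightarrow> real) \<Rightarrow> bool" where
  "continuous_process M X \<longleftrightarrow>
     prob_space M \<and>
     (\<forall>t\<in>{0..1}. X t \<in> borel_measurable M) \<and>
     (\<forall>\<omega>\<in>space M. continuous_on {0..1} (\<lambda>t. X t \<omega>))"

definition nonpos_continuous_process :: "'a measure \<Rightarrow> (real \<Rightarrow> 'a \<Rightarrow> real) \<Rightarrow> bool" where
  "nonpos_continuous_process M X \<longleftrightarrow>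
     continuous_process M X \<and> (\<forall>\<omega>\<in>space M. \<forall>t\<in>{0..1}. X t \<omega> \<le> 0)"

text \<open>Discontinuities are those relative to \<open>[0,1]\<close>.\<close>

definition E01 :: "(real \<Rightarrow> real) set" where
  "E01 = {f. bounded (f ` {0..1}) \<and>
             finite {t \<in> {0..1}. \<not> continuous (at t within {0..1}) f}}"

definition E01_nonpos :: "(real \<Rightarrow> real) set" where
  "E01_nonpos = {f \<in> E01. \<forall>t\<in>{0..1}. f t \<le> 0}"

definition sup_norm01 :: "(real \<Rightarrow> real) \<Rightarrow> real" where
  "sup_norm01 f = (SUP t\<in>{0..1}. \<bar>f t\<bar>)"

definition prob_le :: "'a measure \<Rightarrow> (real \<Rightarrow> 'a \<Rightarrow> real) \<Rightarrow> (real \<Rightarrow> real) \<Rightarrow> real" where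
  "prob_le M X f = \<P>(\<omega> in M. \<forall>t\<in>{0..1}. X t \<omega> \<le> f t)"

definition prob_gt :: "'a measure \<Rightarrow> (real \<Rightarrow> 'a \<Rightarrow> real) \<Rightarrow> (real \<Rightarrow> real) \<Rightarrow> real" where
  "prob_gt M X f = \<P>(\<omega> in M. \<forall>t\<in>{0..1}. f t < X t \<omega>)"

definition path01 :: "(real \<Rightarrow> 'a \<Rightarrow> real) \<Rightarrow> 'a \<Rightarrow> real \<Rightarrow> real" where
  "path01 X \<omega> = (\<lambda>t\<in>{0..1}. X t \<omega>)"

definition path_space :: "(real \<Rightarrow> real) measure" where
  "path_space = (\<Pi>\<^sub>M t\<in>{0..1}. borel)"


definition distr_fun :: "(real \<Rightarrow> real) \<Rightarrow> real \<Rightarrow> real" where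
  "distr_fun \<psi> x = (LINT s:{..x}|lborel. \<psi> s)"

definition scaled_density :: "(real \<Rightarrow> real) \<Rightarrow> real \<Rightarrow> real \<Rightarrow> real" where
  "scaled_density \<psi> \<beta> s = \<beta> * \<psi> (\<beta> * s)"

definition beta_of :: "(real \<Rightarrow> real) \<Rightarrow> real \<Rightarrow> real" where
  "beta_of \<psi> \<theta> = (THE \<beta>. \<beta> > 0 \<and> \<theta> = 2 * distr_fun \<psi> (- \<beta> / 2))"

definition D_norm :: "(real \<Rightarrow> real) \<Rightarrow> real \<Rightarrow> (real \<Rightarrow> real) \<Rightarrow> real" where
  "D_norm \<psi> \<beta> f = (LINT s|lborel. (SUP t\<in>{0..1}. \<bar>f t\<bar> * \<psi> (s - \<beta> * t)))"

definition standard_evp ::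
    "(real \<Rightarrow> real) \<Rightarrow> real \<Rightarrow> 'a measure \<Rightarrow> (real \<Rightarrow> 'a \<Rightarrow> real) \<Rightarrow> bool" where
  "standard_evp \<psi> \<beta> M \<eta> \<longleftrightarrow>
     continuous_process M \<eta> \<and>
     (\<forall>t\<in>{0..1}. \<forall>x\<le>0. \<P>(\<omega> in M. \<eta> t \<omega> \<le> x) = exp x) \<and>
     (\<forall>f\<in>E01_nonpos. \<forall>n::nat. n \<ge> 1 \<longrightarrow>
        (prob_le M \<eta> (\<lambda>t. f t / real n)) ^ n = prob_le M \<eta> f) \<and>
     (\<forall>d::nat. d \<ge> 1 \<longrightarrow> (\<forall>t x. (\<forall>j\<in>{1..d}. t j \<in> {0..1} \<and> x j \<le> 0) \<longrightarrow>
        \<P>(\<omega> in M. \<forall>j\<in>{1..d}. \<eta> (t j) \<omega> \<le> x j) =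
          exp (- (LINT s|lborel. (MAX j\<in>{1..d}. \<bar>x j\<bar> * scaled_density \<psi> \<beta> (s - t j))))))"

text \<open>
  The process \<open>\<eta>\<close> may live on a probability space of its own. Taking outcomes of type
  \<open>real \<Rightarrow> real\<close> is no restriction, as every process with continuous paths can be realised
  by its law on a space of paths. The same device is used for the process \<open>V\<close> in
  \<open>condition_C\<close> below.
\<close>

definition standard_gpp ::
    "(real \<Rightarrow> real) \<Rightarrow> real \<Rightarrow> 'a measure \<Rightarrow> (real \<Rightarrow> 'a \<Rightarrow> real) \<Rightarrow> bool" where
  "standard_gpp \<psi> \<beta> M V \<longleftrightarrow>
     continuous_process M V \<and>
     (\<exists>(N :: (real \<Rightarrow> real) measure) \<eta>. standard_evp \<psi> \<beta> N \<eta> \<and>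
       (\<exists>x0>0. \<forall>f\<in>E01_nonpos. sup_norm01 f \<le> x0 \<longrightarrow>
          prob_le M V f = 1 + ln (prob_le N \<eta> f) \<and>
          1 + ln (prob_le N \<eta> f) = 1 - D_norm \<psi> \<beta> f))"

definition D_norm_generator ::
    "(real \<Rightarrow> real) \<Rightarrow> real \<Rightarrow> 'a measure \<Rightarrow> (real \<Rightarrow> 'a \<Rightarrow> real) \<Rightarrow> bool" where
  "D_norm_generator \<psi> \<beta> M Z \<longleftrightarrow>
     continuous_process M Z \<and>
     (\<exists>m\<ge>1. \<forall>\<omega>\<in>space M. \<forall>t\<in>{0..1}. 0 \<le> Z t \<omega> \<and> Z t \<omega> \<le> m) \<and>
     (\<forall>t\<in>{0..1}. (\<integral>\<omega>. Z t \<omega> \<partial>M) = 1) \<and>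
     (\<forall>f\<in>E01. D_norm \<psi> \<beta> f = (\<integral>\<omega>. (SUP t\<in>{0..1}. \<bar>f t\<bar> * Z t \<omega>) \<partial>M))"


text \<open>
  The remainder \<open>r(c,f) = o(c\<^sup>\<delta>)\<close> is understood for each fixed \<open>f\<close>.
\<close>

definition condition_C ::
    "(real \<Rightarrow> real) \<Rightarrow> real \<Rightarrow> real \<Rightarrow> 'a measure \<Rightarrow> (real \<Rightarrow> 'a \<Rightarrow> real) \<Rightarrow> bool" where
  "condition_C \<psi> \<beta> \<delta> M X \<longleftrightarrow>
     (\<exists>(N :: (real \<Rightarrow> real) measure) V. standard_gpp \<psi> \<beta> N V \<and>
       (\<exists>\<epsilon>0>0. \<exists>(K :: (real \<Rightarrow> real) \<Rightarrow> real) (r :: real \<Rightarrow> (real \<Rightarrow> real) \<Rightarrow> real).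
          \<forall>f\<in>E01_nonpos. sup_norm01 f \<le> \<epsilon>0 \<longrightarrow>
            (\<lambda>c. r c f) \<in> o[at_right 0](\<lambda>c. c powr \<delta>) \<and>
            (\<forall>c\<in>{0<..<1}.
               prob_gt M X (\<lambda>t. c * f t) =
               prob_gt N V (\<lambda>t. c * f t) * (1 + c powr \<delta> * K f + r c f))))"

text \<open>
  \<open>M \<theta>\<close> is the underlying probability space when the parameter is \<open>\<theta>\<close>; \<open>\<kappa>\<close> makes
  ``\<open>\<theta>\<close> close to \<open>\<theta>0\<close>'' precise. The remainder is split as \<open>r1 + r2\<close> with
  \<open>r1 = o(\<bar>\<theta> - \<theta>0\<bar>)\<close> and \<open>r2 = O(\<bar>c\<bar>\<^sup>\<gamma>)\<close>, both uniformly. That \<open>fd \<theta>0 c s\<close> is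
  nonzero is implicit in writing the quotient, but not in Isabelle's total division.
\<close>

definition condition_D ::
    "real \<Rightarrow> real \<Rightarrow> real \<Rightarrow> (real \<Rightarrow> 'a measure) \<Rightarrow> (real \<Rightarrow> 'a \<Rightarrow> real) \<Rightarrow> bool" where
  "condition_D \<theta>0 L \<gamma> M X \<longleftrightarrow>
     (\<exists>c0<0. \<exists>\<kappa>>0. \<exists>fd r1 r2 :: real \<Rightarrow> real \<Rightarrow> real \<Rightarrow> real.
        (\<forall>s\<in>{0<..<1}. \<forall>c\<in>{c0..<0}. \<forall>\<theta>\<in>{0<..<1}. \<bar>\<theta> - \<theta>0\<bar> < \<kappa> \<longrightarrow>
           ((\<lambda>u. prob_gt (M \<theta>) X (\<lambda>t. u * c)) has_real_derivative fd \<theta> c s) (at s) \<and>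
           fd \<theta>0 c s \<noteq> 0 \<and>
           fd \<theta> c s / fd \<theta>0 c s = 1 + L * (\<theta> - \<theta>0) + (r1 s \<theta> c + r2 s \<theta> c)) \<and>
        (\<forall>\<epsilon>>0. \<exists>\<kappa>'>0. \<forall>s\<in>{0<..<1}. \<forall>c\<in>{c0..<0}. \<forall>\<theta>\<in>{0<..<1}.
           \<bar>\<theta> - \<theta>0\<bar> < min \<kappa> \<kappa>' \<longrightarrow> \<bar>r1 s \<theta> c\<bar> \<le> \<epsilon> * \<bar>\<theta> - \<theta>0\<bar>) \<and>
        (\<exists>B. \<forall>s\<in>{0<..<1}. \<forall>c\<in>{c0..<0}. \<forall>\<theta>\<in>{0<..<1}.
           \<bar>\<theta> - \<theta>0\<bar> < \<kappa> \<longrightarrow> \<bar>r2 s \<theta> c\<bar> \<le> B * \<bar>c\<bar> powr \<gamma>))"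

text \<open>
  The process \<open>max(-Y/Z\<^sub>t, a)\<close>, with value \<open>a\<close> where \<open>Z\<^sub>t = 0\<close>. The condition on
  \<open>\<rho>\<close> is about its restriction to \<open>(0,1)\<close> only. Independence of \<open>Y\<close> and of the path of
  \<open>Z\<close> is that of the generated \<open>\<sigma>\<close>-algebras, since \<open>indep_var\<close> needs two variables of
  the same type.
\<close>

definition ratio_process ::
    "(real \<Rightarrow> real) \<Rightarrow> real \<Rightarrow> real \<Rightarrow> 'a measure \<Rightarrow> (real \<Rightarrow> 'a \<Rightarrow> real) \<Rightarrow> bool" where
  "ratio_process \<psi> \<beta> \<delta> M X \<longleftrightarrow>
     (\<exists>a<0. \<exists>Y Z.
        D_norm_generator \<psi> \<beta> M Z \<and>
        Y \<in> borel_measurable M \<and> (\<forall>\<omega>\<in>space M. Y \<omega> > 0) \<and>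
        prob_space.indep_set M
          (sets (vimage_algebra (space M) Y borel))
          (sets (vimage_algebra (space M) (path01 Z) path_space)) \<and>
        (\<forall>\<omega>\<in>space M. \<forall>t\<in>{0..1}.
           X t \<omega> = (if Z t \<omega> = 0 then a else max (- Y \<omega> / Z t \<omega>) a)) \<and>
        continuous_on UNIV (cdf (distr M borel Y)) \<and>
        (\<exists>A \<rho> \<rho>'.
           (\<forall>u\<in>{0<..<1}. cdf (distr M borel Y) u = u + A * u powr (1 + \<delta>) + \<rho> u) \<and>
           \<rho> \<in> o[at_right 0](\<lambda>u. u powr (1 + \<delta>)) \<and>
           (\<forall>u\<in>{0<..<1}. (\<rho> has_real_derivative \<rho>' u) (at u)) \<and>
           bounded (\<rho>' ` {0<..<1}) \<and>
           \<rho>' \<in> o[at_right 0](\<lambda>u. u powr \<delta>)))"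


text \<open>
  Independent copies \<open>Xs 0, Xs 1, \<dots>\<close> on \<open>P\<close> of the process \<open>X\<close> on \<open>M\<close>; independence and
  equality of distribution are those of the whole paths.
\<close>

definition independent_copies ::
    "'w measure \<Rightarrow> (nat \<Rightarrow> real \<Rightarrow> 'w \<Rightarrow> real) \<Rightarrow> 'a measure \<Rightarrow> (real \<Rightarrow> 'a \<Rightarrow> real) \<Rightarrow> bool" where
  "independent_copies P Xs M X \<longleftrightarrow>
     (\<forall>i. nonpos_continuous_process P (Xs i)) \<and>
     prob_space.indep_vars P (\<lambda>_. path_space) (\<lambda>i. path01 (Xs i)) UNIV \<and>
     (\<forall>i. distr P path_space (path01 (Xs i)) = distr M path_space (path01 X))"

text \<open>
  The point process \<open>N\<^sub>n\<^sub>,\<^sub>c\<close> is represented by its values on the Borel sets, and the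
  \<open>\<sigma>\<close>-algebra on such set functions is the one generated by the evaluations
  \<open>N \<mapsto> N(B)\<close>.
\<close>

definition exceedance_process ::
    "(nat \<Rightarrow> real \<Rightarrow> 'w \<Rightarrow> real) \<Rightarrow> nat \<Rightarrow> real \<Rightarrow> 'w \<Rightarrow> real set \<Rightarrow> real" where
  "exceedance_process Xs n c \<omega> = (\<lambda>B\<in>sets borel.
     \<Sum>i<n. measure (return borel (SUP t\<in>{0..1}. Xs i t \<omega> / c)) (B \<inter> {0..<1}))"

definition point_measure_space :: "(real set \<Rightarrow> real) measure" where
  "point_measure_space = (\<Pi>\<^sub>M B\<in>sets (borel :: real measure). borel)"

definition exceedance_count ::
    "(nat \<Rightarrow> real \<Rightarrow> 'w \<Rightarrow> real) \<Rightarrow> nat \<Rightarrow> real \<Rightarrow> 'w \<Rightarrow> nat" where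
  "exceedance_count Xs n c \<omega> = card {i. i < n \<and> (\<forall>t\<in>{0..1}. c < Xs i t \<omega>)}"

definition local_parameter :: "real \<Rightarrow> (nat \<Rightarrow> real) \<Rightarrow> real \<Rightarrow> nat \<Rightarrow> real" where
  "local_parameter \<theta>0 c \<xi> n = \<theta>0 + \<xi> * (real n * \<bar>c n\<bar>) powr (- 1 / 2)"

text \<open>
  \<open>regular_estimator P Xs \<theta>0 c est Q\<close>: the sequence \<open>est\<close> is based on the point processes
  \<open>N\<^sub>n\<^sub>,\<^sub>c\<^sub>n\<close> and regular at \<open>\<theta>0\<close> with limit distribution \<open>Q\<close>, where \<open>P \<theta>\<close> is the
  probability measure for the parameter \<open>\<theta> \<in> (0,1)\<close>. The local parameters lie in \<open>(0,1)\<close>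
  only for large \<open>n\<close>, which is all that the limit depends on.
\<close>

definition regular_estimator ::
    "(real \<Rightarrow> 'w measure) \<Rightarrow> (nat \<Rightarrow> real \<Rightarrow> 'w \<Rightarrow> real) \<Rightarrow> real \<Rightarrow> (nat \<Rightarrow> real) \<Rightarrow>
      (nat \<Rightarrow> 'w \<Rightarrow> real) \<Rightarrow> real measure \<Rightarrow> bool" where
  "regular_estimator P Xs \<theta>0 c est Q \<longleftrightarrow>
     (\<forall>n. \<exists>T \<in> borel_measurable point_measure_space. \<forall>\<theta>\<in>{0<..<1}. \<forall>\<omega>\<in>space (P \<theta>).
        est n \<omega> = T (exceedance_process Xs n (c n) \<omega>)) \<and>
     real_distribution Q \<and>
     (\<forall>\<xi>. weak_conv_m
        (\<lambda>n. distr (P (local_parameter \<theta>0 c \<xi> n)) borel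
           (\<lambda>\<omega>. (real n * \<bar>c n\<bar>) powr (1 / 2) * (est n \<omega> - local_parameter \<theta>0 c \<xi> n))) Q)"

definition has_variance :: "real measure \<Rightarrow> real \<Rightarrow> bool" where
  "has_variance Q v \<longleftrightarrow>
     integrable Q (\<lambda>x. x\<^sup>2) \<and> prob_space.variance Q (\<lambda>x. x) = v"

end

theory Submission
  imports Defs
begin

text \<open>
  Only \<open>W = min 1 (sup\<^sub>t X\<^sub>t / c)\<close> of each copy enters the point process. The expansion (D) says
  that, for \<open>\<theta>\<close> near \<open>\<theta>0\<close>, the law of \<open>W\<close> has a density \<open>R = 1 + L (\<theta> - \<theta>0) + o\<close> on
  \<open>(0,1)\<close> with respect to the law under \<open>\<theta>0\<close>, and (C) says \<open>P\<^sub>\<theta>(X > c) = \<theta> \<bar>c\<bar> (1 + O(\<bar>c\<bar>\<^sup>\<delta>))\<close>;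
  comparing the two as \<open>c \<rightarrow> 0\<close> gives \<open>L = 1 / \<theta>0\<close>.

  The count of exceedances is binomial, so its centred and scaled version has an explicit
  characteristic function and Levy's theorem yields the limit \<open>N(0, \<theta>0)\<close>.

  For the lower bound no local asymptotic normality is needed: the Chapman--Robbins inequality,
  applied to bounded functions of an estimator and to the product of \<open>n\<close> likelihood ratios, whose
  chi-square distance is at most \<open>exp (n \<chi>\<^sup>2) - 1\<close> with \<open>n \<chi>\<^sup>2 \<rightarrow> \<xi>\<^sup>2 / \<theta>0\<close>, passes to the limit as
  \<open>\<xi>\<^sup>2 \<le> v (exp (\<xi>\<^sup>2 / \<theta>0) - 1)\<close> for the limit variance \<open>v\<close>; then \<open>\<xi> \<rightarrow> 0\<close>.
\<close>

section \<open>Suprema of paths\<close>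

text \<open>The constants in (C) may depend on \<open>\<theta>\<close>, so (C) gives no uniform
  control along parameters that move with \<open>n\<close>. Its rate is used at
  \<open>\<theta>0\<close> only, and its limit at a fixed neighbour determines \<open>L\<close>. The
  uniform expansion (D) then carries the exceedance probability from \<open>\<theta>0\<close> to the
  local parameters; because \<open>L * \<theta>0 = 1\<close>, its linear term reproduces exactly the
  shift of the parameter, and no bias is left. The condition on n |c|^(1 + 2 min(\<delta>,
  \<gamma>)) is what this takes: errors of order |c|^\<delta> from (C) and |c|^\<gamma> from (D)
  must vanish after multiplication by sqrt (n |c|). Two more obstacles: (C) concerns
  \<open>V > f\<close>, while the D-norm formula of a Pareto process concerns
  \<open>V \<le> f\<close>; inclusion-exclusion over times connects them, and unimodality of
  \<open>\<psi>\<close> reduces it to the end points 0 and 1. And weak convergence does not control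
  the variances at finite \<open>n\<close>, so the bound is taken to the limit for bounded
  continuous functions, and the truncation is removed only under the limit law.\<close>

definition rat01 :: "real set" where "rat01 = {0..1} \<inter> \<rat>"

lemma countable_rat01: "countable rat01"
  unfolding rat01_def using countable_rat by blast

lemma rat01_ne: "rat01 \<noteq> {}"
proof -
  have "0 \<in> rat01" by (simp add: rat01_def)
  then show ?thesis by blast
qed

lemma rat01_subset: "rat01 \<subseteq> {0..1}"
  by (simp add: rat01_def)

lemma closure_rat01: "closure rat01 = {0..1}"
proof
  show "closure rat01 \<subseteq> {0..1}"
    by (intro closure_minimal rat01_subset closed_atLeastAtMost)
  have "t \<in> closure rat01" if t: "t \<in> {0..1}" for t :: real
    unfolding closure_approachable
  proof (intro allI impI)
    fix e :: real assume e: "e > 0"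
    have "max 0 (t - e) < min 1 (t + e)"
      using t e by auto
    from Rats_dense_in_real[OF this] obtain q where "q \<in> \<rat>" "max 0 (t - e) < q" "q < min 1 (t + e)"
      by blast
    then show "\<exists>y\<in>rat01. dist y t < e"
      by (intro bexI[of _ q]) (auto simp: rat01_def dist_real_def)
  qed
  then show "{0..1} \<subseteq> closure rat01" by blast
qed

lemma cont_le_rat01:
  fixes f :: "real \<Rightarrow> real"
  assumes "continuous_on {0..1} f" "\<And>t. t \<in> rat01 \<Longrightarrow> f t \<le> a" "t \<in> {0..1}"
  shows "f t \<le> a"
  using continuous_le_on_closure[of rat01 f t a] assms by (simp add: closure_rat01)

text \<open>
  Clipping at 1 keeps the supremum over the rationals bounded, hence measurable, on all of
  \<open>path_space\<close> and not only on continuous paths; it loses nothing, as the point process only sees \<open>[0,1)\<close>.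
\<close>

definition clipped_sup :: "real \<Rightarrow> (real \<Rightarrow> real) \<Rightarrow> real" where
  "clipped_sup c y = (SUP t\<in>rat01. min 1 (y t / c))"

lemma clipped_sup_measurable [measurable]: "clipped_sup c \<in> borel_measurable path_space"
  unfolding clipped_sup_def path_space_def
proof (rule borel_measurable_cSUP[OF countable_rat01])
  fix t assume "t \<in> rat01"
  then have [measurable]: "t \<in> {0..1}" using rat01_subset by blast
  show "(\<lambda>y. min 1 (y t / c)) \<in> borel_measurable (Pi\<^sub>M {0..1} (\<lambda>t. borel :: real measure))"
    using \<open>t \<in> {0..1}\<close> by measurable
next
  fix y show "bdd_above ((\<lambda>t. min 1 (y t / c)) ` rat01)"
    by (intro bdd_aboveI[of _ 1]) auto
qed

lemma SUP_attained:
  fixes g :: "real \<Rightarrow> real"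
  assumes "continuous_on {0..1} g"
  obtains t where "t \<in> {0..1}" "g t = (SUP t\<in>{0..1}. g t)" "\<And>s. s \<in> {0..1} \<Longrightarrow> g s \<le> g t"
proof -
  obtain t where t: "t \<in> {0..1}" "\<And>s. s \<in> {0..1} \<Longrightarrow> g s \<le> g t"
    using continuous_attains_sup[of "{0..1::real}" g] assms by auto
  have "(SUP t\<in>{0..1}. g t) = g t"
    by (rule cSup_eq_maximum) (use t in auto)
  with t that show ?thesis by metis
qed

text \<open>The supremum over [0,1] is attained at some \<open>t\<close>; the bound by the supremum
  over the rationals passes to this \<open>t\<close> by continuity of the clipped path.\<close>

lemma clipped_sup_path:
  assumes "continuous_on {0..1} (\<lambda>t. X t \<omega>)"
  shows "clipped_sup c (path01 X \<omega>) = min 1 (SUP t\<in>{0..1}. X t \<omega> / c)"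
proof -
  define g where "g = (\<lambda>t. X t \<omega> / c)"
  have g: "continuous_on {0..1} g"
    unfolding g_def by (cases "c = 0") (auto intro!: continuous_intros assms)
  obtain t where t: "t \<in> {0..1}" "g t = (SUP t\<in>{0..1}. g t)" "\<And>s. s \<in> {0..1} \<Longrightarrow> g s \<le> g t"
    using SUP_attained[OF g] by blast
  have eq: "clipped_sup c (path01 X \<omega>) = (SUP t\<in>rat01. min 1 (g t))"
    unfolding clipped_sup_def g_def path01_def using rat01_subset
    by (intro arg_cong[where f=Sup] image_cong) auto
  have bdd: "bdd_above ((\<lambda>t. min 1 (g t)) ` rat01)"
    by (intro bdd_aboveI[of _ 1]) auto
  have "(SUP t\<in>rat01. min 1 (g t)) \<le> min 1 (g t)"
    using t(3) rat01_subset by (intro cSUP_least rat01_ne) (auto simp: min_le_iff_disj)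
  moreover have "min 1 (g t) \<le> (SUP t\<in>rat01. min 1 (g t))"
  proof (rule cont_le_rat01[where f="\<lambda>t. min 1 (g t)"])
    show "continuous_on {0..1} (\<lambda>t. min 1 (g t))"
      by (intro continuous_on_min continuous_on_const g)
  qed (use t(1) bdd in \<open>auto intro: cSUP_upper\<close>)
  ultimately show ?thesis unfolding eq using t(2) g_def by (metis order_antisym)
qed

text \<open>Since the supremum is attained, the strict inequality at every time survives in the
  supremum. Clipping at 1 cannot affect a comparison with \<open>u \<le> 1\<close>, and division by
  \<open>c < 0\<close> reverses the order.\<close>

lemma clipped_sup_less_iff:
  assumes "continuous_on {0..1} (\<lambda>t. X t \<omega>)" "c < 0" "0 < u" "u \<le> 1"
  shows "clipped_sup c (path01 X \<omega>) < u \<longleftrightarrow> (\<forall>t\<in>{0..1}. u * c < X t \<omega>)"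
proof -
  have "continuous_on {0..1} (\<lambda>t. X t \<omega> / c)"
    using assms by (intro continuous_intros) auto
  from SUP_attained[OF this] obtain t where t: "t \<in> {0..1}" 
    "X t \<omega> / c = (SUP t\<in>{0..1}. X t \<omega> / c)" "\<And>s. s \<in> {0..1} \<Longrightarrow> X s \<omega> / c \<le> X t \<omega> / c"
    by blast
  have "clipped_sup c (path01 X \<omega>) < u \<longleftrightarrow> X t \<omega> / c < u"
    using assms t(2) by (auto simp: clipped_sup_path min_less_iff_disj)
  also have "\<dots> \<longleftrightarrow> (\<forall>t\<in>{0..1}. X t \<omega> / c < u)"
    using t by fastforce
  also have "\<dots> \<longleftrightarrow> (\<forall>t\<in>{0..1}. u * c < X t \<omega>)"
    using assms(2) by (simp add: divide_less_eq mult.commute)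
  finally show ?thesis .
qed

lemma path01_measurable:
  assumes "continuous_process M X"
  shows "path01 X \<in> M \<rightarrow>\<^sub>M path_space"
proof -
  have "(\<lambda>\<omega>. \<lambda>t\<in>{0..1}. X t \<omega>) \<in> M \<rightarrow>\<^sub>M (\<Pi>\<^sub>M t\<in>{0..1}. borel)"
    by (rule measurable_restrict) (use assms in \<open>auto simp: continuous_process_def\<close>)
  then show ?thesis by (simp add: path01_def[abs_def] path_space_def)
qed

definition sup_law :: "'a measure \<Rightarrow> (real \<Rightarrow> 'a \<Rightarrow> real) \<Rightarrow> real \<Rightarrow> real measure" where
  "sup_law M X c = distr M borel (\<lambda>\<omega>. clipped_sup c (path01 X \<omega>))"

lemma clipped_sup_path_measurable:
  assumes "continuous_process M X"
  shows "(\<lambda>\<omega>. clipped_sup c (path01 X \<omega>)) \<in> borel_measurable M"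
  using measurable_compose[OF path01_measurable[OF assms] clipped_sup_measurable] .

lemma measure_sup_law_lessThan:
  assumes "continuous_process M X" "c < 0" "0 < u" "u \<le> 1"
  shows "measure (sup_law M X c) {..<u} = prob_gt M X (\<lambda>t. u * c)"
proof -
  have "(\<lambda>\<omega>. clipped_sup c (path01 X \<omega>)) -` {..<u} \<inter> space M
      = {\<omega> \<in> space M. \<forall>t\<in>{0..1}. u * c < X t \<omega>}"
    using assms by (auto simp: continuous_process_def clipped_sup_less_iff)
  then show ?thesis
    unfolding sup_law_def prob_gt_def
    by (subst measure_distr) (auto intro!: clipped_sup_path_measurable assms)
qed

lemma real_distribution_sup_law:
  assumes "continuous_process M X"
  shows "real_distribution (sup_law M X c)"
  unfolding sup_law_def
  using assms prob_space.real_distribution_distr[OF _ clipped_sup_path_measurable[OF assms]]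
  by (simp add: continuous_process_def)

lemma measure_sup_law_greater_one:
  assumes "continuous_process M X"
  shows "measure (sup_law M X c) {1<..} = 0"
proof -
  have "(\<lambda>\<omega>. clipped_sup c (path01 X \<omega>)) -` {1<..} \<inter> space M = {}"
    using assms by (auto simp: continuous_process_def clipped_sup_path)
  then show ?thesis
    unfolding sup_law_def
    by (subst measure_distr) (auto intro!: clipped_sup_path_measurable assms)
qed

section \<open>The point process as a measurable function of \<open>n\<close> real variables\<close>

definition count_measure_of :: "nat \<Rightarrow> (nat \<Rightarrow> real) \<Rightarrow> real set \<Rightarrow> real" where
  "count_measure_of n w = (\<lambda>B\<in>sets borel. \<Sum>i<n. indicator (B \<inter> {0..<1}) (w i))"

lemma count_measure_of_measurable [measurable]:
  "count_measure_of n \<in> (\<Pi>\<^sub>M i\<in>{..<n}. borel) \<rightarrow>\<^sub>M point_measure_space"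
  unfolding count_measure_of_def point_measure_space_def
  by (intro measurable_restrict borel_measurable_sum measurable_compose[OF
        measurable_component_singleton borel_measurable_indicator]) auto

text \<open>Clipping only moves points above 1 to 1, and every set counted is intersected with
  [0,1). Hence any statistic of the point process is a function of the \<open>n\<close> clipped
  suprema, and product measures on the line replace path spaces.\<close>

lemma exceedance_process_eq:
  fixes Xs :: "nat \<Rightarrow> real \<Rightarrow> 'w \<Rightarrow> real"
  assumes "\<And>i. continuous_on {0..1} (\<lambda>t. Xs i t \<omega>)"
  shows "exceedance_process Xs n c \<omega> =
    count_measure_of n (\<lambda>i\<in>{..<n}. clipped_sup c (path01 (Xs i) \<omega>))"
  unfolding exceedance_process_def count_measure_of_def
  by (intro restrict_ext sum.cong refl)
     (auto simp: measure_return clipped_sup_path assms min_def indicator_def)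

lemma exceedance_count_eq_process:
  fixes Xs :: "nat \<Rightarrow> real \<Rightarrow> 'w \<Rightarrow> real" and c :: real
  assumes cont: "\<And>i. continuous_on {0..1} (\<lambda>t. Xs i t \<omega>)"
    and nonpos: "\<And>i t. t \<in> {0..1} \<Longrightarrow> Xs i t \<omega> \<le> 0" and c: "c < 0"
  shows "exceedance_process Xs n c \<omega> {0..<1} = real (exceedance_count Xs n c \<omega>)"
    and "real (exceedance_count Xs n c \<omega>) =
      (\<Sum>i<n. indicator {..<1} (clipped_sup c (path01 (Xs i) \<omega>)))"
proof -
  \<comment> \<open>Nonpositive paths divided by \<open>c < 0\<close> are nonnegative, so
    \<open>< 1\<close> and membership in [0,1) agree; the value at time 0 already gives the lower
    bound.\<close>
  have nn: "0 \<le> clipped_sup c (path01 (Xs i) \<omega>)" for i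
  proof -
    have "0 \<le> min 1 (Xs i 0 \<omega> / c)"
      using nonpos[of 0 i] c by (simp add: divide_nonpos_neg)
    also have "min 1 (Xs i 0 \<omega> / c) \<le> clipped_sup c (path01 (Xs i) \<omega>)"
      unfolding clipped_sup_def
      by (rule cSUP_upper2[where x="0::real"])
         (auto simp: path01_def rat01_def intro!: bdd_aboveI[of _ 1])
    finally show ?thesis .
  qed
  have *: "(\<forall>t\<in>{0..1}. c < Xs i t \<omega>) \<longleftrightarrow> clipped_sup c (path01 (Xs i) \<omega>) < 1" for i
    using clipped_sup_less_iff[of "Xs i" \<omega> c 1] cont c by simp
  have "real (exceedance_count Xs n c \<omega>) =
      real (card {i\<in>{..<n}. clipped_sup c (path01 (Xs i) \<omega>) < 1})"
    unfolding exceedance_count_def * by simp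
  also have "\<dots> = (\<Sum>i<n. indicator {i. clipped_sup c (path01 (Xs i) \<omega>) < 1} i)"
    by (simp add: sum.If_cases indicator_def Int_def)
  finally show "real (exceedance_count Xs n c \<omega>) =
      (\<Sum>i<n. indicator {..<1} (clipped_sup c (path01 (Xs i) \<omega>)))"
    by (simp add: indicator_def)
  also have "\<dots> = exceedance_process Xs n c \<omega> {0..<1}"
  proof -
    have "exceedance_process Xs n c \<omega> =
        count_measure_of n (\<lambda>i\<in>{..<n}. clipped_sup c (path01 (Xs i) \<omega>))"
      by (rule exceedance_process_eq) (rule cont)
    with nn show ?thesis
      by (auto simp: count_measure_of_def indicator_def intro!: sum.cong)
  qed
  finally show "exceedance_process Xs n c \<omega> {0..<1} = real (exceedance_count Xs n c \<omega>)" ..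
qed

section \<open>Tail probabilities of generalized Pareto processes\<close>

text \<open>Test functions that extract finite-dimensional distributions from an identity for
  functions: off \<open>T\<close> the bound 0 is no restriction on nonpositive paths. Their jumps
  are allowed in \<open>E01\<close>.\<close>

definition spike :: "real \<Rightarrow> real set \<Rightarrow> real \<Rightarrow> real" where
  "spike x T t = (if t \<in> T then - x else 0)"

lemma const_E01_nonpos:
  assumes "x \<ge> 0"
  shows "(\<lambda>t. - x) \<in> E01_nonpos" "sup_norm01 (\<lambda>t. - x) = x"
  using assms by (auto simp: E01_nonpos_def E01_def sup_norm01_def image_constant_conv)

lemma spike_E01_nonpos:
  assumes "finite T" "x \<ge> 0"
  shows "spike x T \<in> E01_nonpos" "sup_norm01 (spike x T) \<le> x"
proof -
  have "continuous (at t within {0..1}) (spike x T)" if "t \<notin> T" for t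
  proof -
    have "\<forall>\<^sub>F s in at t within {0..1}. s \<in> - T"
      using assms(1) that
      by (intro eventually_at_topological[THEN iffD2] exI[of _ "- T"])
         (auto intro!: open_Compl finite_imp_closed)
    then have "\<forall>\<^sub>F s in at t within {0..1}. spike x T s = 0"
      by eventually_elim (auto simp: spike_def)
    with that show ?thesis
      by (subst continuous_at_within_cong[where g="\<lambda>_. 0"]) (auto simp: spike_def)
  qed
  then have "{t \<in> {0..1}. \<not> continuous (at t within {0..1}) (spike x T)} \<subseteq> T"
    by blast
  with assms(1) have "finite {t \<in> {0..1}. \<not> continuous (at t within {0..1}) (spike x T)}"
    using finite_subset by blast
  moreover have "bounded (spike x T ` {0..1})"
    using assms by (intro boundedI[of _ x]) (auto simp: spike_def)
  ultimately show "spike x T \<in> E01_nonpos"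
    using assms by (auto simp: E01_nonpos_def E01_def spike_def)
  show "sup_norm01 (spike x T) \<le> x"
    unfolding sup_norm01_def using assms by (intro cSUP_least) (auto simp: spike_def)
qed

text \<open>As \<open>\<psi>\<close> is positive, times outside \<open>T\<close>, which contribute
  0, never determine the supremum.\<close>

lemma D_norm_spike:
  assumes T: "finite T" "T \<noteq> {}" "T \<subseteq> {0..1}" and x: "x \<ge> 0" and pos: "\<And>s. \<psi> s > 0"
  shows "D_norm \<psi> \<beta> (spike x T) = x * (LINT s|lborel. (MAX t\<in>T. \<psi> (s - \<beta> * t)))"
proof -
  have "(SUP t\<in>{0..1}. \<bar>spike x T t\<bar> * \<psi> (s - \<beta> * t)) = x * (MAX t\<in>T. \<psi> (s - \<beta> * t))" for s
  proof (rule cSup_eq_maximum)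
    have "(MAX t\<in>T. \<psi> (s - \<beta> * t)) \<in> (\<lambda>t. \<psi> (s - \<beta> * t)) ` T"
      using T by (intro Max_in) auto
    then obtain t0 where t0: "t0 \<in> T" "(MAX t\<in>T. \<psi> (s - \<beta> * t)) = \<psi> (s - \<beta> * t0)"
      by blast
    then show "x * (MAX t\<in>T. \<psi> (s - \<beta> * t)) \<in> (\<lambda>t. \<bar>spike x T t\<bar> * \<psi> (s - \<beta> * t)) ` {0..1}"
      using T x by (intro image_eqI[of _ _ t0]) (auto simp: spike_def)
    fix y assume "y \<in> (\<lambda>t. \<bar>spike x T t\<bar> * \<psi> (s - \<beta> * t)) ` {0..1}"
    then obtain t where t: "y = \<bar>spike x T t\<bar> * \<psi> (s - \<beta> * t)" by blast
    show "y \<le> x * (MAX t\<in>T. \<psi> (s - \<beta> * t))"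
    proof (cases "t \<in> T")
      case True
      then have "\<psi> (s - \<beta> * t) \<le> (MAX t\<in>T. \<psi> (s - \<beta> * t))"
        using T by (intro Max_ge) auto
      with True show ?thesis unfolding t using x by (auto simp: spike_def intro: mult_left_mono)
    next
      case False
      with t0 show ?thesis unfolding t using x less_imp_le[OF pos] by (simp add: spike_def)
    qed
  qed
  then show ?thesis by (simp add: D_norm_def)
qed

text \<open>\<open>V0\<close> makes almost all paths nonpositive, so the spike imposes nothing off
  \<open>T\<close>. Measurability of that event comes from the rational times.\<close>

lemma prob_le_spike:
  assumes V: "continuous_process N V" and V0: "prob_le N V (\<lambda>_. 0) = 1" and T: "finite T" "T \<subseteq> {0..1}"
    and x: "x \<ge> 0"
  shows "prob_le N V (spike x T) = measure N {\<omega>\<in>space N. \<forall>t\<in>T. V t \<omega> \<le> - x}"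
proof -
  interpret prob_space N using V by (simp add: continuous_process_def)
  have [measurable]: "V t \<in> borel_measurable N" if "t \<in> {0..1}" for t
    using V that by (simp add: continuous_process_def)
  have [measurable]: "V t \<in> borel_measurable N" if "t \<in> T" for t
    using that T by auto
  have [measurable]: "V t \<in> borel_measurable N" if "t \<in> rat01" for t
    using that rat01_subset by auto
  have 1: "(\<forall>t\<in>{0..1}. V t \<omega> \<le> 0) \<longleftrightarrow> (\<forall>t\<in>rat01. V t \<omega> \<le> 0)" if "\<omega> \<in> space N" for \<omega>
    using V that cont_le_rat01[of "\<lambda>t. V t \<omega>" 0] rat01_subset
    by (auto simp: continuous_process_def)
  have "{\<omega>\<in>space N. \<forall>t\<in>rat01. V t \<omega> \<le> 0} \<in> sets N"
    using countable_rat01 by measurable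
  then have Z: "{\<omega>\<in>space N. \<forall>t\<in>{0..1}. V t \<omega> \<le> 0} \<in> sets N"
    using 1 by (simp cong: conj_cong)
  have S: "{\<omega>\<in>space N. \<forall>t\<in>T. V t \<omega> \<le> - x} \<in> sets N"
    using countable_finite[OF T(1)] by measurable
  have eq: "{\<omega>\<in>space N. \<forall>t\<in>{0..1}. V t \<omega> \<le> spike x T t} =
    {\<omega>\<in>space N. \<forall>t\<in>T. V t \<omega> \<le> - x} \<inter> {\<omega>\<in>space N. \<forall>t\<in>{0..1}. V t \<omega> \<le> 0}"
    using T x by (auto simp: spike_def)
  have "AE \<omega> in N. \<omega> \<in> {\<omega>\<in>space N. \<forall>t\<in>{0..1}. V t \<omega> \<le> 0}"
    using V0 unfolding prob_le_def by (rule AE_prob_1)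
  then have "measure N {\<omega>\<in>space N. \<forall>t\<in>{0..1}. V t \<omega> \<le> spike x T t} =
      measure N {\<omega>\<in>space N. \<forall>t\<in>T. V t \<omega> \<le> - x}"
    unfolding eq using S Z by (intro measure_eq_AE) (auto simp: Int_def)
  then show ?thesis by (simp add: prob_le_def)
qed

section \<open>The density \<open>\<psi>\<close> and the parametrisation by
  \<open>\<theta>\<close>\<close>

locale profile_density =
  fixes \<psi> :: "real \<Rightarrow> real"
  assumes cont: "continuous_on UNIV \<psi>"
    and pos: "\<And>s. \<psi> s > 0"
    and int: "integrable lborel \<psi>" and int1: "(LINT s|lborel. \<psi> s) = 1"
    and even: "\<And>s. \<psi> s = \<psi> (- s)"
    and decreasing: "antimono_on {0..} \<psi>"
begin

lemma abs_mono: "\<bar>s\<bar> \<le> \<bar>r\<bar> \<Longrightarrow> \<psi> r \<le> \<psi> s"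
proof -
  have "\<psi> \<bar>s\<bar> = \<psi> s" for s using even[of s] by (simp add: abs_if)
  then show "\<bar>s\<bar> \<le> \<bar>r\<bar> \<Longrightarrow> \<psi> r \<le> \<psi> s"
    using monotone_onD[OF decreasing, of "\<bar>s\<bar>" "\<bar>r\<bar>"] by simp
qed

lemma psi_measurable [measurable]: "\<psi> \<in> borel_measurable borel"
  using int by (simp add: borel_measurable_integrable)

lemma int_shift: "integrable lborel (\<lambda>s. \<psi> (s - a))" "(LINT s|lborel. \<psi> (s - a)) = 1"
  using lborel_integrable_real_affine[OF int, of 1 "- a"]
    lborel_integral_real_affine[of 1 \<psi> "- a"] int1 by simp_all

text \<open>The point \<open>s - \<beta> * t\<close> lies between \<open>s - \<beta>\<close> and
  \<open>s\<close>, so it is at most as far from 0 as one of these two, and \<open>\<psi>\<close>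
  decreases with the distance from 0.\<close>

lemma min_le_between:
  assumes "t \<in> {0..1}" "\<beta> > 0"
  shows "min (\<psi> s) (\<psi> (s - \<beta>)) \<le> \<psi> (s - \<beta> * t)"
proof -
  have "0 \<le> \<beta> * t" "\<beta> * t \<le> \<beta>"
    using assms by (auto intro: mult_left_le)
  then have "\<bar>s - \<beta> * t\<bar> \<le> \<bar>s\<bar> \<or> \<bar>s - \<beta> * t\<bar> \<le> \<bar>s - \<beta>\<bar>"
    by linarith
  then show ?thesis using abs_mono by (auto simp: min_le_iff_disj)
qed

text \<open>The two translates of the symmetric density cross at \<open>\<beta> / 2\<close>: to the
  left the minimum is the tail of the one centred at \<open>\<beta>\<close>, to the right that of
  the one centred at 0, and both tails have mass \<open>distr_fun \<psi> (- \<beta> / 2)\<close>.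
  This is where the parameter \<open>\<theta>\<close> comes from.\<close>

lemma integral_min:
  assumes "\<beta> > 0"
  shows "(LINT s|lborel. min (\<psi> s) (\<psi> (s - \<beta>))) = 2 * distr_fun \<psi> (- \<beta> / 2)"
proof -
  let ?f = "\<lambda>s. indicator {..\<beta>/2} s * \<psi> (s - \<beta>)" and ?g = "\<lambda>s. indicator {\<beta>/2<..} s * \<psi> s"
  have i: "integrable lborel ?f" "integrable lborel ?g"
    using integrable_mult_indicator[OF _ int_shift(1), of "{..\<beta>/2}" \<beta>]
      integrable_mult_indicator[OF _ int, of "{\<beta>/2<..}"] by simp_all
  have "(LINT s|lborel. min (\<psi> s) (\<psi> (s - \<beta>))) = (LINT s|lborel. ?f s + ?g s)"
  proof (rule Bochner_Integration.integral_cong[OF refl])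
    fix s show "min (\<psi> s) (\<psi> (s - \<beta>)) = ?f s + ?g s"
    proof (cases "s \<le> \<beta> / 2")
      case True
      then have "\<psi> (s - \<beta>) \<le> \<psi> s" using assms by (intro abs_mono) linarith
      with True show ?thesis by (simp add: indicator_def)
    next
      case False
      then have "\<psi> s \<le> \<psi> (s - \<beta>)" using assms by (intro abs_mono) linarith
      with False show ?thesis by (simp add: indicator_def)
    qed
  qed
  also have "\<dots> = integral\<^sup>L lborel ?f + integral\<^sup>L lborel ?g"
    using i by simp
  also have "integral\<^sup>L lborel ?f = distr_fun \<psi> (- \<beta> / 2)"
    unfolding distr_fun_def set_lebesgue_integral_def
    by (subst lborel_integral_real_affine[of 1 _ \<beta>])
       (auto simp: indicator_def intro!: Bochner_Integration.integral_cong)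
  also have "integral\<^sup>L lborel ?g = distr_fun \<psi> (- \<beta> / 2)"
  proof -
    have "integral\<^sup>L lborel ?g = (LINT s|lborel. indicator {..<-\<beta>/2} s * \<psi> s)"
      by (subst lborel_integral_real_affine[of "-1" _ 0])
         (auto simp: indicator_def even[symmetric] intro!: Bochner_Integration.integral_cong)
    also have "\<dots> = distr_fun \<psi> (- \<beta> / 2)"
      unfolding distr_fun_def set_lebesgue_integral_def
      by (rule integral_cong_AE)
         (use AE_lborel_singleton[of "-\<beta>/2"] in \<open>auto simp: indicator_def elim!: eventually_mono\<close>)
    finally show ?thesis .
  qed
  finally show ?thesis by simp
qed

lemma distr_fun_zero: "distr_fun \<psi> 0 = 1 / 2"
proof -
  let ?f = "\<lambda>s. indicator {..0} s * \<psi> s" and ?g = "\<lambda>s. indicator {0<..} s * \<psi> s"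
  have i: "integrable lborel ?f" "integrable lborel ?g"
    using integrable_mult_indicator[OF _ int, of "{..0}"]
      integrable_mult_indicator[OF _ int, of "{0<..}"] by simp_all
  have "1 = (LINT s|lborel. ?f s + ?g s)"
    unfolding int1[symmetric]
    by (rule Bochner_Integration.integral_cong) (auto simp: indicator_def)
  also have "\<dots> = integral\<^sup>L lborel ?f + integral\<^sup>L lborel ?g"
    using i by simp
  also have "integral\<^sup>L lborel ?g = integral\<^sup>L lborel ?f"
  proof -
    have "integral\<^sup>L lborel ?g = (LINT s|lborel. indicator {..<0} s * \<psi> s)"
      by (subst lborel_integral_real_affine[of "-1" _ 0])
         (auto simp: indicator_def even[symmetric] intro!: Bochner_Integration.integral_cong)
    also have "\<dots> = integral\<^sup>L lborel ?f"
      by (rule integral_cong_AE)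
         (use AE_lborel_singleton[of "0::real"] in \<open>auto simp: indicator_def elim!: eventually_mono\<close>)
    finally show ?thesis .
  qed
  finally show ?thesis by (simp add: distr_fun_def set_lebesgue_integral_def)
qed

lemma distr_fun_strict_mono:
  assumes "x < y" shows "distr_fun \<psi> x < distr_fun \<psi> y"
proof -
  \<comment> \<open>A positive lower bound of \<open>\<psi>\<close> on the interval, by
    \<open>abs_mono\<close>.\<close>
  define m where "m = \<psi> (max \<bar>x\<bar> \<bar>y\<bar>)"
  have i: "integrable lborel (\<lambda>s. indicator A s * \<psi> s)" if "A \<in> sets borel" for A
    using integrable_mult_indicator[OF _ int, of A] that by simp
  have "0 < m * (y - x)" using assms pos by (simp add: m_def)
  also have "\<dots> = (LINT s|lborel. indicator {x<..y} s * m)"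
    using assms by simp
  also have "\<dots> \<le> (LINT s|lborel. indicator {x<..y} s * \<psi> s)"
  proof (rule integral_mono)
    show "integrable lborel (\<lambda>s. indicator {x<..y} s * m)"
      using assms by (intro integrable_mult_left integrable_real_indicator) auto
    show "indicator {x<..y} s * m \<le> indicator {x<..y} s * \<psi> s" for s
      unfolding m_def by (auto simp: indicator_def intro!: abs_mono)
  qed (rule i, simp)
  also have "\<dots> = (LINT s|lborel. indicator {..y} s * \<psi> s - indicator {..x} s * \<psi> s)"
    using assms by (intro Bochner_Integration.integral_cong) (auto simp: indicator_def)
  also have "\<dots> = distr_fun \<psi> y - distr_fun \<psi> x"
    unfolding distr_fun_def set_lebesgue_integral_def using i[of "{..y}"] i[of "{..x}"] by simp
  finally show ?thesis by simp
qed

text \<open>The definite description needs existence and uniqueness: the intermediate value theorem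
  applies because the distribution function tends to 0 on the left and equals 1/2 > \<theta>/2 at 0,
  and strict monotonicity does the rest. The law \<open>D\<close> with density \<open>\<psi>\<close>
  serves to borrow continuity and the limit from the theory of \<open>cdf\<close>.\<close>

lemma beta_of:
  assumes "\<theta> \<in> {0<..<1}"
  shows "beta_of \<psi> \<theta> > 0" "\<theta> = 2 * distr_fun \<psi> (- beta_of \<psi> \<theta> / 2)"
proof -
  define D where "D = density lborel (\<lambda>s. ennreal (\<psi> s))"
  have nn: "0 \<le> \<psi> s" for s using pos[of s] by simp
  have mD: "measure D A = (LINT s|lborel. indicator A s * \<psi> s)" if [measurable]: "A \<in> sets borel" for A
  proof -
    have "emeasure D A = (\<integral>\<^sup>+s. ennreal (indicator A s * \<psi> s) \<partial>lborel)"
      unfolding D_def using that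
      by (subst emeasure_density) (auto intro!: nn_integral_cong simp: indicator_def)
    also have "\<dots> = ennreal (LINT s|lborel. indicator A s * \<psi> s)"
      using integrable_mult_indicator[OF _ int, of A] that nn by (intro nn_integral_eq_integral) auto
    finally show ?thesis
      using nn by (simp add: measure_def Bochner_Integration.integral_nonneg)
  qed
  have "prob_space D"
  proof
    have "emeasure D (space D) = (\<integral>\<^sup>+s. ennreal (\<psi> s) \<partial>lborel)"
      unfolding D_def by (subst emeasure_density) auto
    also have "\<dots> = 1" using int nn int1 by (subst nn_integral_eq_integral) auto
    finally show "emeasure D (space D) = 1" .
  qed
  then interpret D: real_distribution D
    by (simp add: real_distribution_def real_distribution_axioms_def D_def)
  have F: "distr_fun \<psi> x = cdf D x" for x
    by (simp add: cdf_def mD distr_fun_def set_lebesgue_integral_def)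
  have "measure D {x} = 0" for x
  proof -
    have "AE s in lborel. indicator {x} s * \<psi> s = 0"
      using AE_lborel_singleton[of x] by eventually_elim simp
    then show ?thesis
      using mD[of "{x}"] by (simp add: integral_eq_zero_AE)
  qed
  then have contF: "isCont (distr_fun \<psi>) x" for x
    using D.isCont_cdf[of x] by (simp add: F[abs_def])
  have "(distr_fun \<psi> \<longlongrightarrow> 0) at_bot"
    using D.cdf_lim_at_bot by (simp add: F[abs_def])
  then have "\<forall>\<^sub>F x in at_bot. distr_fun \<psi> x < \<theta> / 2"
    using assms by (intro order_tendstoD) auto
  then have "\<exists>x\<le>0. distr_fun \<psi> x < \<theta> / 2"
    unfolding eventually_at_bot_linorder by (metis min.cobounded1 min.cobounded2)
  then obtain x0 where x0: "x0 \<le> 0" "distr_fun \<psi> x0 < \<theta> / 2" by blast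
  obtain x where x: "x \<le> 0" "distr_fun \<psi> x = \<theta> / 2"
    using IVT[of "distr_fun \<psi>" x0 "\<theta> / 2" 0] x0 contF assms distr_fun_zero by auto
  have "x \<noteq> 0" using x assms distr_fun_zero by auto
  have "\<exists>!\<beta>. \<beta> > 0 \<and> \<theta> = 2 * distr_fun \<psi> (- \<beta> / 2)"
  proof (rule ex1I[of _ "-2 * x"])
    show "-2 * x > 0 \<and> \<theta> = 2 * distr_fun \<psi> (- (-2 * x) / 2)" using x \<open>x \<noteq> 0\<close> by simp
    fix b assume b: "b > 0 \<and> \<theta> = 2 * distr_fun \<psi> (- b / 2)"
    then have "distr_fun \<psi> (- b / 2) = distr_fun \<psi> x" using x by simp
    then have "- b / 2 = x"
      using distr_fun_strict_mono[of "-b/2" x] distr_fun_strict_mono[of x "-b/2"] by linarith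
    then show "b = -2 * x" by simp
  qed
  from theI'[OF this] show "beta_of \<psi> \<theta> > 0" "\<theta> = 2 * distr_fun \<psi> (- beta_of \<psi> \<theta> / 2)"
    by (simp_all add: beta_of_def)
qed

end

section \<open>Exceedance probabilities of constant levels\<close>

context profile_density
begin

text \<open>For small \<open>x\<close>, inclusion-exclusion on the events
  \<open>V 0 \<le> -x\<close> and \<open>V 1 \<le> -x\<close> gives the probability that both end
  points exceed \<open>-x\<close> as \<open>x\<close> times the integral of
  \<open>min (z 0) (z 1)\<close>, which is \<open>x * \<theta>\<close>. It remains to see that a
  path above the level at both ends is above it throughout, up to null sets.\<close>

lemma gpp_prob_gt_const:
  assumes V: "standard_gpp \<psi> \<beta> N V" and \<beta>: "\<beta> > 0"
  shows "\<exists>x0>0. \<forall>x\<in>{0<..x0}. prob_gt N V (\<lambda>t. - x) = x * (2 * distr_fun \<psi> (- \<beta> / 2))"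
proof -
  have cp: "continuous_process N V" using V by (simp add: standard_gpp_def)
  interpret prob_space N using cp by (simp add: continuous_process_def)
  obtain x0 where x0: "x0 > 0"
    and D: "\<And>f. f \<in> E01_nonpos \<Longrightarrow> sup_norm01 f \<le> x0 \<Longrightarrow> prob_le N V f = 1 - D_norm \<psi> \<beta> f"
    using V unfolding standard_gpp_def by metis
  define \<theta> where "\<theta> = 2 * distr_fun \<psi> (- \<beta> / 2)"
  define z where "z t s = \<psi> (s - \<beta> * t)" for t s
  have [simp]: "integrable lborel (z t)" "integral\<^sup>L lborel (z t) = 1" for t
    unfolding z_def[abs_def] by (rule int_shift)+
  have \<theta>_eq: "(LINT s|lborel. min (z 0 s) (z 1 s)) = \<theta>"
    using integral_min[OF \<beta>] by (simp add: z_def \<theta>_def)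
  \<comment> \<open>The zero function has D-norm 0, so almost all paths of \<open>V\<close> are
    nonpositive.\<close>
  have V0: "prob_le N V (\<lambda>_. 0) = 1"
  proof -
    have "D_norm \<psi> \<beta> (\<lambda>_. 0) = 0" by (simp add: D_norm_def)
    then show ?thesis
      using D[of "\<lambda>_. 0"] const_E01_nonpos[of 0] x0 by simp
  qed
  have q: "measure N {\<omega>\<in>space N. \<forall>t\<in>T. V t \<omega> \<le> - x} = 1 - x * (LINT s|lborel. (MAX t\<in>T. z t s))"
    if "finite T" "T \<noteq> {}" "T \<subseteq> {0..1}" "x \<in> {0<..x0}" for T x
    using that D[of "spike x T"] spike_E01_nonpos[of T x] D_norm_spike[of T x \<psi> \<beta>] pos
      prob_le_spike[OF cp V0, of T x]
    by (simp add: z_def)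
  have Vm[measurable]: "V t \<in> borel_measurable N" if "t \<in> {0..1}" for t
    using cp that by (simp add: continuous_process_def)
  define A where "A x t = {\<omega>\<in>space N. V t \<omega> \<le> - x}" for x t
  have A[measurable, simp]: "A x t \<in> events" if "t \<in> {0..1}" for x t
    unfolding A_def using Vm[OF that] by measurable
  have qA: "prob (A x t) = 1 - x" if "t \<in> {0..1}" "x \<in> {0<..x0}" for t x
    using q[of "{t}" x] that by (simp add: A_def)
  have qAA: "prob (A x s \<inter> A x t) = 1 - x * (LINT u|lborel. max (z s u) (z t u))"
    if "s \<in> {0..1}" "t \<in> {0..1}" "x \<in> {0<..x0}" for s t x
  proof -
    have "A x s \<inter> A x t = {\<omega>\<in>space N. \<forall>r\<in>{s,t}. V r \<omega> \<le> - x}"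
      by (auto simp: A_def)
    with q[of "{s,t}" x] that show ?thesis by simp
  qed
  \<comment> \<open>Unimodality of \<open>\<psi>\<close> gives \<open>min (z 0) (z 1) \<le> z t\<close>, so by inclusion-exclusion a path above the
    constant \<open>-x\<close> at both endpoints is almost surely above it in between.\<close>
  have bad: "prob (A x t - (A x 0 \<union> A x 1)) = 0" if t: "t \<in> {0..1}" and x: "x \<in> {0<..x0}" for t x
  proof -
    have 3: "prob (A x t \<inter> (A x 0 \<inter> A x 1)) =
        1 - x * (LINT u|lborel. max (z t u) (max (z 0 u) (z 1 u)))"
    proof -
      have "A x t \<inter> (A x 0 \<inter> A x 1) = {\<omega>\<in>space N. \<forall>r\<in>{t,0,1}. V r \<omega> \<le> - x}"
        by (auto simp: A_def)
      with q[of "{t,0,1}" x] t x show ?thesis by simp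
    qed
    have "prob (A x t \<inter> (A x 0 \<union> A x 1)) = prob (A x t \<inter> A x 0) + prob (A x t \<inter> A x 1)
        - prob (A x t \<inter> (A x 0 \<inter> A x 1))"
      using t measure_Un3[of "A x t \<inter> A x 0" N "A x t \<inter> A x 1"]
      by (simp add: fmeasurable_eq_sets Int_Un_distrib Int_ac)
    moreover have "prob (A x t - (A x 0 \<union> A x 1)) = prob (A x t) - prob (A x t \<inter> (A x 0 \<union> A x 1))"
      using t by (intro finite_measure_Diff') auto
    ultimately have "prob (A x t - (A x 0 \<union> A x 1)) =
      x * (- 1 + (LINT u|lborel. max (z t u) (z 0 u)) + (LINT u|lborel. max (z t u) (z 1 u))
        - (LINT u|lborel. max (z t u) (max (z 0 u) (z 1 u))))"
      using t x by (simp add: qA qAA 3 algebra_simps)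
    also have "- 1 + (LINT u|lborel. max (z t u) (z 0 u)) + (LINT u|lborel. max (z t u) (z 1 u))
        - (LINT u|lborel. max (z t u) (max (z 0 u) (z 1 u))) =
        (LINT u|lborel. - z t u + max (z t u) (z 0 u) + max (z t u) (z 1 u)
        - max (z t u) (max (z 0 u) (z 1 u)))"
      by simp
    also have "\<dots> = (LINT (u::real)|lborel. 0)"
    proof (rule Bochner_Integration.integral_cong[OF refl])
      fix u
      \<comment> \<open>In general
        \<open>max a b + max a c = max a (max b c) + max a (min b c)\<close>; here the last term is
        \<open>a = z t u\<close>.\<close>
      have "min (z 0 u) (z 1 u) \<le> z t u"
        using min_le_between[OF t \<beta>, of u] by (simp add: z_def)
      then show "- z t u + max (z t u) (z 0 u) + max (z t u) (z 1 u)
        - max (z t u) (max (z 0 u) (z 1 u)) = 0"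
        by (auto simp: max_def min_def split: if_splits)
    qed
    finally show ?thesis by simp
  qed
  have ends: "prob (space N - (A x 0 \<union> A x 1)) = x * \<theta>" if x: "x \<in> {0<..x0}" for x
  proof -
    have "prob (A x 0 \<union> A x 1) = prob (A x 0) + prob (A x 1) - prob (A x 0 \<inter> A x 1)"
      by (intro measure_Un3) (simp_all add: fmeasurable_eq_sets)
    also have "\<dots> = 1 - x * (2 - (LINT u|lborel. max (z 0 u) (z 1 u)))"
      using x by (simp add: qA qAA algebra_simps)
    also have "2 - (LINT u|lborel. max (z 0 u) (z 1 u)) =
        (LINT u|lborel. z 0 u + z 1 u - max (z 0 u) (z 1 u))"
      by simp
    also have "\<dots> = (LINT u|lborel. min (z 0 u) (z 1 u))"
      by (intro Bochner_Integration.integral_cong) (auto simp: max_def min_def)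
    finally show ?thesis by (subst prob_compl) (simp_all add: \<theta>_eq)
  qed
  have "prob_gt N V (\<lambda>t. - x) = x * \<theta>" if x: "x \<in> {0<..x0}" for x
  proof (rule antisym)
    define G where "G = {\<omega>\<in>space N. \<forall>t\<in>{0..1}. - x < V t \<omega>}"
    have cont: "continuous_on {0..1} (\<lambda>t. V t \<omega>)" if "\<omega> \<in> space N" for \<omega>
      using cp that by (simp add: continuous_process_def)
    have "G = {\<omega>\<in>space N. clipped_sup (- x) (path01 V \<omega>) < 1}"
      using clipped_sup_less_iff[of V _ "- x" 1] cont x by (auto simp: G_def)
    then have [measurable]: "G \<in> events"
      using clipped_sup_path_measurable[OF cp] by simp
    have Gp: "prob_gt N V (\<lambda>t. - x) = prob G" by (simp add: prob_gt_def G_def)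
    have "prob G \<le> prob (space N - (A x 0 \<union> A x 1))"
    proof (rule finite_measure_mono)
      show "G \<subseteq> space N - (A x 0 \<union> A x 1)"
      proof
        fix \<omega> assume \<omega>: "\<omega> \<in> G"
        then have "- x < V 0 \<omega>" "- x < V 1 \<omega>" unfolding G_def by auto
        with \<omega> show "\<omega> \<in> space N - (A x 0 \<union> A x 1)" by (auto simp: G_def A_def not_le)
      qed
      show "space N - (A x 0 \<union> A x 1) \<in> events"
        by (intro sets.Diff sets.Un sets.top A) auto
    qed
    with ends[OF x] Gp show "prob_gt N V (\<lambda>t. - x) \<le> x * \<theta>" by simp
    show "x * \<theta> \<le> prob_gt N V (\<lambda>t. - x)"
    \<comment> \<open>Passing from rational times to all times turns \<open>>\<close> into
      \<open>\<ge>\<close>. The smaller level \<open>y = r * x\<close> restores the strict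
      inequality, as \<open>V t \<ge> -y > -x\<close>, and the factor \<open>r < 1\<close> is
      arbitrary.\<close>
    proof (rule field_le_mult_one_interval)
      fix r :: real assume r: "0 < r" "r < 1"
      define y where "y = r * x"
      have "r * x < 1 * x" using r x by (intro mult_strict_right_mono) auto
      moreover have "0 < r * x" "x \<le> x0" using r x by auto
      ultimately have y: "y \<in> {0<..x0}" "y < x"
        unfolding y_def by simp_all
      have "AE \<omega> in N. \<forall>t\<in>rat01. \<omega> \<notin> A y t - (A y 0 \<union> A y 1)"
        unfolding AE_ball_countable[OF countable_rat01]
      proof
        fix t assume "t \<in> rat01"
        then have "t \<in> {0..1}" using rat01_subset by blast
        with bad[OF this y(1)] show "AE \<omega> in N. \<omega> \<notin> A y t - (A y 0 \<union> A y 1)"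
          by (intro AE_not_in null_setsI) (auto simp: emeasure_eq_measure)
      qed
      then have "AE \<omega> in N. \<omega> \<in> space N - (A y 0 \<union> A y 1) \<longrightarrow> \<omega> \<in> G"
      proof (rule AE_mp, intro AE_I2 impI)
        fix \<omega> assume \<omega>: "\<omega> \<in> space N" "\<forall>t\<in>rat01. \<omega> \<notin> A y t - (A y 0 \<union> A y 1)"
          "\<omega> \<in> space N - (A y 0 \<union> A y 1)"
        have "- V t \<omega> \<le> y" if t: "t \<in> {0..1}" for t
        proof (rule cont_le_rat01[OF _ _ t])
          show "continuous_on {0..1} (\<lambda>t. - V t \<omega>)" using cont[OF \<omega>(1)] by (intro continuous_intros)
          show "- V s \<omega> \<le> y" if "s \<in> rat01" for s
            using \<omega> that by (auto simp: A_def)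
        qed
        with y \<omega>(1) show "\<omega> \<in> G" unfolding G_def by force
      qed
      then have "prob (space N - (A y 0 \<union> A y 1)) \<le> prob G"
        by (intro finite_measure_mono_AE) auto
      with ends[OF y(1)] Gp show "r * (x * \<theta>) \<le> prob_gt N V (\<lambda>t. - x)"
        by (simp add: y_def mult.assoc)
    qed
  qed
  with x0 show ?thesis unfolding \<theta>_def by blast
qed

text \<open>All small levels are multiples of the single constant function
  \<open>- \<epsilon>0\<close>, namely \<open>x = c * \<epsilon>0\<close>. So a remainder that is
  \<open>o(c powr \<delta>)\<close> for each fixed function is enough, and \<open>K\<close> is just
  a number.\<close>

lemma condition_C_tail:
  assumes C: "condition_C \<psi> \<beta> \<delta> M X" and \<beta>: "\<beta> > 0" and \<theta>: "\<theta> = 2 * distr_fun \<psi> (- \<beta> / 2)"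
    and \<delta>: "\<delta> > 0"
  obtains B x1 where "x1 > 0" "B \<ge> 0"
    "\<And>x. x \<in> {0<..<x1} \<Longrightarrow> \<bar>prob_gt M X (\<lambda>t. - x) - x * \<theta>\<bar> \<le> x * (B * x powr \<delta>)"
proof -
  obtain N :: "(real \<Rightarrow> real) measure" and V where V: "standard_gpp \<psi> \<beta> N V" and
    ex: "\<exists>\<epsilon>0>0. \<exists>(K :: (real \<Rightarrow> real) \<Rightarrow> real) (r :: real \<Rightarrow> (real \<Rightarrow> real) \<Rightarrow> real).
          \<forall>f\<in>E01_nonpos. sup_norm01 f \<le> \<epsilon>0 \<longrightarrow>
            (\<lambda>c. r c f) \<in> o[at_right 0](\<lambda>c. c powr \<delta>) \<and>
            (\<forall>c\<in>{0<..<1}.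
               prob_gt M X (\<lambda>t. c * f t) =
               prob_gt N V (\<lambda>t. c * f t) * (1 + c powr \<delta> * K f + r c f))"
    using C unfolding condition_C_def by blast
  obtain \<epsilon>0 K' r' where e: "\<epsilon>0 > 0" and
    Kr: "\<forall>f\<in>E01_nonpos. sup_norm01 f \<le> \<epsilon>0 \<longrightarrow>
            (\<lambda>c. r' c f) \<in> o[at_right 0](\<lambda>c. c powr \<delta>) \<and>
            (\<forall>c\<in>{0<..<1}.
               prob_gt M X (\<lambda>t. c * f t) =
               prob_gt N V (\<lambda>t. c * f t) * (1 + c powr \<delta> * K' f + r' c f))"
    using ex by blast
  define K where "K = K' (\<lambda>t. - \<epsilon>0)"
  define r where "r c = r' c (\<lambda>t. - \<epsilon>0)" for c
  have ro: "r \<in> o[at_right 0](\<lambda>c. c powr \<delta>)"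
    and eq: "prob_gt M X (\<lambda>t. c * - \<epsilon>0) =
      prob_gt N V (\<lambda>t. c * - \<epsilon>0) * (1 + c powr \<delta> * K + r c)" if "c \<in> {0<..<1}" for c
    using Kr[rule_format, OF const_E01_nonpos(1)[of \<epsilon>0]] const_E01_nonpos(2)[of \<epsilon>0] e that
    unfolding K_def r_def[abs_def] by auto
  \<comment> \<open>The premise on \<open>c\<close> above was attached to both facts; any point of
    (0,1) discharges it.\<close>
  have ro: "r \<in> o[at_right 0](\<lambda>c. c powr \<delta>)"
    by (rule ro[of "1/2"]) simp
  obtain x0 where x0: "x0 > 0" and V': "\<And>x. x \<in> {0<..x0} \<Longrightarrow> prob_gt N V (\<lambda>t. - x) = x * \<theta>"
    using gpp_prob_gt_const[OF V \<beta>] \<theta> by auto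
  have "\<forall>\<^sub>F c in at_right 0. norm (r c) \<le> 1 * norm (c powr \<delta>)"
    using landau_o.smallD[OF ro, of 1] by simp
  then obtain c1 where c1: "c1 > 0" "\<And>c. 0 < c \<Longrightarrow> c < c1 \<Longrightarrow> \<bar>r c\<bar> \<le> c powr \<delta>"
    unfolding eventually_at_right_field by auto
  \<comment> \<open>Near 0 the remainder is at most \<open>c powr \<delta>\<close>, whence
    \<open>\<bar>K\<bar> + 1\<close>; the power of \<open>\<epsilon>0\<close> converts
    \<open>c powr \<delta>\<close> to \<open>x powr \<delta>\<close>.\<close>
  define B where "B = \<bar>\<theta>\<bar> * (\<bar>K\<bar> + 1) * \<epsilon>0 powr (- \<delta>)"
  define x1 where "x1 = min x0 (\<epsilon>0 * min 1 c1)"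
  show ?thesis
  proof (rule that)
    show "x1 > 0" using x0 e c1 by (simp add: x1_def)
    show "B \<ge> 0" by (simp add: B_def)
    fix x assume x: "x \<in> {0<..<x1}"
    define c where "c = x / \<epsilon>0"
    have c: "0 < c" "c < 1" "c < c1" "c * \<epsilon>0 = x" "x \<le> x0"
      using x e by (auto simp: c_def x1_def divide_less_eq mult.commute min_mult_distrib_left)
    have "prob_gt M X (\<lambda>t. - x) = x * \<theta> * (1 + c powr \<delta> * K + r c)"
      using eq[of c] c V'[of x] x by simp
    then have "prob_gt M X (\<lambda>t. - x) - x * \<theta> = x * (\<theta> * (c powr \<delta> * K + r c))"
      by (simp add: algebra_simps)
    then have "\<bar>prob_gt M X (\<lambda>t. - x) - x * \<theta>\<bar> = x * (\<bar>\<theta>\<bar> * \<bar>c powr \<delta> * K + r c\<bar>)"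
      using x by (simp add: abs_mult)
    also have "\<bar>c powr \<delta> * K + r c\<bar> \<le> c powr \<delta> * \<bar>K\<bar> + c powr \<delta>"
      using c1(2)[of c] c by (intro order_trans[OF abs_triangle_ineq] add_mono) (auto simp: abs_mult)
    also have "c powr \<delta> * \<bar>K\<bar> + c powr \<delta> = (\<bar>K\<bar> + 1) * \<epsilon>0 powr (- \<delta>) * x powr \<delta>"
      using x e by (simp add: c_def powr_divide powr_minus field_simps)
    finally show "\<bar>prob_gt M X (\<lambda>t. - x) - x * \<theta>\<bar> \<le> x * (B * x powr \<delta>)"
      using x by (simp add: B_def mult_left_mono mult.assoc)
  qed
qed

end

section \<open>Likelihood ratios\<close>

text \<open>The derivative exists everywhere on (0,1) but need not be continuous. Monotonicity makes
  it nonnegative, and for a nonnegative measurable derivative the fundamental theorem still holds on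
  closed subintervals; these determine the measure. Sets \<open>{..<u}\<close> appear, not
  \<open>{..u}\<close>, because \<open>X > u * c\<close> corresponds to a clipped supremum strictly
  below \<open>u\<close>.\<close>

lemma density_of_lessThan_derivative:
  fixes \<mu> :: "real measure"
  assumes \<mu>: "real_distribution \<mu>"
    and der: "\<And>u. u \<in> {0<..<1} \<Longrightarrow> ((\<lambda>u. measure \<mu> {..<u}) has_real_derivative f u) (at u)"
  obtains g where "g \<in> borel_measurable borel" "\<And>u. 0 \<le> g u" "\<And>u. u \<in> {0<..<1} \<Longrightarrow> g u = f u"
    "density \<mu> (indicator {0<..<1}) = density lborel (\<lambda>u. ennreal (g u) * indicator {0<..<1} u)"
proof -
  interpret real_distribution \<mu> by fact
  define F where "F u = measure \<mu> {..<u}" for u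
  have mono: "F x \<le> F y" if "x \<le> y" for x y
    unfolding F_def using that by (intro finite_measure_mono) auto
  have [measurable]: "F \<in> borel_measurable borel"
    by (rule borel_measurable_mono) (auto simp: mono_def mono)
  \<comment> \<open>\<open>f\<close> is arbitrary outside (0,1) and not known to be measurable; a
    limit of difference quotients of the monotone function \<open>F\<close> is.\<close>
  define g0 where "g0 u = lim (\<lambda>n. (F (u + 1 / real (Suc n)) - F u) / (1 / real (Suc n)))" for u
  have [measurable]: "g0 \<in> borel_measurable borel"
    unfolding g0_def by measurable
  define g where "g u = (if u \<in> {0<..<1} then g0 u else 0)" for u
  have [measurable]: "g \<in> borel_measurable borel"
    unfolding g_def by measurable
  have lim: "(\<lambda>n. (F (u + 1 / real (Suc n)) - F u) / (1 / real (Suc n))) \<longlonglongrightarrow> f u"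
    if "u \<in> {0<..<1}" for u
  proof -
    have "((\<lambda>h. (F (u + h) - F u) / h) \<longlongrightarrow> f u) (at 0)"
      using der[OF that] by (simp add: DERIV_def F_def[abs_def])
    moreover have "filterlim (\<lambda>n. 1 / real (Suc n)) (at 0) sequentially"
      unfolding filterlim_at using LIMSEQ_inverse_real_of_nat by (simp add: inverse_eq_divide)
    ultimately show ?thesis by (rule filterlim_compose)
  qed
  have gf: "g u = f u" if "u \<in> {0<..<1}" for u
    using that limI[OF lim[OF that]] by (simp add: g_def g0_def)
  have gnn: "0 \<le> g u" for u
  proof (cases "u \<in> {0<..<1}")
    case True
    have "0 \<le> f u"
      by (rule LIMSEQ_le_const[OF lim[OF True]])
         (intro exI allI impI divide_nonneg_pos, auto intro: mono)
    with gf[OF True] show ?thesis by simp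
  qed (auto simp: g_def)
  have gder: "(F has_real_derivative g u) (at u)" if "u \<in> {0<..<1}" for u
    using der[OF that] gf[OF that] by (simp add: F_def[abs_def])
  define \<mu>1 where "\<mu>1 = density \<mu> (indicator {0<..<1})"
  define \<mu>2 where "\<mu>2 = density lborel (\<lambda>u. ennreal (g u) * indicator {0<..<1} u)"
  have Ico: "emeasure \<mu>1 {a..<b} = emeasure \<mu>2 {a..<b}" if ab: "0 < a" "a \<le> b" "b < 1" for a b
  proof -
    have "emeasure \<mu>1 {a..<b} = (\<integral>\<^sup>+u. indicator {0<..<1} u * indicator {a..<b} u \<partial>\<mu>)"
      unfolding \<mu>1_def by (rule emeasure_density) auto
    also have "\<dots> = (\<integral>\<^sup>+u. indicator {a..<b} u \<partial>\<mu>)"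
      using ab by (intro nn_integral_cong) (auto simp: indicator_def)
    also have "\<dots> = measure \<mu> {a..<b}"
      by (simp add: emeasure_eq_measure)
    also have "measure \<mu> {a..<b} = F b - F a"
    proof -
      have eq: "{a..<b} = {..<b} - {..<a}" using ab by auto
      show ?thesis unfolding F_def eq using ab by (intro finite_measure_Diff) auto
    qed
    also have "ennreal (F b - F a) = (\<integral>\<^sup>+u. ennreal (g u) * indicator {a..b} u \<partial>lborel)"
      using ab gnn gder by (intro nn_integral_FTC_Icc[symmetric]) auto
    also have "\<dots> = (\<integral>\<^sup>+u. (ennreal (g u) * indicator {0<..<1} u) * indicator {a..<b} u \<partial>lborel)"
      using AE_lborel_singleton[of b] ab
      by (intro nn_integral_cong_AE) (auto simp: indicator_def elim!: eventually_mono)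
    also have "\<dots> = emeasure \<mu>2 {a..<b}"
      unfolding \<mu>2_def by (rule emeasure_density[symmetric]) auto
    finally show ?thesis .
  qed
  \<comment> \<open>Both measures live on (0,1), so the half-lines that determine a finite measure
    reduce to intervals ending at 1.\<close>
  have restr: "emeasure \<mu>1 {x<..} = emeasure \<mu>1 {max 0 x<..<1}"
    "emeasure \<mu>2 {x<..} = emeasure \<mu>2 {max 0 x<..<1}" for x
    unfolding \<mu>1_def \<mu>2_def
    by (auto simp: emeasure_density indicator_def intro!: nn_integral_cong)
  have eq: "emeasure \<mu>1 {x<..<1} = emeasure \<mu>2 {x<..<1}" if x: "0 \<le> x" for x
  proof (cases "x < 1")
    case True
    \<comment> \<open>\<open>Ico\<close> needs intervals that stay away from 0 and 1, so (x,1) is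
      exhausted from inside; dividing by at least 3 ensures \<open>x + d n \<le> 1 - d n\<close>
      from \<open>n = 0\<close> on.\<close>
    define d where "d n = (1 - x) / real (n + 3)" for n
    define A where "A n = {x + d n..<1 - d n}" for n
    have d0: "0 < d n" for n using True by (simp add: d_def)
    have dd: "d n \<le> d m" if "m \<le> n" for m n
      unfolding d_def using True that by (intro divide_left_mono) auto
    have "incseq A"
      unfolding incseq_def A_def using dd by fastforce
    have "A n \<in> sets borel" for n by (simp add: A_def)
    then have meas: "range A \<subseteq> sets \<mu>1" "range A \<subseteq> sets \<mu>2"
      by (auto simp: \<mu>1_def \<mu>2_def)
    have UN: "(\<Union>n. A n) = {x<..<1}"
    proof (intro antisym subsetI)
      fix y assume "y \<in> (\<Union>n. A n)"
      then obtain n where "y \<in> A n" by blast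
      with d0[of n] show "y \<in> {x<..<1}" by (auto simp: A_def)
    next
      fix y assume y: "y \<in> {x<..<1}"
      have "d \<longlonglongrightarrow> 0"
        unfolding d_def by (rule LIMSEQ_ignore_initial_segment[OF lim_const_over_n])
      then have "\<forall>\<^sub>F n in sequentially. d n < min (y - x) (1 - y)"
        using y by (intro order_tendstoD) auto
      then obtain n where "d n < min (y - x) (1 - y)"
        by (auto simp: eventually_sequentially)
      then show "y \<in> (\<Union>n. A n)" unfolding A_def by (intro UN_I[of n]) auto
    qed
    have E: "emeasure \<mu>1 (A n) = emeasure \<mu>2 (A n)" for n
    proof -
      have "d n \<le> (1 - x) / 3" using dd[of 0 n] by (simp add: d_def)
      then show ?thesis unfolding A_def using x True d0[of n] by (intro Ico) auto
    qed
    have "(\<lambda>n. emeasure \<mu>1 (A n)) \<longlonglongrightarrow> emeasure \<mu>1 {x<..<1}"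
      unfolding UN[symmetric] using \<open>incseq A\<close> meas by (intro Lim_emeasure_incseq)
    moreover have "(\<lambda>n. emeasure \<mu>2 (A n)) \<longlonglongrightarrow> emeasure \<mu>2 {x<..<1}"
      unfolding UN[symmetric] using \<open>incseq A\<close> meas by (intro Lim_emeasure_incseq)
    ultimately show ?thesis unfolding E by (rule LIMSEQ_unique)
  next
    case False
    then have "{x<..<1} = {}" by auto
    then show ?thesis by (simp only: emeasure_empty)
  qed
  have "\<mu>1 = \<mu>2"
  proof (rule measure_eqI_lessThan)
    show "sets \<mu>1 = sets borel" "sets \<mu>2 = sets borel"
      by (simp_all add: \<mu>1_def \<mu>2_def)
    show "emeasure \<mu>1 {x<..} = emeasure \<mu>2 {x<..}" for x
      unfolding restr by (rule eq) simp
    show "emeasure \<mu>1 {x<..} < \<infinity>" for x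
    proof -
      have "emeasure \<mu>1 {x<..} \<le> (\<integral>\<^sup>+u. 1 \<partial>\<mu>)"
      proof -
        have "emeasure \<mu>1 {x<..} = (\<integral>\<^sup>+u. indicator {0<..<1} u * indicator {x<..} u \<partial>\<mu>)"
          unfolding \<mu>1_def by (rule emeasure_density) auto
        also have "\<dots> \<le> (\<integral>\<^sup>+u. 1 \<partial>\<mu>)"
          by (rule nn_integral_mono) (auto simp: indicator_def)
        finally show ?thesis .
      qed
      also have "\<dots> < \<infinity>" by (simp add: emeasure_eq_measure)
      finally show ?thesis .
    qed
  qed
  with that[of g] gf gnn show ?thesis by (simp add: \<mu>1_def \<mu>2_def)
qed

text \<open>Both laws consist of a density on (0,1) and an atom at 1, where the clipped values sit.
  The ratio is taken separately on the two parts; outside (0,1], a null set, the ratio of the atoms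
  is used so that \<open>R\<close> has only one exceptional value.\<close>

lemma likelihood_ratio:
  fixes \<mu> \<nu> :: "real measure"
  assumes \<mu>: "real_distribution \<mu>" and \<nu>: "real_distribution \<nu>"
    and f: "\<And>u. u \<in> {0<..<1} \<Longrightarrow> ((\<lambda>u. measure \<mu> {..<u}) has_real_derivative f u) (at u)"
    and g: "\<And>u. u \<in> {0<..<1} \<Longrightarrow> ((\<lambda>u. measure \<nu> {..<u}) has_real_derivative g u) (at u)"
    and g0: "\<And>u. u \<in> {0<..<1} \<Longrightarrow> g u \<noteq> 0"
    and supp: "measure \<mu> {..0} = 0" "measure \<mu> {1<..} = 0" "measure \<nu> {..0} = 0" "measure \<nu> {1<..} = 0"
    and one: "measure \<nu> {1} > 0"
  obtains R where "R \<in> borel_measurable borel" "\<And>u. 0 \<le> R u" "\<mu> = density \<nu> (\<lambda>u. ennreal (R u))"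
    "\<And>u. u \<in> {0<..<1} \<Longrightarrow> R u = f u / g u"
    "\<And>u. u \<notin> {0<..<1} \<Longrightarrow> R u = measure \<mu> {1} / measure \<nu> {1}"
proof -
  interpret m: real_distribution \<mu> by fact
  interpret n: real_distribution \<nu> by fact
  obtain f' where [measurable]: "f' \<in> borel_measurable borel" and f': "\<And>u. 0 \<le> f' u"
      "\<And>u. u \<in> {0<..<1} \<Longrightarrow> f' u = f u"
      "density \<mu> (indicator {0<..<1}) = density lborel (\<lambda>u. ennreal (f' u) * indicator {0<..<1} u)"
    using density_of_lessThan_derivative[OF \<mu> f] by blast
  obtain g' where [measurable]: "g' \<in> borel_measurable borel" and g': "\<And>u. 0 \<le> g' u"
      "\<And>u. u \<in> {0<..<1} \<Longrightarrow> g' u = g u"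
      "density \<nu> (indicator {0<..<1}) = density lborel (\<lambda>u. ennreal (g' u) * indicator {0<..<1} u)"
    using density_of_lessThan_derivative[OF \<nu> g] by blast
  define R where "R u = (if u \<in> {0<..<1} then f' u / g' u else measure \<mu> {1} / measure \<nu> {1})" for u
  have [measurable]: "R \<in> borel_measurable borel" unfolding R_def by measurable
  have split: "(\<integral>\<^sup>+u. h u \<partial>\<kappa>) = (\<integral>\<^sup>+u. h u \<partial>density \<kappa> (indicator {0<..<1})) + h 1 * emeasure \<kappa> {1}"
    if \<kappa>: "real_distribution \<kappa>" "measure \<kappa> {..0} = 0" "measure \<kappa> {1<..} = 0"
      and [measurable]: "h \<in> borel_measurable borel" for \<kappa> :: "real measure" and h :: "real \<Rightarrow> ennreal"
  proof -
    interpret k: real_distribution \<kappa> by fact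
    have "{..0} \<in> null_sets \<kappa>" "{1<..} \<in> null_sets \<kappa>"
      using \<kappa> by (auto simp: k.emeasure_eq_measure)
    then have "AE u in \<kappa>. u \<notin> {..0}" "AE u in \<kappa>. u \<notin> {1<..}"
      by (auto dest: AE_not_in)
    then have "AE u in \<kappa>. h u = indicator {0<..<1} u * h u + h u * indicator {1} u"
      by eventually_elim (auto simp: indicator_def)
    then have "(\<integral>\<^sup>+u. h u \<partial>\<kappa>) = (\<integral>\<^sup>+u. indicator {0<..<1} u * h u + h u * indicator {1} u \<partial>\<kappa>)"
      by (rule nn_integral_cong_AE)
    also have "\<dots> = (\<integral>\<^sup>+u. indicator {0<..<1} u * h u \<partial>\<kappa>) + (\<integral>\<^sup>+u. h u * indicator {1} u \<partial>\<kappa>)"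
      by (rule nn_integral_add) auto
    also have "(\<integral>\<^sup>+u. h u * indicator {1} u \<partial>\<kappa>) = (\<integral>\<^sup>+u. h 1 * indicator {1} u \<partial>\<kappa>)"
      by (intro nn_integral_cong) (auto simp: indicator_def)
    also have "\<dots> = h 1 * emeasure \<kappa> {1}"
      by (rule nn_integral_cmult_indicator) auto
    also have "(\<integral>\<^sup>+u. indicator {0<..<1} u * h u \<partial>\<kappa>) = (\<integral>\<^sup>+u. h u \<partial>density \<kappa> (indicator {0<..<1}))"
      by (rule nn_integral_density[symmetric]) auto
    finally show ?thesis .
  qed
  have "\<mu> = density \<nu> (\<lambda>u. ennreal (R u))"
  proof (rule measure_eqI)
    fix A assume "A \<in> sets \<mu>"
    then have [measurable]: "A \<in> sets borel" by simp
    have "emeasure (density \<nu> (\<lambda>u. ennreal (R u))) A = (\<integral>\<^sup>+u. ennreal (R u) * indicator A u \<partial>\<nu>)"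
      by (rule emeasure_density) auto
    also have "\<dots> = (\<integral>\<^sup>+u. ennreal (R u) * indicator A u \<partial>density \<nu> (indicator {0<..<1})) +
        ennreal (R 1) * indicator A 1 * emeasure \<nu> {1}"
      by (rule split[OF \<nu> supp(3,4)]) auto
    also have "ennreal (R 1) * indicator A 1 * emeasure \<nu> {1} = indicator A 1 * emeasure \<mu> {1}"
      using one by (auto simp: R_def n.emeasure_eq_measure m.emeasure_eq_measure indicator_def
        ennreal_mult[symmetric])
    also have "(\<integral>\<^sup>+u. ennreal (R u) * indicator A u \<partial>density \<nu> (indicator {0<..<1})) =
       (\<integral>\<^sup>+u. (ennreal (g' u) * indicator {0<..<1} u) * (ennreal (R u) * indicator A u) \<partial>lborel)"
      unfolding g'(3) by (rule nn_integral_density) auto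
    also have "\<dots> = (\<integral>\<^sup>+u. (ennreal (f' u) * indicator {0<..<1} u) * indicator A u \<partial>lborel)"
    proof (intro nn_integral_cong)
      fix u
      show "(ennreal (g' u) * indicator {0<..<1} u) * (ennreal (R u) * indicator A u) =
        (ennreal (f' u) * indicator {0<..<1} u) * indicator A u"
      proof (cases "u \<in> {0<..<1}")
        case True
        then have "g' u * R u = f' u" using g0 g'(2) by (simp add: R_def)
        with True show ?thesis
          using g'(1)[of u] f'(1)[of u] by (auto simp: R_def ennreal_mult[symmetric] indicator_def)
      qed simp
    qed
    also have "\<dots> = (\<integral>\<^sup>+u. indicator A u \<partial>density \<mu> (indicator {0<..<1}))"
      unfolding f'(3) by (rule nn_integral_density[symmetric]) auto
    also have "\<dots> + indicator A 1 * emeasure \<mu> {1} = (\<integral>\<^sup>+u. indicator A u \<partial>\<mu>)"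
      by (rule split[OF \<mu> supp(1,2), symmetric]) auto
    also have "\<dots> = emeasure \<mu> A" by simp
    finally show "emeasure \<mu> A = emeasure (density \<nu> (\<lambda>u. ennreal (R u))) A" ..
  qed simp
  moreover have "0 \<le> R u" for u
    using f'(1)[of u] g'(1)[of u] by (simp add: R_def)
  moreover have "R u = f u / g u" if "u \<in> {0<..<1}" for u
    using that f'(2) g'(2) by (simp add: R_def)
  moreover have "R u = measure \<mu> {1} / measure \<nu> {1}" if "u \<notin> {0<..<1}" for u
    using that by (auto simp: R_def)
  ultimately show ?thesis using that[of R] by simp
qed

text \<open>In the application \<open>k\<close> is the linear term of (D) and \<open>e\<close>
  bounds its remainder. With \<open>q = \<bar>k\<bar> + e\<close>, \<open>p0\<close> and
  \<open>p1\<close> the masses below 1, \<open>\<bar>R - 1\<bar> \<le> q\<close> on (0,1);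
  integrating gives \<open>\<bar>p1 - p0\<bar> \<le> q * p0\<close>, and since the total masses
  agree, \<open>R - 1 = (p0 - p1) / (1 - p0)\<close> at the atom. The contributions q^2 p0 and q^2
  p0^2 / (1 - p0) to the chi-square distance add up to q^2 p0 / (1 - p0): to leading order only the
  exceedances carry information.\<close>

lemma likelihood_ratio_bounds:
  fixes \<mu> \<nu> :: "real measure"
  assumes \<mu>: "real_distribution \<mu>" and \<nu>: "real_distribution \<nu>"
    and supp: "measure \<mu> {..0} = 0" "measure \<mu> {1<..} = 0" "measure \<nu> {..0} = 0" "measure \<nu> {1<..} = 0"
    and one: "measure \<nu> {1} > 0"
    and R [measurable]: "R \<in> borel_measurable borel" and R0: "\<And>u. 0 \<le> R u"
    and dens: "\<mu> = density \<nu> (\<lambda>u. ennreal (R u))"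
    and R1: "\<And>u. u \<notin> {0<..<1} \<Longrightarrow> R u = measure \<mu> {1} / measure \<nu> {1}"
    and bound: "\<And>u. u \<in> {0<..<1} \<Longrightarrow> \<bar>R u - 1 - k\<bar> \<le> e"
  shows "\<exists>C. \<forall>u. R u \<le> C"
    and "\<bar>measure \<mu> {..<1} - (1 + k) * measure \<nu> {..<1}\<bar> \<le> e * measure \<nu> {..<1}"
    and "(LINT u|\<nu>. (R u - 1)\<^sup>2) \<le> (\<bar>k\<bar> + e)\<^sup>2 * measure \<nu> {..<1} / (1 - measure \<nu> {..<1})"
proof -
  interpret m: real_distribution \<mu> by fact
  interpret n: real_distribution \<nu> by fact
  define p0 where "p0 = measure \<nu> {..<1}"
  define p1 where "p1 = measure \<mu> {..<1}"
  have compl: "measure \<kappa> {1} = 1 - measure \<kappa> {..<1}"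
    if \<kappa>: "real_distribution \<kappa>" "measure \<kappa> {1<..} = 0" for \<kappa> :: "real measure"
  proof -
    interpret k: real_distribution \<kappa> by fact
    have "measure \<kappa> {1<..} + measure \<kappa> {1} = measure \<kappa> ({1<..} \<union> {1})"
      by (intro k.finite_measure_Union[symmetric]) auto
    also have "{1<..} \<union> {1} = space \<kappa> - {..<1::real}" by auto
    also have "measure \<kappa> \<dots> = 1 - measure \<kappa> {..<1}" by (intro k.prob_compl) auto
    finally show ?thesis using \<kappa> by simp
  qed
  have \<nu>1: "measure \<nu> {1} = 1 - p0" and \<mu>1: "measure \<mu> {1} = 1 - p1"
    unfolding p0_def p1_def by (intro compl \<mu> \<nu> supp)+
  have "{..0} \<in> null_sets \<nu>" "{1<..} \<in> null_sets \<nu>"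
    using supp by (auto simp: n.emeasure_eq_measure)
  then have AE01: "AE u in \<nu>. u \<notin> {..0} \<and> u \<notin> {1<..}"
    by (auto dest: AE_not_in)
  have Rk: "R u \<le> max (1 + k + e) (R 1)" for u
    using bound[of u] R1[of u] R1[of 1] by (cases "u \<in> {0<..<1}") auto
  then show "\<exists>C. \<forall>u. R u \<le> C" by blast
  have bd: "norm (R u) \<le> max (1 + k + e) (R 1)" for u
    using Rk[of u] R0[of u] by simp
  have Rint: "integrable \<nu> (\<lambda>u. R u * indicator {..<1} u)"
  proof (rule n.integrable_const_bound[where B="max (1 + k + e) (R 1)"])
    have "0 \<le> max (1 + k + e) (R 1)" using R0[of 1] by simp
    then show "AE u in \<nu>. norm (R u * indicator {..<1} u) \<le> max (1 + k + e) (R 1)"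
      using bd by (intro AE_I2) (auto simp: indicator_def simp del: max.absorb1 max.absorb2)
  qed simp
  have p1_eq: "p1 = (LINT u|\<nu>. R u * indicator {..<1} u)"
  proof -
    have "emeasure \<mu> {..<1} = (\<integral>\<^sup>+u. ennreal (R u * indicator {..<1} u) \<partial>\<nu>)"
      unfolding dens using R0
      by (subst emeasure_density) (auto intro!: nn_integral_cong simp: indicator_def)
    also have "\<dots> = ennreal (LINT u|\<nu>. R u * indicator {..<1} u)"
      using R0 by (intro nn_integral_eq_integral Rint) (auto simp: indicator_def)
    finally show ?thesis
      unfolding p1_def using R0 by (simp add: measure_def Bochner_Integration.integral_nonneg)
  qed
  have p0_eq: "p0 = (LINT u|\<nu>. indicator {..<1} u)"
    by (simp add: p0_def)
  have iint: "integrable \<nu> (\<lambda>u. indicator {..<1} u :: real)"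
    by (intro integrable_real_indicator) (auto simp: n.emeasure_eq_measure)
  have "p1 - (1 + k) * p0 = (LINT u|\<nu>. R u * indicator {..<1} u - (1 + k) * indicator {..<1} u)"
    unfolding p1_eq p0_eq using Rint iint by simp
  also have "\<bar>\<dots>\<bar> \<le> (LINT u|\<nu>. e * indicator {..<1} u)"
  proof (rule order_trans[OF integral_abs_bound integral_mono_AE])
    show "AE u in \<nu>. \<bar>R u * indicator {..<1} u - (1 + k) * indicator {..<1} u\<bar> \<le> e * indicator {..<1} u"
      using AE01
    proof eventually_elim
      fix u :: real assume "u \<notin> {..0} \<and> u \<notin> {1<..}"
      with bound[of u] show "\<bar>R u * indicator {..<1} u - (1 + k) * indicator {..<1} u\<bar> \<le> e * indicator {..<1} u"
        by (cases "u < 1") (auto simp: diff_diff_eq)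
    qed
  qed (use Rint iint in auto)
  finally have main: "\<bar>p1 - (1 + k) * p0\<bar> \<le> e * p0" by (simp add: p0_eq)
  then show "\<bar>measure \<mu> {..<1} - (1 + k) * measure \<nu> {..<1}\<bar> \<le> e * measure \<nu> {..<1}"
    by (simp add: p0_def p1_def)
  define q where "q = \<bar>k\<bar> + e"
  have "p0 \<ge> 0" by (simp add: p0_def)
  have p0: "p0 < 1" using one \<nu>1 by simp
  have q1: "\<bar>p1 - p0\<bar> \<le> q * p0"
  proof -
    have "\<bar>p1 - p0\<bar> \<le> \<bar>p1 - (1 + k) * p0\<bar> + \<bar>k * p0\<bar>" by (simp add: algebra_simps)
    also have "\<dots> \<le> e * p0 + \<bar>k\<bar> * p0" using main \<open>p0 \<ge> 0\<close> by (simp add: abs_mult)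
    finally show ?thesis by (simp add: q_def algebra_simps)
  qed
  have R1': "R 1 - 1 = (p0 - p1) / (1 - p0)"
    using R1[of 1] p0 by (simp add: \<nu>1 \<mu>1 field_simps)
  have "(LINT u|\<nu>. (R u - 1)\<^sup>2) \<le>
      (LINT u|\<nu>. q\<^sup>2 * indicator {..<1} u + ((p0 - p1) / (1 - p0))\<^sup>2 * indicator {1} u)"
  proof (rule integral_mono_AE)
    show "integrable \<nu> (\<lambda>u. (R u - 1)\<^sup>2)"
    proof (rule n.integrable_const_bound[where B="(max (1 + k + e) (R 1) + 1)\<^sup>2"])
      show "AE u in \<nu>. norm ((R u - 1)\<^sup>2) \<le> (max (1 + k + e) (R 1) + 1)\<^sup>2"
      proof (rule AE_I2)
        fix u
        have "\<bar>R u - 1\<bar> \<le> max (1 + k + e) (R 1) + 1"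
          using Rk[of u] R0[of u] R0[of 1] by linarith
        then have "\<bar>R u - 1\<bar>\<^sup>2 \<le> (max (1 + k + e) (R 1) + 1)\<^sup>2"
          by (intro power_mono) auto
        then show "norm ((R u - 1)\<^sup>2) \<le> (max (1 + k + e) (R 1) + 1)\<^sup>2" by simp
      qed
    qed simp
    show "integrable \<nu> (\<lambda>u. q\<^sup>2 * indicator {..<1} u + ((p0 - p1) / (1 - p0))\<^sup>2 * indicator {1} u)"
      by (intro Bochner_Integration.integrable_add integrable_mult_right integrable_real_indicator)
         (auto simp: n.emeasure_eq_measure)
    show "AE u in \<nu>. (R u - 1)\<^sup>2 \<le> q\<^sup>2 * indicator {..<1} u + ((p0 - p1) / (1 - p0))\<^sup>2 * indicator {1} u"
      using AE01
    proof eventually_elim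
      fix u :: real assume u: "u \<notin> {..0} \<and> u \<notin> {1<..}"
      show "(R u - 1)\<^sup>2 \<le> q\<^sup>2 * indicator {..<1} u + ((p0 - p1) / (1 - p0))\<^sup>2 * indicator {1} u"
      proof (cases "u < 1")
        case True
        have "\<bar>R u - 1\<bar> \<le> q" using bound[of u] u True by (simp add: q_def)
        then have "\<bar>R u - 1\<bar>\<^sup>2 \<le> q\<^sup>2" by (intro power_mono) auto
        with True show ?thesis by simp
      next
        case False
        with u have "u = 1" by auto
        then show ?thesis using R1' by simp
      qed
    qed
  qed
  also have "\<dots> = q\<^sup>2 * p0 + ((p0 - p1) / (1 - p0))\<^sup>2 * (1 - p0)"
    using iint \<nu>1 by (subst Bochner_Integration.integral_add)
      (auto simp: p0_eq n.emeasure_eq_measure intro!: integrable_mult_right integrable_real_indicator)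
  also have "\<dots> = q\<^sup>2 * p0 + \<bar>p1 - p0\<bar>\<^sup>2 / (1 - p0)"
  proof -
    have "(x / d)\<^sup>2 * d = x\<^sup>2 / d" for x d :: real by (simp add: power2_eq_square)
    then show ?thesis by (simp add: power2_commute)
  qed
  also have "\<dots> \<le> q\<^sup>2 * p0 + (q * p0)\<^sup>2 / (1 - p0)"
    using q1 p0 by (intro add_left_mono divide_right_mono power_mono) auto
  also have "\<dots> = q\<^sup>2 * p0 / (1 - p0)"
  proof -
    have "q\<^sup>2 * p0 = q\<^sup>2 * p0 * (1 - p0) / (1 - p0)" using p0 by simp
    then have "q\<^sup>2 * p0 + (q * p0)\<^sup>2 / (1 - p0) = (q\<^sup>2 * p0 * (1 - p0) + (q * p0)\<^sup>2) / (1 - p0)"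
      by (simp add: add_divide_distrib)
    also have "q\<^sup>2 * p0 * (1 - p0) + (q * p0)\<^sup>2 = q\<^sup>2 * p0"
      by (simp add: power2_eq_square algebra_simps)
    finally show ?thesis .
  qed
  finally show "(LINT u|\<nu>. (R u - 1)\<^sup>2) \<le> (\<bar>k\<bar> + e)\<^sup>2 * measure \<nu> {..<1} / (1 - measure \<nu> {..<1})"
    by (simp add: q_def p0_def)
qed

section \<open>Cauchy-Schwarz, product likelihoods and the Chapman-Robbins inequality\<close>

lemma (in prob_space) integral_Cauchy_Schwarz_bounded:
  fixes a b :: "'a \<Rightarrow> real"
  assumes [measurable]: "a \<in> borel_measurable M" "b \<in> borel_measurable M"
    and bd: "\<And>x. x \<in> space M \<Longrightarrow> \<bar>a x\<bar> \<le> K" "\<And>x. x \<in> space M \<Longrightarrow> \<bar>b x\<bar> \<le> K"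
  shows "(LINT x|M. a x * b x)\<^sup>2 \<le> (LINT x|M. (a x)\<^sup>2) * (LINT x|M. (b x)\<^sup>2)"
proof -
  have K: "0 \<le> K" using bd(1) not_empty by (metis abs_ge_zero all_not_in_conv order_trans)
  have int: "integrable M (\<lambda>x. f x * g x)"
    if [measurable]: "f \<in> borel_measurable M" "g \<in> borel_measurable M"
      and "\<And>x. x \<in> space M \<Longrightarrow> \<bar>f x\<bar> \<le> K" "\<And>x. x \<in> space M \<Longrightarrow> \<bar>g x\<bar> \<le> K" for f g :: "'a \<Rightarrow> real"
    by (rule integrable_const_bound[where B="K * K"])
       (use K that in \<open>auto intro!: AE_I2 mult_mono simp: abs_mult\<close>)
  have [simp]: "integrable M (\<lambda>x. a x * b x)" "integrable M (\<lambda>x. (a x)\<^sup>2)" "integrable M (\<lambda>x. (b x)\<^sup>2)"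
    unfolding power2_eq_square by (auto intro!: int bd)
  define A B C where "A = (LINT x|M. (a x)\<^sup>2)" "B = (LINT x|M. (b x)\<^sup>2)" "C = (LINT x|M. a x * b x)"
  have quad: "0 \<le> s\<^sup>2 * A - 2 * s * t * C + t\<^sup>2 * B" for s t
  proof -
    have "0 \<le> (LINT x|M. (s * a x - t * b x)\<^sup>2)" by (rule Bochner_Integration.integral_nonneg) auto
    also have "\<dots> = (LINT x|M. s\<^sup>2 * (a x)\<^sup>2 - 2 * s * t * (a x * b x) + t\<^sup>2 * (b x)\<^sup>2)"
      by (intro Bochner_Integration.integral_cong) (auto simp: power2_eq_square algebra_simps)
    also have "\<dots> = s\<^sup>2 * A - 2 * s * t * C + t\<^sup>2 * B" by (simp add: A_B_C_def)
    finally show ?thesis .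
  qed
  have "B \<ge> 0" unfolding A_B_C_def by (rule Bochner_Integration.integral_nonneg) auto
  \<comment> \<open>At \<open>(s, t) = (B, C)\<close> the form equals \<open>B\<close> times
    \<open>A * B\<close> minus the square of \<open>C\<close>. For \<open>B = 0\<close> this is
    void; there \<open>t = (A + 1) / (2 * C)\<close> would make the form \<open>-1\<close> unless
    \<open>C = 0\<close>.\<close>
  have "C\<^sup>2 \<le> A * B"
  proof (cases "B = 0")
    case True
    have "C = 0"
    proof (rule ccontr)
      assume "C \<noteq> 0"
      with quad[of 1 "(A + 1) / (2 * C)"] True have "0 \<le> A - (A + 1)" by simp
      then show False by simp
    qed
    with True show ?thesis by simp
  next
    case False
    have "0 \<le> B * (A * B - C\<^sup>2)"
      using quad[of B C] by (simp add: power2_eq_square algebra_simps)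
    with False \<open>B \<ge> 0\<close> show ?thesis by (simp add: zero_le_mult_iff)
  qed
  then show ?thesis by (simp add: A_B_C_def)
qed

lemma PiM_density:
  fixes \<nu> :: "real measure" and R :: "real \<Rightarrow> real"
  assumes \<nu>: "prob_space \<nu>" "sets \<nu> = sets borel" and [measurable]: "R \<in> borel_measurable borel"
    and R0: "\<And>u. 0 \<le> R u" and \<mu>: "prob_space (density \<nu> (\<lambda>u. ennreal (R u)))" and I: "finite I"
  shows "(\<Pi>\<^sub>M i\<in>I. density \<nu> (\<lambda>u. ennreal (R u))) =
    density (\<Pi>\<^sub>M i\<in>I. \<nu>) (\<lambda>w. ennreal (\<Prod>i\<in>I. R (w i)))"
proof -
  interpret n: prob_space \<nu> by fact
  interpret m: prob_space "density \<nu> (\<lambda>u. ennreal (R u))" by fact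
  interpret N: product_sigma_finite "\<lambda>_. \<nu>" by standard
  interpret M: product_sigma_finite "\<lambda>_. density \<nu> (\<lambda>u. ennreal (R u))" by standard
  note [measurable_cong] = \<nu>(2)
  show ?thesis
  proof (rule M.PiM_eqI[symmetric, OF I])
    show "sets (density (\<Pi>\<^sub>M i\<in>I. \<nu>) (\<lambda>w. ennreal (\<Prod>i\<in>I. R (w i)))) =
      sets (\<Pi>\<^sub>M i\<in>I. density \<nu> (\<lambda>u. ennreal (R u)))"
      by (simp cong: sets_PiM_cong)
    fix A assume A: "\<And>i. i \<in> I \<Longrightarrow> A i \<in> sets (density \<nu> (\<lambda>u. ennreal (R u)))"
    then have A': "\<And>i. i \<in> I \<Longrightarrow> A i \<in> sets \<nu>" by simp
    then have [measurable]: "Pi\<^sub>E I A \<in> sets (\<Pi>\<^sub>M i\<in>I. \<nu>)"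
      using I by (intro sets_PiM_I_finite) auto
    have "emeasure (density (\<Pi>\<^sub>M i\<in>I. \<nu>) (\<lambda>w. ennreal (\<Prod>i\<in>I. R (w i)))) (Pi\<^sub>E I A) =
      (\<integral>\<^sup>+w. ennreal (\<Prod>i\<in>I. R (w i)) * indicator (Pi\<^sub>E I A) w \<partial>(\<Pi>\<^sub>M i\<in>I. \<nu>))"
      by (rule emeasure_density) measurable
    also have "\<dots> = (\<integral>\<^sup>+w. (\<Prod>i\<in>I. ennreal (R (w i)) * indicator (A i) (w i)) \<partial>(\<Pi>\<^sub>M i\<in>I. \<nu>))"
    proof (rule nn_integral_cong)
      fix w assume w: "w \<in> space (\<Pi>\<^sub>M i\<in>I. \<nu>)"
      then have "(indicator (Pi\<^sub>E I A) w :: ennreal) = (\<Prod>i\<in>I. indicator (A i) (w i))"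
        using I by (auto simp: indicator_def space_PiM PiE_def Pi_def prod_zero_iff)
      then show "ennreal (\<Prod>i\<in>I. R (w i)) * indicator (Pi\<^sub>E I A) w =
        (\<Prod>i\<in>I. ennreal (R (w i)) * indicator (A i) (w i))"
        using R0 by (simp add: prod.distrib prod_ennreal)
    qed
    also have "\<dots> = (\<Prod>i\<in>I. \<integral>\<^sup>+u. ennreal (R u) * indicator (A i) u \<partial>\<nu>)"
    proof (rule N.product_nn_integral_prod[OF I])
      fix i assume "i \<in> I"
      with A' have [measurable]: "A i \<in> sets \<nu>" by blast
      show "(\<lambda>u. ennreal (R u) * indicator (A i) u) \<in> borel_measurable \<nu>" by measurable
    qed
    also have "\<dots> = (\<Prod>i\<in>I. emeasure (density \<nu> (\<lambda>u. ennreal (R u))) (A i))"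
      using A' by (intro prod.cong refl emeasure_density[symmetric]) auto
    finally show "emeasure (density (\<Pi>\<^sub>M i\<in>I. \<nu>) (\<lambda>w. ennreal (\<Prod>i\<in>I. R (w i)))) (Pi\<^sub>E I A) =
      (\<Prod>i\<in>I. emeasure (density \<nu> (\<lambda>u. ennreal (R u))) (A i))" .
  qed
qed

text \<open>With \<open>\<Lambda>\<close> the product of the ratios, the difference of the means is
  the integral of \<open>\<phi> * (\<Lambda> - 1)\<close> under the second law, and Cauchy-Schwarz
  applies. By independence the second moment of \<open>\<Lambda>\<close> is the n-th power of that
  of \<open>R\<close>, which is 1 plus the chi-square distance. The second moment of
  \<open>\<phi>\<close> is enough in place of its variance, because later the functions are
  truncations of a variable centred at its limit mean.\<close>

lemma product_chapman_robbins:
  fixes \<nu> :: "real measure" and R :: "real \<Rightarrow> real" and \<phi> :: "(nat \<Rightarrow> real) \<Rightarrow> real"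
  assumes \<nu>: "prob_space \<nu>" "sets \<nu> = sets borel" and [measurable]: "R \<in> borel_measurable borel"
    and R0: "\<And>u. 0 \<le> R u" and RC: "\<And>u. R u \<le> C"
    and \<mu>: "prob_space \<mu>" "\<mu> = density \<nu> (\<lambda>u. ennreal (R u))"
    and \<phi>: "\<phi> \<in> borel_measurable (\<Pi>\<^sub>M i\<in>{..<n}. borel)" and K: "\<And>w. \<bar>\<phi> w\<bar> \<le> K"
  shows "((LINT w|(\<Pi>\<^sub>M i\<in>{..<n}. \<mu>). \<phi> w) - (LINT w|(\<Pi>\<^sub>M i\<in>{..<n}. \<nu>). \<phi> w))\<^sup>2 \<le>
    (LINT w|(\<Pi>\<^sub>M i\<in>{..<n}. \<nu>). (\<phi> w)\<^sup>2) * ((1 + (LINT u|\<nu>. (R u - 1)\<^sup>2)) ^ n - 1)"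
proof -
  interpret n: prob_space \<nu> by fact
  interpret N: product_prob_space "\<lambda>_. \<nu>" "{..<n}" by unfold_locales
  note [measurable_cong] = \<nu>(2)
  have [measurable]: "\<phi> \<in> borel_measurable (\<Pi>\<^sub>M i\<in>{..<n}. \<nu>)"
  proof -
    have eq: "sets (\<Pi>\<^sub>M i\<in>{..<n}. \<nu>) = sets (\<Pi>\<^sub>M i\<in>{..<n}. borel)"
      by (intro sets_PiM_cong refl \<nu>)
    show ?thesis unfolding measurable_cong_sets[OF eq refl] by (rule \<phi>)
  qed
  define \<Lambda> where "\<Lambda> w = (\<Prod>i<n. R (w i))" for w :: "nat \<Rightarrow> real"
  have [measurable]: "\<Lambda> \<in> borel_measurable (\<Pi>\<^sub>M i\<in>{..<n}. \<nu>)"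
    unfolding \<Lambda>_def by measurable
  have C0: "0 \<le> C" using R0[of 0] RC[of 0] by simp
  have \<Lambda>0: "0 \<le> \<Lambda> w" for w unfolding \<Lambda>_def using R0 by (intro prod_nonneg) auto
  have \<Lambda>C: "\<Lambda> w \<le> C ^ n" for w
    unfolding \<Lambda>_def using prod_mono[of "{..<n}" "\<lambda>i. R (w i)" "\<lambda>_. C"] R0 RC by simp
  have Rint: "integrable \<nu> R" "integrable \<nu> (\<lambda>u. (R u)\<^sup>2)"
    by (rule n.integrable_const_bound[where B=C], use R0 RC in \<open>auto intro!: AE_I2\<close>)
       (rule n.integrable_const_bound[where B="C\<^sup>2"],
        use R0 RC in \<open>auto intro!: AE_I2 power_mono\<close>)
  have R1: "(LINT u|\<nu>. R u) = 1"
  proof -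
    have "1 = emeasure \<mu> (space \<mu>)" using \<mu>(1) by (simp add: prob_space.emeasure_space_1)
    also have "\<dots> = (\<integral>\<^sup>+u. ennreal (R u) \<partial>\<nu>)"
      unfolding \<mu>(2) by (subst emeasure_density) (auto intro!: nn_integral_cong)
    also have "\<dots> = ennreal (LINT u|\<nu>. R u)"
      using R0 by (intro nn_integral_eq_integral Rint) auto
    finally show ?thesis by simp
  qed
  have R2: "(LINT u|\<nu>. (R u)\<^sup>2) = 1 + (LINT u|\<nu>. (R u - 1)\<^sup>2)"
  proof -
    have "(LINT u|\<nu>. (R u - 1)\<^sup>2) = (LINT u|\<nu>. (R u)\<^sup>2 - 2 * R u + 1)"
      by (intro Bochner_Integration.integral_cong) (auto simp: power2_eq_square algebra_simps)
    also have "\<dots> = (LINT u|\<nu>. (R u)\<^sup>2) - 2 * (LINT u|\<nu>. R u) + 1"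
      using Rint by (simp add: n.prob_space)
    finally show ?thesis by (simp add: R1)
  qed
  have \<Lambda>int: "integrable (\<Pi>\<^sub>M i\<in>{..<n}. \<nu>) \<Lambda>" "integrable (\<Pi>\<^sub>M i\<in>{..<n}. \<nu>) (\<lambda>w. (\<Lambda> w)\<^sup>2)"
    by (rule N.P.integrable_const_bound[where B="C ^ n"], use \<Lambda>0 \<Lambda>C in \<open>auto intro!: AE_I2\<close>)
       (rule N.P.integrable_const_bound[where B="(C ^ n)\<^sup>2"],
        use \<Lambda>0 \<Lambda>C in \<open>auto intro!: AE_I2 power_mono\<close>)
  have L1: "(LINT w|(\<Pi>\<^sub>M i\<in>{..<n}. \<nu>). \<Lambda> w) = 1"
    unfolding \<Lambda>_def using Rint(1) by (subst N.product_integral_prod) (auto simp: R1)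
  have L2: "(LINT w|(\<Pi>\<^sub>M i\<in>{..<n}. \<nu>). (\<Lambda> w)\<^sup>2) = (1 + (LINT u|\<nu>. (R u - 1)\<^sup>2)) ^ n"
    unfolding \<Lambda>_def prod_power_distrib
    using Rint(2) by (subst N.product_integral_prod) (auto simp: R2)
  have L3: "(LINT w|(\<Pi>\<^sub>M i\<in>{..<n}. \<nu>). (\<Lambda> w - 1)\<^sup>2) = (1 + (LINT u|\<nu>. (R u - 1)\<^sup>2)) ^ n - 1"
  proof -
    have "(LINT w|(\<Pi>\<^sub>M i\<in>{..<n}. \<nu>). (\<Lambda> w - 1)\<^sup>2) =
        (LINT w|(\<Pi>\<^sub>M i\<in>{..<n}. \<nu>). (\<Lambda> w)\<^sup>2 - 2 * \<Lambda> w + 1)"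
      by (intro Bochner_Integration.integral_cong) (auto simp: power2_eq_square algebra_simps)
    also have "\<dots> = (LINT w|(\<Pi>\<^sub>M i\<in>{..<n}. \<nu>). (\<Lambda> w)\<^sup>2) - 2 * (LINT w|(\<Pi>\<^sub>M i\<in>{..<n}. \<nu>). \<Lambda> w) + 1"
      using \<Lambda>int by (simp add: N.P.prob_space)
    finally show ?thesis by (simp add: L1 L2)
  qed
  have "(\<Pi>\<^sub>M i\<in>{..<n}. \<mu>) = density (\<Pi>\<^sub>M i\<in>{..<n}. \<nu>) (\<lambda>w. ennreal (\<Lambda> w))"
    unfolding \<mu>(2) \<Lambda>_def using \<mu> by (intro PiM_density \<nu> R0) auto
  then have "(LINT w|(\<Pi>\<^sub>M i\<in>{..<n}. \<mu>). \<phi> w) = (LINT w|(\<Pi>\<^sub>M i\<in>{..<n}. \<nu>). \<Lambda> w * \<phi> w)"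
    using \<Lambda>0 by (simp add: integral_density)
  moreover have "integrable (\<Pi>\<^sub>M i\<in>{..<n}. \<nu>) \<phi>"
    by (rule N.P.integrable_const_bound[where B=K]) (use K in \<open>auto intro!: AE_I2\<close>)
  moreover have "integrable (\<Pi>\<^sub>M i\<in>{..<n}. \<nu>) (\<lambda>w. \<Lambda> w * \<phi> w)"
    by (rule N.P.integrable_const_bound[where B="C ^ n * K"])
       (use K \<Lambda>0 \<Lambda>C C0 in \<open>auto intro!: AE_I2 mult_mono simp: abs_mult\<close>)
  ultimately have "(LINT w|(\<Pi>\<^sub>M i\<in>{..<n}. \<mu>). \<phi> w) - (LINT w|(\<Pi>\<^sub>M i\<in>{..<n}. \<nu>). \<phi> w) =
      (LINT w|(\<Pi>\<^sub>M i\<in>{..<n}. \<nu>). \<phi> w * (\<Lambda> w - 1))"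
    by (simp add: algebra_simps)
  also have "\<dots>\<^sup>2 \<le> (LINT w|(\<Pi>\<^sub>M i\<in>{..<n}. \<nu>). (\<phi> w)\<^sup>2) * (LINT w|(\<Pi>\<^sub>M i\<in>{..<n}. \<nu>). (\<Lambda> w - 1)\<^sup>2)"
  proof (rule N.P.integral_Cauchy_Schwarz_bounded[where K="max K (C ^ n + 1)"])
    show "\<bar>\<phi> w\<bar> \<le> max K (C ^ n + 1)" for w using K[of w] by simp
    show "\<bar>\<Lambda> w - 1\<bar> \<le> max K (C ^ n + 1)" for w using \<Lambda>0[of w] \<Lambda>C[of w] by simp
  qed measurable
  finally show ?thesis by (simp add: L3)
qed

section \<open>Weak convergence and the number of exceedances\<close>

lemma weak_conv_eventually_cong:
  assumes "\<forall>\<^sub>F n in sequentially. \<mu> n = \<nu> n"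
  shows "weak_conv_m \<mu> Q \<longleftrightarrow> weak_conv_m \<nu> Q"
proof -
  have "(\<lambda>n. cdf (\<mu> n) x) \<longlonglongrightarrow> cdf Q x \<longleftrightarrow> (\<lambda>n. cdf (\<nu> n) x) \<longlonglongrightarrow> cdf Q x" for x
    by (rule tendsto_cong, rule eventually_mono[OF assms]) simp
  then show ?thesis by (simp add: weak_conv_m_def weak_conv_def)
qed

text \<open>Local parameters lie in (0,1) only for large \<open>n\<close>, so only then are the laws
  known to be probability measures. The finitely many other terms are replaced by
  \<open>Q\<close>.\<close>

lemma weak_conv_integral_eventually:
  fixes f :: "real \<Rightarrow> real"
  assumes w: "weak_conv_m \<mu> Q" and \<mu>: "\<forall>\<^sub>F n in sequentially. real_distribution (\<mu> n)"
    and Q: "real_distribution Q" and f: "\<And>x. isCont f x" "\<And>x. \<bar>f x\<bar> \<le> B"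
  shows "(\<lambda>n. integral\<^sup>L (\<mu> n) f) \<longlonglongrightarrow> integral\<^sup>L Q f"
proof -
  define \<nu> where "\<nu> n = (if real_distribution (\<mu> n) then \<mu> n else Q)" for n
  have eq: "\<forall>\<^sub>F n in sequentially. \<mu> n = \<nu> n"
    using \<mu> by eventually_elim (simp add: \<nu>_def)
  have "(\<lambda>n. integral\<^sup>L (\<nu> n) f) \<longlonglongrightarrow> integral\<^sup>L Q f"
  proof (rule weak_conv_imp_integral_bdd_continuous_conv)
    show "weak_conv_m \<nu> Q" using w weak_conv_eventually_cong[OF eq] by blast
    show "real_distribution (\<nu> n)" for n using Q by (simp add: \<nu>_def)
    show "norm (f x) \<le> B" for x using f by simp
  qed (use Q f in auto)
  moreover have "\<forall>\<^sub>F n in sequentially. integral\<^sup>L (\<nu> n) f = integral\<^sup>L (\<mu> n) f"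
    using eq by eventually_elim simp
  ultimately show ?thesis by (rule Lim_transform_eventually)
qed

lemma levy_continuity_eventually:
  assumes \<mu>: "\<forall>\<^sub>F n in sequentially. real_distribution (\<mu> n)" and Q: "real_distribution Q"
    and char: "\<And>t. (\<lambda>n. char (\<mu> n) t) \<longlonglongrightarrow> char Q t"
  shows "weak_conv_m \<mu> Q"
proof -
  define \<nu> where "\<nu> n = (if real_distribution (\<mu> n) then \<mu> n else Q)" for n
  have eq: "\<forall>\<^sub>F n in sequentially. \<mu> n = \<nu> n"
    using \<mu> by eventually_elim (simp add: \<nu>_def)
  have "weak_conv_m \<nu> Q"
  proof (rule levy_continuity)
    show "real_distribution (\<nu> n)" for n using Q by (simp add: \<nu>_def)
    show "(\<lambda>n. char (\<nu> n) t) \<longlonglongrightarrow> char Q t" for t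
    proof (rule Lim_transform_eventually[OF char])
      show "\<forall>\<^sub>F n in sequentially. char (\<mu> n) t = char (\<nu> n) t"
        using eq by eventually_elim simp
    qed
  qed (rule Q)
  with weak_conv_eventually_cong[OF eq] show ?thesis by blast
qed

section \<open>The sample of clipped suprema and its number of exceedances\<close>

lemma copies_distr:
  assumes copies: "independent_copies P Xs M X" and X: "continuous_process M X" and n: "n > 0"
  shows "prob_space P"
    and "(\<lambda>\<omega>. \<lambda>i\<in>{..<n}. clipped_sup c (path01 (Xs i) \<omega>)) \<in> P \<rightarrow>\<^sub>M (\<Pi>\<^sub>M i\<in>{..<n}. borel)"
    and "distr P (\<Pi>\<^sub>M i\<in>{..<n}. borel) (\<lambda>\<omega>. \<lambda>i\<in>{..<n}. clipped_sup c (path01 (Xs i) \<omega>)) =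
      (\<Pi>\<^sub>M i\<in>{..<n}. sup_law M X c)"
proof -
  have cp: "continuous_process P (Xs i)" for i
    using copies by (simp add: independent_copies_def nonpos_continuous_process_def)
  then show "prob_space P" by (auto simp: continuous_process_def)
  then interpret prob_space P .
  have m: "path01 (Xs i) \<in> P \<rightarrow>\<^sub>M path_space" for i by (rule path01_measurable[OF cp])
  have rv: "(\<lambda>\<omega>. clipped_sup c (path01 (Xs i) \<omega>)) \<in> borel_measurable P" for i
    by (rule clipped_sup_path_measurable[OF cp])
  then show "(\<lambda>\<omega>. \<lambda>i\<in>{..<n}. clipped_sup c (path01 (Xs i) \<omega>)) \<in> P \<rightarrow>\<^sub>M (\<Pi>\<^sub>M i\<in>{..<n}. borel)"
    by (intro measurable_restrict)
  have "indep_vars (\<lambda>_. path_space) (\<lambda>i. path01 (Xs i)) {..<n}"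
    using copies indep_vars_subset[of "\<lambda>_. path_space" "\<lambda>i. path01 (Xs i)" UNIV "{..<n}"]
    by (simp add: independent_copies_def)
  then have indep: "indep_vars (\<lambda>_. borel) (\<lambda>i \<omega>. clipped_sup c (path01 (Xs i) \<omega>)) {..<n}"
    by (rule indep_vars_compose2) measurable
  have "distr P borel (\<lambda>\<omega>. clipped_sup c (path01 (Xs i) \<omega>)) = sup_law M X c" for i
  proof -
    have "distr P borel (\<lambda>\<omega>. clipped_sup c (path01 (Xs i) \<omega>)) =
        distr (distr P path_space (path01 (Xs i))) borel (clipped_sup c)"
      using m[of i] by (subst distr_distr) (auto simp: o_def)
    also have "distr P path_space (path01 (Xs i)) = distr M path_space (path01 X)"
      using copies by (simp add: independent_copies_def)
    also have "distr \<dots> borel (clipped_sup c) = sup_law M X c"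
      unfolding sup_law_def using path01_measurable[OF X]
      by (subst distr_distr) (auto simp: o_def)
    finally show ?thesis .
  qed
  with indep show "distr P (\<Pi>\<^sub>M i\<in>{..<n}. borel) (\<lambda>\<omega>. \<lambda>i\<in>{..<n}. clipped_sup c (path01 (Xs i) \<omega>)) =
      (\<Pi>\<^sub>M i\<in>{..<n}. sup_law M X c)"
    using n rv by (subst (asm) indep_vars_iff_distr_eq_PiM') auto
qed

lemma exceedance_count_copies:
  assumes copies: "independent_copies P Xs M X" and c: "c < 0" and \<omega>: "\<omega> \<in> space P"
  shows "exceedance_process Xs n c \<omega> = count_measure_of n (\<lambda>i\<in>{..<n}. clipped_sup c (path01 (Xs i) \<omega>))"
    and "exceedance_process Xs n c \<omega> {0..<1} = real (exceedance_count Xs n c \<omega>)"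
    and "real (exceedance_count Xs n c \<omega>) =
      (\<Sum>i<n. indicator {..<1} (clipped_sup c (path01 (Xs i) \<omega>)))"
proof -
  have 1: "continuous_on {0..1} (\<lambda>t. Xs i t \<omega>)" for i
    using copies \<omega>
    by (simp add: independent_copies_def nonpos_continuous_process_def continuous_process_def)
  have 2: "Xs i t \<omega> \<le> 0" if "t \<in> {0..1}" for i t
    using copies \<omega> that by (simp add: independent_copies_def nonpos_continuous_process_def)
  show "exceedance_process Xs n c \<omega> = count_measure_of n (\<lambda>i\<in>{..<n}. clipped_sup c (path01 (Xs i) \<omega>))"
    by (rule exceedance_process_eq) (rule 1)
  show "exceedance_process Xs n c \<omega> {0..<1} = real (exceedance_count Xs n c \<omega>)"
    by (rule exceedance_count_eq_process(1)) (use 1 2 c in auto)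
  show "real (exceedance_count Xs n c \<omega>) =
      (\<Sum>i<n. indicator {..<1} (clipped_sup c (path01 (Xs i) \<omega>)))"
    by (rule exceedance_count_eq_process(2)) (use 1 2 c in auto)
qed

lemma exceedance_count_measurable:
  assumes copies: "independent_copies P Xs M X" and c: "c < 0"
  shows "(\<lambda>\<omega>. real (exceedance_count Xs n c \<omega>)) \<in> borel_measurable P"
proof -
  have [measurable]: "(\<lambda>\<omega>. clipped_sup c (path01 (Xs i) \<omega>)) \<in> borel_measurable P" for i
    using copies
    by (intro clipped_sup_path_measurable) (simp add: independent_copies_def nonpos_continuous_process_def)
  have "(\<lambda>\<omega>. \<Sum>i<n. indicator {..<1} (clipped_sup c (path01 (Xs i) \<omega>)) :: real) \<in> borel_measurable P"
    by measurable
  then show ?thesis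
    by (rule measurable_cong[THEN iffD1, rotated])
       (simp add: exceedance_count_copies(3)[OF copies c])
qed

lemma exceedance_count_char:
  assumes copies: "independent_copies P Xs M X" and X: "continuous_process M X" and n: "n > 0" and c: "c < 0"
  shows "(CLINT \<omega>|P. iexp (s * real (exceedance_count Xs n c \<omega>))) =
    (1 + of_real (prob_gt M X (\<lambda>t. c)) * (iexp s - 1)) ^ n"
proof -
  define \<nu> where "\<nu> = sup_law M X c"
  define h where "h u = iexp (s * indicator {..<1} u)" for u :: real
  interpret n: real_distribution \<nu> unfolding \<nu>_def by (rule real_distribution_sup_law[OF X])
  interpret N: product_prob_space "\<lambda>_. \<nu>" "{..<n}" by unfold_locales
  have [measurable]: "h \<in> borel_measurable borel" unfolding h_def by measurable
  have [measurable]: "(\<lambda>w. \<Prod>i<n. h (w i)) \<in> borel_measurable (\<Pi>\<^sub>M i\<in>{..<n}. borel)" by measurable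
  have "(CLINT \<omega>|P. iexp (s * real (exceedance_count Xs n c \<omega>))) =
    (CLINT \<omega>|P. (\<Prod>i<n. h ((\<lambda>i\<in>{..<n}. clipped_sup c (path01 (Xs i) \<omega>)) i)))"
  proof (rule Bochner_Integration.integral_cong[OF refl])
    fix \<omega> assume \<omega>: "\<omega> \<in> space P"
    have "iexp (s * (\<Sum>i<n. g i)) = (\<Prod>i<n. iexp (s * g i))" for g :: "nat \<Rightarrow> real"
      by (simp add: sum_distrib_left exp_sum)
    note prod_iexp = this
    show "iexp (s * real (exceedance_count Xs n c \<omega>)) =
        (\<Prod>i<n. h ((\<lambda>i\<in>{..<n}. clipped_sup c (path01 (Xs i) \<omega>)) i))"
      unfolding exceedance_count_copies(3)[OF copies c \<omega>] prod_iexp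
      by (rule prod.cong) (simp_all add: h_def)
  qed
  also have "\<dots> = (CLINT w|distr P (\<Pi>\<^sub>M i\<in>{..<n}. borel) (\<lambda>\<omega>. \<lambda>i\<in>{..<n}. clipped_sup c (path01 (Xs i) \<omega>)).
      (\<Prod>i<n. h (w i)))"
    by (rule integral_distr[symmetric, OF copies_distr(2)[OF copies X n]]) measurable
  also have "\<dots> = (CLINT w|(\<Pi>\<^sub>M i\<in>{..<n}. \<nu>). (\<Prod>i<n. h (w i)))"
    by (simp add: copies_distr(3)[OF copies X n] \<nu>_def)
  also have "\<dots> = (\<Prod>i<n. (CLINT u|\<nu>. h u))"
  proof (rule N.product_integral_prod)
    show "integrable \<nu> h"
      by (rule n.integrable_const_bound[where B=1]) (auto simp: h_def)
  qed simp
  also have "(CLINT u|\<nu>. h u) = (CLINT u|\<nu>. 1 + indicator {..<1} u *\<^sub>R (iexp s - 1))"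
    by (intro Bochner_Integration.integral_cong) (auto simp: h_def indicator_def)
  also have "\<dots> = 1 + measure \<nu> {..<1} *\<^sub>R (iexp s - 1)"
  proof -
    have i: "integrable \<nu> (\<lambda>u. indicator {..<1} u :: real)"
      by (intro integrable_real_indicator) (auto simp: n.emeasure_eq_measure)
    have "(CLINT u|\<nu>. 1 + indicator {..<1} u *\<^sub>R (iexp s - 1)) =
        (CLINT u|\<nu>. 1) + (CLINT u|\<nu>. indicator {..<1} u *\<^sub>R (iexp s - 1))"
      by (intro Bochner_Integration.integral_add n.integrable_const integrable_scaleR_left impI i)
    also have "(CLINT u|\<nu>. 1) = 1"
      using n.prob_space by simp
    also have "(CLINT u|\<nu>. indicator {..<1} u *\<^sub>R (iexp s - 1)) = (LINT u|\<nu>. indicator {..<1} u) *\<^sub>R (iexp s - 1)"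
      by (intro integral_scaleR_left impI i)
    also have "(LINT u|\<nu>. indicator {..<1} u) = measure \<nu> {..<1}"
      by simp
    finally show ?thesis .
  qed
  also have "measure \<nu> {..<1} = prob_gt M X (\<lambda>t. c)"
    using measure_sup_law_lessThan[OF X c, of 1] by (simp add: \<nu>_def)
  finally show ?thesis by (simp add: scaleR_conv_of_real)
qed

text \<open>Here \<open>p\<close> are success probabilities, \<open>a\<close> the scale and
  \<open>b\<close> the centring; as \<open>p\<close> tends to 0, the variance n p (1 - p) may be
  replaced by n p. Both \<open>1 + w n\<close> and \<open>exp (w n)\<close> have modulus at most 1,
  so their n-th powers differ by at most \<open>n\<close> times their distance, which is of order n
  p^2 / a^2 and vanishes. After this exchange only the exponent has to be expanded.\<close>

lemma binomial_char_limit: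
  fixes a p b :: "nat \<Rightarrow> real"
  assumes p: "\<And>n. 0 \<le> p n" "\<And>n. p n \<le> 1" and a: "filterlim a at_top sequentially"
    and p0: "p \<longlonglongrightarrow> 0" and var: "(\<lambda>n. real n * p n / (a n)\<^sup>2) \<longlonglongrightarrow> v"
    and mean: "(\<lambda>n. real n * p n / a n - b n) \<longlonglongrightarrow> 0"
  shows "(\<lambda>n. iexp (- (t * b n)) * (1 + of_real (p n) * (iexp (t / a n) - 1)) ^ n)
    \<longlonglongrightarrow> of_real (exp (- (t\<^sup>2 * v / 2)))"
proof -
  define u where "u n = t / a n" for n
  define w where "w n = of_real (p n) * (iexp (u n) - 1)" for n
  have ainf: "filterlim a at_infinity sequentially" using a by (rule filterlim_at_top_imp_at_infinity)
  have ainv: "(\<lambda>n. 1 / a n) \<longlonglongrightarrow> 0"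
    by (rule tendsto_divide_0[OF tendsto_const ainf])
  have e1: "cmod (iexp x - 1) \<le> \<bar>x\<bar>" for x
    using iexp_approx1[of x 0] by simp
  have e2: "cmod (iexp x - 1 - \<i> * x + of_real (x\<^sup>2 / 2)) \<le> \<bar>x\<bar> ^ 3 / 6" for x
  proof -
    have "(\<Sum>k\<le>2. (\<i> * x) ^ k / fact k) = 1 + \<i> * x - of_real (x\<^sup>2 / 2)"
      by (simp add: numeral_2_eq_2 power_mult_distrib)
    then have "iexp x - 1 - \<i> * x + of_real (x\<^sup>2 / 2) = iexp x - (\<Sum>k\<le>2. (\<i> * x) ^ k / fact k)"
      by (simp only: diff_diff_eq diff_diff_eq2 diff_add_eq)
    moreover have "fact (Suc 2) = (6::real)" "Suc 2 = 3" by (simp_all add: fact_numeral numeral_3_eq_3)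
    ultimately show ?thesis using iexp_approx1[of x 2] by (simp only:)
  qed
  have w1: "cmod (1 + w n) \<le> 1" for n
  proof -
    have "1 + w n = of_real (1 - p n) + of_real (p n) * iexp (u n)"
      by (simp add: w_def algebra_simps)
    also have "cmod \<dots> \<le> cmod (of_real (1 - p n)) + cmod (of_real (p n) * iexp (u n))"
      by (rule norm_triangle_ineq)
    also have "\<dots> = 1" using p[of n] by (simp add: norm_mult del: of_real_diff)
    finally show ?thesis .
  qed
  have wn: "cmod (w n) \<le> p n * \<bar>u n\<bar>" for n
    unfolding w_def using e1[of "u n"] p(1)[of n] by (simp add: norm_mult mult_left_mono)
  have Rew: "Re (w n) \<le> 0" for n
    unfolding w_def using p(1)[of n] by (simp add: Re_exp mult_le_0_iff)
  have w2: "cmod (w n) \<le> 2" for n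
    using norm_triangle_ineq4[of "1 + w n" 1] w1[of n] by simp
  have ew1: "cmod (exp (w n)) \<le> 1" for n using Rew by simp
  \<comment> \<open>The constant \<open>exp 2\<close> bounds
    \<open>exp \<bar>Re (w n)\<bar>\<close>, by \<open>w2\<close>.\<close>
  have d: "cmod (1 + w n - exp (w n)) \<le> exp 2 * (p n * \<bar>u n\<bar>)\<^sup>2" for n
  proof -
    have "cmod (1 + w n - exp (w n)) = cmod (exp (w n) - (\<Sum>k\<le>1. w n ^ k / fact k))"
      by (simp add: norm_minus_commute)
    also have "\<dots> \<le> exp \<bar>Re (w n)\<bar> * cmod (w n) ^ 2"
      using Taylor_exp[of "w n" 1] by (simp add: numeral_2_eq_2)
    also have "\<dots> \<le> exp 2 * (p n * \<bar>u n\<bar>)\<^sup>2"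
      using w2[of n] abs_Re_le_cmod[of "w n"] wn[of n]
      by (intro mult_mono power_mono) auto
    finally show ?thesis .
  qed
  have lim1: "(\<lambda>n. (1 + w n) ^ n - exp (w n) ^ n) \<longlonglongrightarrow> 0"
  proof (rule Lim_null_comparison)
    show "\<forall>\<^sub>F n in sequentially. cmod ((1 + w n) ^ n - exp (w n) ^ n) \<le>
        exp 2 * t\<^sup>2 * ((real n * p n / (a n)\<^sup>2) * p n)"
    proof (rule always_eventually, rule allI)
      fix n
      have "cmod ((1 + w n) ^ n - exp (w n) ^ n) \<le> real n * cmod (1 + w n - exp (w n))"
        using norm_power_diff[OF w1 ew1, of n n] by simp
      also have "\<dots> \<le> real n * (exp 2 * (p n * \<bar>u n\<bar>)\<^sup>2)"
        by (intro mult_left_mono d) simp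
      also have "\<dots> = exp 2 * t\<^sup>2 * ((real n * p n / (a n)\<^sup>2) * p n)"
        by (simp add: u_def power_mult_distrib power_divide power2_eq_square)
      finally show "cmod ((1 + w n) ^ n - exp (w n) ^ n) \<le>
        exp 2 * t\<^sup>2 * ((real n * p n / (a n)\<^sup>2) * p n)" .
    qed
    show "(\<lambda>n. exp 2 * t\<^sup>2 * ((real n * p n / (a n)\<^sup>2) * p n)) \<longlonglongrightarrow> 0"
      using tendsto_mult[OF tendsto_const tendsto_mult[OF var p0], of "exp 2 * t\<^sup>2"] by simp
  qed
  \<comment> \<open>The third-order Taylor remainder, of order n p / a^3: the variance, which
    converges, times 1 / a.\<close>
  define R where "R n = of_nat n * of_real (p n) * (iexp (u n) - 1 - \<i> * u n + of_real ((u n)\<^sup>2 / 2))" for n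
  have R: "R \<longlonglongrightarrow> 0"
  proof (rule Lim_null_comparison)
    show "\<forall>\<^sub>F n in sequentially. cmod (R n) \<le> \<bar>t\<bar> ^ 3 / 6 * ((real n * p n / (a n)\<^sup>2) * \<bar>1 / a n\<bar>)"
    proof (rule always_eventually, rule allI)
      fix n
      have "cmod (R n) \<le> real n * p n * (\<bar>u n\<bar> ^ 3 / 6)"
      proof -
        have "cmod (R n) = real n * p n * cmod (iexp (u n) - 1 - \<i> * u n + of_real ((u n)\<^sup>2 / 2))"
          unfolding R_def norm_mult using p(1)[of n] by (simp del: of_real_divide of_real_power)
        also have "\<dots> \<le> real n * p n * (\<bar>u n\<bar> ^ 3 / 6)"
          using p(1)[of n] by (intro mult_left_mono e2) simp
        finally show ?thesis .
      qed
      also have "\<dots> = \<bar>t\<bar> ^ 3 / 6 * ((real n * p n / (a n)\<^sup>2) * \<bar>1 / a n\<bar>)"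
      proof -
        have "\<bar>x\<bar> ^ 3 = x\<^sup>2 * \<bar>x\<bar>" for x :: real
          by (simp add: power3_eq_cube power2_eq_square)
        then have "\<bar>u n\<bar> ^ 3 = \<bar>t\<bar> ^ 3 * ((1 / a n)\<^sup>2 * \<bar>1 / a n\<bar>)"
          by (simp add: u_def power_mult_distrib power_divide abs_mult abs_divide)
        then show ?thesis by (simp add: power_divide mult_ac)
      qed
      finally show "cmod (R n) \<le> \<bar>t\<bar> ^ 3 / 6 * ((real n * p n / (a n)\<^sup>2) * \<bar>1 / a n\<bar>)" .
    qed
    show "(\<lambda>n. \<bar>t\<bar> ^ 3 / 6 * ((real n * p n / (a n)\<^sup>2) * \<bar>1 / a n\<bar>)) \<longlonglongrightarrow> 0"
      using tendsto_mult[OF tendsto_const tendsto_mult[OF var tendsto_rabs[OF ainv]], of "\<bar>t\<bar> ^ 3 / 6"]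
      by simp
  qed
  \<comment> \<open>The linear Taylor term cancels the centring in the limit, the quadratic one
    yields the variance.\<close>
  have decomp: "of_nat n * w n - \<i> * of_real (t * b n) =
      R n + \<i> * of_real (t * (real n * p n / a n - b n)) - of_real (t\<^sup>2 / 2 * (real n * p n / (a n)\<^sup>2))" for n
  proof -
    have alg: "N * (e - 1 - \<i> * U + Q) = N * (e - 1) - \<i> * (N * U) + N * Q" for N e U Q :: complex
      by (simp add: algebra_simps)
    have alg2: "W - \<i> * T = (W - \<i> * X + Y) + \<i> * (X - T) - Y" for W T X Y :: complex
      by (simp add: algebra_simps)
    have X: "of_nat n * of_real (p n) * of_real (u n) = (of_real (t * (real n * p n / a n)) :: complex)"
      by (simp add: u_def)
    have Y: "of_nat n * of_real (p n) * of_real ((u n)\<^sup>2 / 2) =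
        (of_real (t\<^sup>2 / 2 * (real n * p n / (a n)\<^sup>2)) :: complex)"
      by (simp add: u_def power_divide mult_ac)
    have "R n = of_nat n * w n - \<i> * of_real (t * (real n * p n / a n)) +
        of_real (t\<^sup>2 / 2 * (real n * p n / (a n)\<^sup>2))"
      unfolding R_def w_def alg X Y by (simp only: mult.assoc)
    then show ?thesis
      unfolding right_diff_distrib[of t] of_real_diff by (simp only: alg2[symmetric])
  qed
  have "(\<lambda>n. of_nat n * w n - \<i> * of_real (t * b n)) \<longlonglongrightarrow>
      0 + \<i> * of_real (t * 0) - of_real (t\<^sup>2 / 2 * v)"
    unfolding decomp by (intro tendsto_intros R mean var)
  then have "(\<lambda>n. exp (of_nat n * w n - \<i> * of_real (t * b n))) \<longlonglongrightarrow>
      exp (0 + \<i> * of_real (t * 0) - of_real (t\<^sup>2 / 2 * v))"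
    by (rule tendsto_exp)
  also have "exp (0 + \<i> * of_real (t * 0) - of_real (t\<^sup>2 / 2 * v)) = of_real (exp (- (t\<^sup>2 * v / 2)))"
    by (simp add: exp_of_real[symmetric])
  also have "(\<lambda>n. exp (of_nat n * w n - \<i> * of_real (t * b n))) =
      (\<lambda>n. iexp (- (t * b n)) * exp (w n) ^ n)"
  proof
    fix n
    have "exp (of_nat n * w n - \<i> * of_real (t * b n)) = exp (of_nat n * w n) * iexp (- (t * b n))"
      unfolding exp_add[symmetric] by simp
    then show "exp (of_nat n * w n - \<i> * of_real (t * b n)) = iexp (- (t * b n)) * exp (w n) ^ n"
      by (simp only: exp_of_nat_mult mult.commute)
  qed
  finally have lim2: "(\<lambda>n. iexp (- (t * b n)) * exp (w n) ^ n) \<longlonglongrightarrow> of_real (exp (- (t\<^sup>2 * v / 2)))" .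
  have "(\<lambda>n. iexp (- (t * b n)) * ((1 + w n) ^ n - exp (w n) ^ n)) \<longlonglongrightarrow> 0"
  proof (rule Lim_null_comparison[OF _ tendsto_norm_zero[OF lim1]])
    have "cmod (iexp (- (t * b n)) * z) \<le> cmod z" for n z
      by (simp only: norm_mult norm_exp_i_times mult_1_left order_refl)
    then show "\<forall>\<^sub>F n in sequentially. cmod (iexp (- (t * b n)) * ((1 + w n) ^ n - exp (w n) ^ n)) \<le>
        cmod ((1 + w n) ^ n - exp (w n) ^ n)"
      by (intro always_eventually allI)
  qed
  from tendsto_add[OF this lim2]
  have "(\<lambda>n. iexp (- (t * b n)) * (1 + w n) ^ n) \<longlonglongrightarrow> of_real (exp (- (t\<^sup>2 * v / 2)))"
    by (simp only: right_diff_distrib diff_add_cancel add_0_left)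
  then show ?thesis
    by (simp only: w_def u_def)
qed

section \<open>Local expansions of the exceedance law\<close>

locale exceedance_model = profile_density \<psi> for \<psi> :: "real \<Rightarrow> real" +
  fixes \<delta> \<gamma> \<theta>0 L :: real
    and M :: "real \<Rightarrow> 'a measure" and X :: "real \<Rightarrow> 'a \<Rightarrow> real"
  assumes delta: "\<delta> > 0" and gamma: "\<gamma> > 0" and theta0: "\<theta>0 \<in> {0<..<1}"
    and X_process: "\<And>\<theta>. \<theta> \<in> {0<..<1} \<Longrightarrow> continuous_process (M \<theta>) X"
    and X_C: "\<And>\<theta>. \<theta> \<in> {0<..<1} \<Longrightarrow> condition_C \<psi> (beta_of \<psi> \<theta>) \<delta> (M \<theta>) X"
    and X_D: "condition_D \<theta>0 L \<gamma> M X"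
begin

definition surv :: "real \<Rightarrow> real \<Rightarrow> real" where
  "surv \<theta> y = prob_gt (M \<theta>) X (\<lambda>t. y)"

definition law :: "real \<Rightarrow> real \<Rightarrow> real measure" where
  "law \<theta> y = sup_law (M \<theta>) X y"

lemma surv_bounds:
  assumes "\<theta> \<in> {0<..<1}" shows "0 \<le> surv \<theta> y" "surv \<theta> y \<le> 1"
proof -
  interpret prob_space "M \<theta>" using X_process[OF assms] by (simp add: continuous_process_def)
  show "0 \<le> surv \<theta> y" "surv \<theta> y \<le> 1" by (simp_all add: surv_def prob_gt_def)
qed

lemma surv_tail:
  assumes \<theta>: "\<theta> \<in> {0<..<1}"
  obtains B x1 where "x1 > 0" "B \<ge> 0"
    "\<And>y. y \<in> {-x1<..<0} \<Longrightarrow> \<bar>surv \<theta> y / \<bar>y\<bar> - \<theta>\<bar> \<le> B * \<bar>y\<bar> powr \<delta>"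
proof -
  obtain B x1 where B: "x1 > 0" "B \<ge> 0"
    "\<And>x. x \<in> {0<..<x1} \<Longrightarrow> \<bar>prob_gt (M \<theta>) X (\<lambda>t. - x) - x * \<theta>\<bar> \<le> x * (B * x powr \<delta>)"
    using condition_C_tail[OF X_C[OF \<theta>] beta_of[OF \<theta>] delta] by blast
  show ?thesis
  proof (rule that[OF B(1,2)])
    fix y assume y: "y \<in> {-x1<..<0}"
    define x where "x = - y"
    have x: "x \<in> {0<..<x1}" "x > 0" "y = - x" using y by (auto simp: x_def)
    have "\<bar>surv \<theta> y / \<bar>y\<bar> - \<theta>\<bar> = \<bar>surv \<theta> y - x * \<theta>\<bar> / x"
    proof -
      have "surv \<theta> y / \<bar>y\<bar> - \<theta> = (surv \<theta> y - x * \<theta>) / x"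
        using x(2) by (simp add: x(3) field_simps)
      then show ?thesis using x(2) by (simp add: abs_divide)
    qed
    also have "\<dots> \<le> x * (B * x powr \<delta>) / x"
      using B(3)[OF x(1)] x by (intro divide_right_mono) (auto simp: surv_def)
    finally show "\<bar>surv \<theta> y / \<bar>y\<bar> - \<theta>\<bar> \<le> B * \<bar>y\<bar> powr \<delta>"
      using x by simp
  qed
qed

lemma surv_ratio_lim:
  assumes \<theta>: "\<theta> \<in> {0<..<1}"
  shows "((\<lambda>y. surv \<theta> y / \<bar>y\<bar>) \<longlongrightarrow> \<theta>) (at_left 0)"
proof -
  obtain B x1 where B: "x1 > 0" "B \<ge> 0"
    "\<And>y. y \<in> {-x1<..<0} \<Longrightarrow> \<bar>surv \<theta> y / \<bar>y\<bar> - \<theta>\<bar> \<le> B * \<bar>y\<bar> powr \<delta>"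
    using surv_tail[OF \<theta>] by blast
  have "((\<lambda>y. surv \<theta> y / \<bar>y\<bar> - \<theta>) \<longlongrightarrow> 0) (at_left 0)"
  proof (rule Lim_null_comparison)
    show "\<forall>\<^sub>F y in at_left 0. norm (surv \<theta> y / \<bar>y\<bar> - \<theta>) \<le> B * \<bar>y\<bar> powr \<delta>"
      unfolding eventually_at_left_field using B by (intro exI[of _ "- x1"]) auto
    have "((\<lambda>y::real. \<bar>y\<bar> powr \<delta>) \<longlongrightarrow> 0) (at_left 0)"
      using delta by (intro tendsto_zero_powrI[of _ _ _ \<delta>] tendsto_rabs_zero tendsto_ident_at tendsto_const) auto
    then show "((\<lambda>y. B * \<bar>y\<bar> powr \<delta>) \<longlongrightarrow> 0) (at_left 0)"
      by (rule tendsto_mult_right_zero)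
  qed
  then show ?thesis by (simp only: LIM_zero_iff)
qed

lemma surv_lim_zero:
  assumes \<theta>: "\<theta> \<in> {0<..<1}"
  shows "(surv \<theta> \<longlongrightarrow> 0) (at_left 0)"
proof -
  have "((\<lambda>y. surv \<theta> y / \<bar>y\<bar> * \<bar>y\<bar>) \<longlongrightarrow> \<theta> * 0) (at_left 0)"
    by (intro tendsto_mult surv_ratio_lim[OF \<theta>] tendsto_rabs_zero tendsto_ident_at)
  moreover have "\<forall>\<^sub>F y in at_left 0. surv \<theta> y / \<bar>y\<bar> * \<bar>y\<bar> = surv \<theta> y"
    unfolding eventually_at_left_field by (intro exI[of _ "-1"]) auto
  ultimately show ?thesis using tendsto_cong by fastforce
qed

lemma law_facts:
  assumes \<theta>: "\<theta> \<in> {0<..<1}" and y: "y < 0"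
  shows "real_distribution (law \<theta> y)" "measure (law \<theta> y) {1<..} = 0" "measure (law \<theta> y) {..0} = 0"
    "measure (law \<theta> y) {..<1} = surv \<theta> y"
    "\<And>u. 0 < u \<Longrightarrow> u \<le> 1 \<Longrightarrow> measure (law \<theta> y) {..<u} = surv \<theta> (u * y)"
    "measure (law \<theta> y) {1} = 1 - surv \<theta> y"
proof -
  show rd: "real_distribution (law \<theta> y)"
    unfolding law_def by (rule real_distribution_sup_law[OF X_process[OF \<theta>]])
  show one: "measure (law \<theta> y) {1<..} = 0"
    unfolding law_def by (rule measure_sup_law_greater_one[OF X_process[OF \<theta>]])
  show lt: "measure (law \<theta> y) {..<u} = surv \<theta> (u * y)" if "0 < u" "u \<le> 1" for u
    unfolding law_def surv_def using that y by (intro measure_sup_law_lessThan X_process[OF \<theta>])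
  then show lt1: "measure (law \<theta> y) {..<1} = surv \<theta> y" by simp
  interpret real_distribution "law \<theta> y" by (rule rd)
  \<comment> \<open>There is no mass at or below 0, because the levels \<open>u * y\<close> tend to
    0 with \<open>u\<close> and (C) makes their exceedance probabilities vanish.\<close>
  have "measure (law \<theta> y) {..0} \<le> e" if e: "0 < e" for e
  proof -
    have "\<forall>\<^sub>F z in at_left 0. surv \<theta> z < e"
      by (rule order_tendstoD(2)[OF surv_lim_zero[OF \<theta>] e])
    then obtain b where b: "b < 0" "\<And>z. b < z \<Longrightarrow> z < 0 \<Longrightarrow> surv \<theta> z < e"
      unfolding eventually_at_left_field by auto
    \<comment> \<open>Chosen so that \<open>u * y \<ge> b / 2 > b\<close>; the minimum keeps
      \<open>u\<close> in (0,1].\<close>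
    define u where "u = min 1 (b / (2 * y))"
    have u: "0 < u" "u \<le> 1" using b y by (auto simp: u_def divide_neg_neg)
    have "u \<le> b / (2 * y)" by (simp add: u_def)
    then have "u * y \<ge> b / (2 * y) * y" using y by (intro mult_right_mono_neg) auto
    then have "b < u * y" using b y by simp
    have "measure (law \<theta> y) {..0} \<le> measure (law \<theta> y) {..<u}"
      using u by (intro finite_measure_mono) auto
    also have "\<dots> < e"
      using u y b(2)[OF \<open>b < u * y\<close>] by (simp add: lt mult_pos_neg)
    finally show ?thesis by simp
  qed
  then have "measure (law \<theta> y) {..0} \<le> 0" by (rule field_le_epsilon) simp
  then show "measure (law \<theta> y) {..0} = 0" by (simp add: measure_le_0_iff)
  have "measure (law \<theta> y) {1<..} + measure (law \<theta> y) {1} = measure (law \<theta> y) ({1<..} \<union> {1})"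
    by (intro finite_measure_Union[symmetric]) auto
  also have "{1<..} \<union> {1} = space (law \<theta> y) - {..<1::real}" by auto
  also have "measure (law \<theta> y) \<dots> = 1 - measure (law \<theta> y) {..<1}" by (intro prob_compl) auto
  finally show "measure (law \<theta> y) {1} = 1 - surv \<theta> y" using one lt1 by simp
qed

text \<open>
  \<open>close_law \<theta> y e\<close> collects what (D) yields at level \<open>y\<close> when its remainder is at most \<open>e\<close>. The law
  of the clipped supremum has an atom at 1, hence the factor \<open>1 / (1 - surv \<theta>0 y)\<close> in the chi-square
  bound.
\<close>

definition close_law :: "real \<Rightarrow> real \<Rightarrow> real \<Rightarrow> bool" where
  "close_law \<theta> y e \<longleftrightarrow> surv \<theta>0 y < 1 \<and>
     \<bar>surv \<theta> y - (1 + L * (\<theta> - \<theta>0)) * surv \<theta>0 y\<bar> \<le> e * surv \<theta>0 y \<and>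
     (\<exists>R C. R \<in> borel_measurable borel \<and> (\<forall>u. 0 \<le> R u \<and> R u \<le> C) \<and>
        law \<theta> y = density (law \<theta>0 y) (\<lambda>u. ennreal (R u)) \<and>
        (LINT u|law \<theta>0 y. (R u - 1)\<^sup>2) \<le>
          (\<bar>L * (\<theta> - \<theta>0)\<bar> + e)\<^sup>2 * surv \<theta>0 y / (1 - surv \<theta>0 y))"

lemma close_law_mono:
  assumes "close_law \<theta> y e" "0 \<le> e" "e \<le> e'"
  shows "close_law \<theta> y e'"
proof -
  have s: "0 \<le> surv \<theta>0 y" by (rule surv_bounds[OF theta0])
  have "e * surv \<theta>0 y \<le> e' * surv \<theta>0 y" using s assms by (intro mult_right_mono)
  moreover have "(\<bar>L * (\<theta> - \<theta>0)\<bar> + e)\<^sup>2 * surv \<theta>0 y / (1 - surv \<theta>0 y) \<le>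
      (\<bar>L * (\<theta> - \<theta>0)\<bar> + e')\<^sup>2 * surv \<theta>0 y / (1 - surv \<theta>0 y)"
    using s assms by (intro divide_right_mono mult_right_mono power_mono) (auto simp: close_law_def)
  ultimately show ?thesis
    using assms(1) unfolding close_law_def by (blast intro: order_trans)
qed

text \<open>The order of the quantifiers matters: \<open>c1\<close>, \<open>\<kappa>\<close> and
  \<open>B\<close> do not depend on \<open>\<epsilon>\<close>, and the bound is uniform in
  \<open>y\<close> and \<open>\<theta>\<close>, so both may move with \<open>n\<close>. The
  threshold \<open>c1\<close> is the larger of the \<open>c0\<close> of (D) and half of a point
  \<open>b\<close> beyond which \<open>surv \<theta>0\<close> is below 1, as the atom at 1 must be
  positive; \<open>\<bar>B\<bar>\<close> makes the constant nonnegative.\<close>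

lemma close_laws:
  "\<exists>c1<0. \<exists>\<kappa>>0. \<exists>B\<ge>0. \<forall>\<epsilon>>0. \<exists>\<kappa>'>0. \<forall>y\<in>{c1..<0}. \<forall>\<theta>\<in>{0<..<1}.
     \<bar>\<theta> - \<theta>0\<bar> < min \<kappa> \<kappa>' \<longrightarrow> close_law \<theta> y (\<epsilon> * \<bar>\<theta> - \<theta>0\<bar> + B * \<bar>y\<bar> powr \<gamma>)"
proof -
  obtain c0 \<kappa> and fd r1 r2 :: "real \<Rightarrow> real \<Rightarrow> real \<Rightarrow> real" where c0: "c0 < 0" and \<kappa>: "\<kappa> > 0" and
    D: "\<forall>s\<in>{0<..<1}. \<forall>c\<in>{c0..<0}. \<forall>\<theta>\<in>{0<..<1}. \<bar>\<theta> - \<theta>0\<bar> < \<kappa> \<longrightarrow>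
           ((\<lambda>u. prob_gt (M \<theta>) X (\<lambda>t. u * c)) has_real_derivative fd \<theta> c s) (at s) \<and>
           fd \<theta>0 c s \<noteq> 0 \<and>
           fd \<theta> c s / fd \<theta>0 c s = 1 + L * (\<theta> - \<theta>0) + (r1 s \<theta> c + r2 s \<theta> c)" and
    r1: "\<forall>\<epsilon>>0. \<exists>\<kappa>'>0. \<forall>s\<in>{0<..<1}. \<forall>c\<in>{c0..<0}. \<forall>\<theta>\<in>{0<..<1}.
           \<bar>\<theta> - \<theta>0\<bar> < min \<kappa> \<kappa>' \<longrightarrow> \<bar>r1 s \<theta> c\<bar> \<le> \<epsilon> * \<bar>\<theta> - \<theta>0\<bar>" and
    r2: "\<exists>B. \<forall>s\<in>{0<..<1}. \<forall>c\<in>{c0..<0}. \<forall>\<theta>\<in>{0<..<1}.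
           \<bar>\<theta> - \<theta>0\<bar> < \<kappa> \<longrightarrow> \<bar>r2 s \<theta> c\<bar> \<le> B * \<bar>c\<bar> powr \<gamma>"
    using X_D unfolding condition_D_def by blast
  obtain B where B: "\<forall>s\<in>{0<..<1}. \<forall>c\<in>{c0..<0}. \<forall>\<theta>\<in>{0<..<1}.
           \<bar>\<theta> - \<theta>0\<bar> < \<kappa> \<longrightarrow> \<bar>r2 s \<theta> c\<bar> \<le> B * \<bar>c\<bar> powr \<gamma>"
    using r2 by blast
  have "\<forall>\<^sub>F z in at_left 0. surv \<theta>0 z < 1"
    by (rule order_tendstoD(2)[OF surv_lim_zero[OF theta0]]) simp
  then obtain b where b: "b < 0" "\<And>z. b < z \<Longrightarrow> z < 0 \<Longrightarrow> surv \<theta>0 z < 1"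
    unfolding eventually_at_left_field by auto
  have der: "((\<lambda>u. measure (law \<theta> y) {..<u}) has_real_derivative fd \<theta> y s) (at s)"
    if "s \<in> {0<..<1}" "y \<in> {c0..<0}" "\<theta> \<in> {0<..<1}" "\<bar>\<theta> - \<theta>0\<bar> < \<kappa>" for s y \<theta>
  proof (rule has_field_derivative_transform_within_open)
    show "((\<lambda>u. prob_gt (M \<theta>) X (\<lambda>t. u * y)) has_real_derivative fd \<theta> y s) (at s)"
      using D that by blast
    show "prob_gt (M \<theta>) X (\<lambda>t. u * y) = measure (law \<theta> y) {..<u}" if "u \<in> {0<..<1}" for u
      using law_facts(5)[of \<theta> y u] that \<open>y \<in> _\<close> \<open>\<theta> \<in> _\<close> by (simp add: surv_def)
  qed (use that in auto)
  have main: "\<exists>\<kappa>'>0. \<forall>y\<in>{max c0 (b / 2)..<0}. \<forall>\<theta>\<in>{0<..<1}. \<bar>\<theta> - \<theta>0\<bar> < min \<kappa> \<kappa>' \<longrightarrow>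
      close_law \<theta> y (\<epsilon> * \<bar>\<theta> - \<theta>0\<bar> + \<bar>B\<bar> * \<bar>y\<bar> powr \<gamma>)" if \<epsilon>: "0 < \<epsilon>" for \<epsilon>
  proof -
    obtain \<kappa>' where \<kappa>': "\<kappa>' > 0" "\<forall>s\<in>{0<..<1}. \<forall>c\<in>{c0..<0}. \<forall>\<theta>\<in>{0<..<1}.
           \<bar>\<theta> - \<theta>0\<bar> < min \<kappa> \<kappa>' \<longrightarrow> \<bar>r1 s \<theta> c\<bar> \<le> \<epsilon> * \<bar>\<theta> - \<theta>0\<bar>"
      using r1[rule_format, OF \<epsilon>] by blast
    show ?thesis
    proof (intro exI[of _ \<kappa>'] conjI \<kappa>'(1) ballI impI)
      fix y \<theta> assume y: "y \<in> {max c0 (b / 2)..<0}" and \<theta>: "\<theta> \<in> {0<..<1}"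
        and close: "\<bar>\<theta> - \<theta>0\<bar> < min \<kappa> \<kappa>'"
      have yc: "y \<in> {c0..<0}" "y < 0" "b < y" using y b(1) by auto
      have \<theta>\<kappa>: "\<bar>\<theta> - \<theta>0\<bar> < \<kappa>" "\<bar>\<theta>0 - \<theta>0\<bar> < \<kappa>" using close \<kappa> by auto
      define e where "e = \<epsilon> * \<bar>\<theta> - \<theta>0\<bar> + \<bar>B\<bar> * \<bar>y\<bar> powr \<gamma>"
      have s1: "surv \<theta>0 y < 1" using b(2) yc by simp
      note lf = law_facts[OF \<theta> yc(2)] and lf0 = law_facts[OF theta0 yc(2)]
      have one: "measure (law \<theta>0 y) {1} > 0" using lf0(6) s1 by simp
      have g0: "fd \<theta>0 y u \<noteq> 0" if "u \<in> {0<..<1}" for u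
        using D that yc(1) theta0 \<theta>\<kappa>(2) by blast
      obtain R where R: "R \<in> borel_measurable borel" "\<And>u. 0 \<le> R u"
        "law \<theta> y = density (law \<theta>0 y) (\<lambda>u. ennreal (R u))"
        "\<And>u. u \<in> {0<..<1} \<Longrightarrow> R u = fd \<theta> y u / fd \<theta>0 y u"
        "\<And>u. u \<notin> {0<..<1} \<Longrightarrow> R u = measure (law \<theta> y) {1} / measure (law \<theta>0 y) {1}"
        using likelihood_ratio[OF lf(1) lf0(1) der[OF _ yc(1) \<theta> \<theta>\<kappa>(1)] der[OF _ yc(1) theta0 \<theta>\<kappa>(2)] g0
          lf(3,2) lf0(3,2) one] by blast
      have Rb: "\<bar>R u - 1 - L * (\<theta> - \<theta>0)\<bar> \<le> e" if u: "u \<in> {0<..<1}" for u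
      proof -
        have "R u - 1 - L * (\<theta> - \<theta>0) = r1 u \<theta> y + r2 u \<theta> y"
          using D[rule_format, OF u yc(1) \<theta> \<theta>\<kappa>(1)] R(4)[OF u] by simp
        moreover have "\<bar>r1 u \<theta> y\<bar> \<le> \<epsilon> * \<bar>\<theta> - \<theta>0\<bar>"
          using \<kappa>'(2) u yc(1) \<theta> close by blast
        moreover have "\<bar>r2 u \<theta> y\<bar> \<le> B * \<bar>y\<bar> powr \<gamma>"
          using B u yc(1) \<theta> \<theta>\<kappa>(1) by blast
        moreover have "B * \<bar>y\<bar> powr \<gamma> \<le> \<bar>B\<bar> * \<bar>y\<bar> powr \<gamma>" by (intro mult_right_mono) auto
        ultimately show ?thesis unfolding e_def by linarith
      qed
      note bounds = likelihood_ratio_bounds[OF lf(1) lf0(1) lf(3,2) lf0(3,2) one R(1,2,3,5) Rb]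
      obtain C where C: "\<And>u. R u \<le> C" using bounds(1) by blast
      show "close_law \<theta> y (\<epsilon> * \<bar>\<theta> - \<theta>0\<bar> + \<bar>B\<bar> * \<bar>y\<bar> powr \<gamma>)"
        unfolding e_def[symmetric] close_law_def
      proof (intro conjI s1 exI[of _ R] exI[of _ C] allI R(1,2,3) C)
        show "\<bar>surv \<theta> y - (1 + L * (\<theta> - \<theta>0)) * surv \<theta>0 y\<bar> \<le> e * surv \<theta>0 y"
          using bounds(2) by (simp add: lf(4) lf0(4))
        show "(LINT u|law \<theta>0 y. (R u - 1)\<^sup>2) \<le>
          (\<bar>L * (\<theta> - \<theta>0)\<bar> + e)\<^sup>2 * surv \<theta>0 y / (1 - surv \<theta>0 y)"
          using bounds(3) by (simp add: lf0(4))
      qed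
    qed
  qed
  have neg: "max c0 (b / 2) < 0" using c0 b by simp
  show ?thesis
    by (rule exI[of _ "max c0 (b / 2)"], rule conjI[OF neg], rule exI[of _ \<kappa>], rule conjI[OF \<kappa>],
        rule exI[of _ "\<bar>B\<bar>"], rule conjI[OF abs_ge_zero], intro allI impI, erule main)
qed

text \<open>The parameter is held fixed at distance \<open>h\<close> while \<open>y\<close> tends to
  0, as (C) is only available at each parameter separately. The term with \<open>\<gamma>\<close>
  disappears and \<open>h * \<bar>1 - L * \<theta>0\<bar> \<le> \<epsilon> * h * \<theta>0\<close>
  remains. Here \<open>h\<close> depends on \<open>\<epsilon>\<close> but cancels.\<close>

lemma L_eq: "L = 1 / \<theta>0"
proof -
  have "\<bar>1 - L * \<theta>0\<bar> \<le> \<epsilon>" if \<epsilon>: "\<epsilon> > 0" for \<epsilon>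
  proof -
    obtain c1 \<kappa> B where c1: "c1 < 0" "\<kappa> > 0" "B \<ge> 0"
      and c1': "\<forall>\<epsilon>>0. \<exists>\<kappa>'>0. \<forall>y\<in>{c1..<0}. \<forall>\<theta>\<in>{0<..<1}.
       \<bar>\<theta> - \<theta>0\<bar> < min \<kappa> \<kappa>' \<longrightarrow> close_law \<theta> y (\<epsilon> * \<bar>\<theta> - \<theta>0\<bar> + B * \<bar>y\<bar> powr \<gamma>)"
      using close_laws by blast
    obtain \<kappa>' where \<kappa>': "\<kappa>' > 0" "\<And>y \<theta>. y \<in> {c1..<0} \<Longrightarrow> \<theta> \<in> {0<..<1} \<Longrightarrow>
       \<bar>\<theta> - \<theta>0\<bar> < min \<kappa> \<kappa>' \<Longrightarrow> close_law \<theta> y (\<epsilon> * \<bar>\<theta> - \<theta>0\<bar> + B * \<bar>y\<bar> powr \<gamma>)"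
      using c1'[rule_format, OF \<epsilon>] by blast
    define h where "h = min (min \<kappa> \<kappa>') (1 - \<theta>0) / 2"
    have h: "0 < h" "h < min \<kappa> \<kappa>'" "\<theta>0 + h \<in> {0<..<1}"
    proof -
      define m where "m = min (min \<kappa> \<kappa>') (1 - \<theta>0)"
      have "0 < m" "m \<le> min \<kappa> \<kappa>'" "m \<le> 1 - \<theta>0"
        using c1 \<kappa>' theta0 by (auto simp: m_def)
      moreover have "h = m / 2" by (simp add: h_def m_def)
      ultimately show "0 < h" "h < min \<kappa> \<kappa>'" "\<theta>0 + h \<in> {0<..<1}"
        using theta0 by auto
    qed
    define \<theta> where "\<theta> = \<theta>0 + h"
    have \<theta>: "\<theta> \<in> {0<..<1}" "\<theta> - \<theta>0 = h" using h by (simp_all add: \<theta>_def)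
    have ev: "\<forall>\<^sub>F y in at_left 0. \<bar>surv \<theta> y / \<bar>y\<bar> - (1 + L * h) * (surv \<theta>0 y / \<bar>y\<bar>)\<bar> \<le>
        (\<epsilon> * h + B * \<bar>y\<bar> powr \<gamma>) * (surv \<theta>0 y / \<bar>y\<bar>)"
      unfolding eventually_at_left_field
    proof (intro exI[of _ c1] conjI c1(1) allI impI)
      fix y assume y: "c1 < y" "y < 0"
      have "close_law \<theta> y (\<epsilon> * \<bar>\<theta> - \<theta>0\<bar> + B * \<bar>y\<bar> powr \<gamma>)"
        using y \<theta> h by (intro \<kappa>'(2)) auto
      then have "\<bar>surv \<theta> y - (1 + L * h) * surv \<theta>0 y\<bar> \<le> (\<epsilon> * h + B * \<bar>y\<bar> powr \<gamma>) * surv \<theta>0 y"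
        using \<theta> h(1) by (simp add: close_law_def)
      then have "\<bar>surv \<theta> y - (1 + L * h) * surv \<theta>0 y\<bar> / \<bar>y\<bar> \<le> (\<epsilon> * h + B * \<bar>y\<bar> powr \<gamma>) * surv \<theta>0 y / \<bar>y\<bar>"
        by (rule divide_right_mono) simp
      moreover have "\<bar>surv \<theta> y - (1 + L * h) * surv \<theta>0 y\<bar> / \<bar>y\<bar> =
          \<bar>surv \<theta> y / \<bar>y\<bar> - (1 + L * h) * (surv \<theta>0 y / \<bar>y\<bar>)\<bar>"
        by (simp add: diff_divide_distrib[symmetric] abs_divide)
      ultimately show "\<bar>surv \<theta> y / \<bar>y\<bar> - (1 + L * h) * (surv \<theta>0 y / \<bar>y\<bar>)\<bar> \<le>
        (\<epsilon> * h + B * \<bar>y\<bar> powr \<gamma>) * (surv \<theta>0 y / \<bar>y\<bar>)" by simp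
    qed
    have pz: "((\<lambda>y::real. \<bar>y\<bar> powr \<gamma>) \<longlongrightarrow> 0) (at_left 0)"
      using gamma by (intro tendsto_zero_powrI[of _ _ _ \<gamma>] tendsto_rabs_zero tendsto_ident_at tendsto_const) auto
    have "\<bar>\<theta> - (1 + L * h) * \<theta>0\<bar> \<le> (\<epsilon> * h + B * 0) * \<theta>0"
    proof (rule tendsto_le[OF _ _ _ ev])
      show "((\<lambda>y. \<bar>surv \<theta> y / \<bar>y\<bar> - (1 + L * h) * (surv \<theta>0 y / \<bar>y\<bar>)\<bar>) \<longlongrightarrow>
        \<bar>\<theta> - (1 + L * h) * \<theta>0\<bar>) (at_left 0)"
        by (intro tendsto_intros surv_ratio_lim \<theta> theta0)
      show "((\<lambda>y. (\<epsilon> * h + B * \<bar>y\<bar> powr \<gamma>) * (surv \<theta>0 y / \<bar>y\<bar>)) \<longlongrightarrow> (\<epsilon> * h + B * 0) * \<theta>0) (at_left 0)"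
        by (intro tendsto_mult tendsto_add tendsto_const surv_ratio_lim theta0 pz)
    qed simp
    moreover have "\<theta> - (1 + L * h) * \<theta>0 = h * (1 - L * \<theta>0)" by (simp add: \<theta>_def algebra_simps)
    ultimately have "h * \<bar>1 - L * \<theta>0\<bar> \<le> h * (\<epsilon> * \<theta>0)"
      using h(1) by (simp add: abs_mult)
    then have "\<bar>1 - L * \<theta>0\<bar> \<le> \<epsilon> * \<theta>0" using h(1) by simp
    also have "\<dots> \<le> \<epsilon>" using \<epsilon> theta0 by simp
    finally show ?thesis .
  qed
  then have "\<bar>1 - L * \<theta>0\<bar> \<le> 0" by (rule field_le_epsilon) simp
  then show ?thesis using theta0 by (simp add: field_simps)
qed

end

section \<open>Asymptotics along the local parameters\<close>

locale exceedance_sampling = exceedance_model \<psi> \<delta> \<gamma> \<theta>0 L M X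
  for \<psi> :: "real \<Rightarrow> real" and \<delta> \<gamma> \<theta>0 L :: real
    and M :: "real \<Rightarrow> 'a measure" and X :: "real \<Rightarrow> 'a \<Rightarrow> real" +
  fixes P :: "real \<Rightarrow> 'w measure" and Xs :: "nat \<Rightarrow> real \<Rightarrow> 'w \<Rightarrow> real" and c :: "nat \<Rightarrow> real"
  assumes copies: "\<And>\<theta>. \<theta> \<in> {0<..<1} \<Longrightarrow> independent_copies (P \<theta>) Xs (M \<theta>) X"
    and c_neg: "\<And>n. c n < 0" and c_lim: "c \<longlonglongrightarrow> 0"
    and nc_infinity: "filterlim (\<lambda>n. real n * \<bar>c n\<bar>) at_top sequentially"
    and nc_powr: "(\<lambda>n. real n * \<bar>c n\<bar> powr (1 + 2 * min \<delta> \<gamma>)) \<longlonglongrightarrow> 0"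
begin

definition a :: "nat \<Rightarrow> real" where "a n = (real n * \<bar>c n\<bar>) powr (1 / 2)"

abbreviation lp :: "real \<Rightarrow> nat \<Rightarrow> real" where "lp \<equiv> local_parameter \<theta>0 c"

lemma a_sqrt: "a n = sqrt (real n * \<bar>c n\<bar>)"
  by (simp add: a_def powr_half_sqrt)

lemma a_sq: "(a n)\<^sup>2 = real n * \<bar>c n\<bar>"
  by (simp add: a_sqrt)

lemma a_pos: "n > 0 \<Longrightarrow> a n > 0"
  using c_neg[of n] by (simp add: a_sqrt mult_pos_neg)

lemma a_top: "filterlim a at_top sequentially"
  unfolding a_sqrt[abs_def] by (rule filterlim_compose[OF sqrt_at_top nc_infinity])

lemma a_inv: "(\<lambda>n. 1 / a n) \<longlonglongrightarrow> 0"
  by (rule tendsto_divide_0[OF tendsto_const filterlim_at_top_imp_at_infinity[OF a_top]])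

lemma lp_eq: "lp \<xi> n = \<theta>0 + \<xi> / a n"
proof -
  have "(-1 / 2 :: real) = - (1 / 2)" by simp
  then show ?thesis
    unfolding local_parameter_def a_def by (simp only: powr_minus divide_inverse)
qed

lemma lp_lim: "lp \<xi> \<longlonglongrightarrow> \<theta>0"
  using tendsto_add[OF tendsto_const tendsto_mult[OF tendsto_const a_inv], of \<theta>0 \<xi>]
  by (simp add: lp_eq[abs_def])

lemma lp_ev: "\<forall>\<^sub>F n in sequentially. lp \<xi> n \<in> {0<..<1}"
proof -
  have "\<forall>\<^sub>F n in sequentially. 0 < lp \<xi> n" "\<forall>\<^sub>F n in sequentially. lp \<xi> n < 1"
    using theta0 by (auto intro: order_tendstoD[OF lp_lim])
  then show ?thesis by eventually_elim simp
qed

lemma c_left: "filterlim c (at_left 0) sequentially"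
  unfolding filterlim_at using c_lim c_neg by (auto intro!: always_eventually simp: less_imp_neq)

lemma c_abs: "(\<lambda>n. \<bar>c n\<bar>) \<longlonglongrightarrow> 0"
  using tendsto_rabs_zero[OF c_lim] .

text \<open>For the smallest exponent the square of the sequence is the one in
  \<open>nc_powr\<close>; larger exponents only help once \<open>\<bar>c n\<bar> < 1\<close>. The
  case \<open>\<delta>\<close> removes the bias left by (C), the case \<open>\<gamma>\<close> the
  second remainder of (D).\<close>

lemma a_powr_lim:
  assumes m: "min \<delta> \<gamma> \<le> m"
  shows "(\<lambda>n. a n * \<bar>c n\<bar> powr m) \<longlonglongrightarrow> 0"
proof (rule Lim_null_comparison)
  define m0 where "m0 = min \<delta> \<gamma>"
  have eq: "sqrt (real n * \<bar>c n\<bar> powr (1 + 2 * m0)) = a n * \<bar>c n\<bar> powr m0" for n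
  proof (rule real_sqrt_unique)
    have "\<bar>c n\<bar> powr (1 + 2 * m0) = \<bar>c n\<bar> * (\<bar>c n\<bar> powr m0)\<^sup>2"
      by (simp only: powr_add mult_2 power2_eq_square powr_one[OF abs_ge_zero])
    then show "(a n * \<bar>c n\<bar> powr m0)\<^sup>2 = real n * \<bar>c n\<bar> powr (1 + 2 * m0)"
      unfolding power_mult_distrib a_sq by (simp only: mult.assoc)
    show "0 \<le> a n * \<bar>c n\<bar> powr m0" by (simp add: a_def)
  qed
  have "(\<lambda>n. sqrt (real n * \<bar>c n\<bar> powr (1 + 2 * m0))) \<longlonglongrightarrow> sqrt 0"
    unfolding m0_def by (rule tendsto_real_sqrt[OF nc_powr])
  then show "(\<lambda>n. a n * \<bar>c n\<bar> powr m0) \<longlonglongrightarrow> 0"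
    unfolding eq real_sqrt_zero .
  have "\<forall>\<^sub>F n in sequentially. \<bar>c n\<bar> < 1" by (rule order_tendstoD(2)[OF c_abs]) simp
  then show "\<forall>\<^sub>F n in sequentially. norm (a n * \<bar>c n\<bar> powr m) \<le> a n * \<bar>c n\<bar> powr m0"
  proof eventually_elim
    fix n assume "\<bar>c n\<bar> < 1"
    have "m0 \<le> m" using m by (simp only: m0_def)
    then have "\<bar>c n\<bar> powr m \<le> \<bar>c n\<bar> powr m0"
      by (rule powr_mono'[OF _ abs_ge_zero less_imp_le[OF \<open>\<bar>c n\<bar> < 1\<close>]])
    moreover have an: "0 \<le> a n" by (simp only: a_def powr_ge_zero)
    ultimately have "a n * \<bar>c n\<bar> powr m \<le> a n * \<bar>c n\<bar> powr m0"
      by (rule mult_left_mono)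
    moreover have "0 \<le> a n * \<bar>c n\<bar> powr m" using an by (rule mult_nonneg_nonneg) (rule powr_ge_zero)
    ultimately show "norm (a n * \<bar>c n\<bar> powr m) \<le> a n * \<bar>c n\<bar> powr m0"
      by (simp only: real_norm_def abs_of_nonneg)
  qed
qed

definition \<pi>0 :: "nat \<Rightarrow> real" where "\<pi>0 n = surv \<theta>0 (c n) / \<bar>c n\<bar>"

lemma \<pi>0_lim: "\<pi>0 \<longlonglongrightarrow> \<theta>0"
  unfolding \<pi>0_def by (rule filterlim_compose[OF surv_ratio_lim[OF theta0] c_left])

lemma \<pi>0_rate: "(\<lambda>n. a n * (\<pi>0 n - \<theta>0)) \<longlonglongrightarrow> 0"
proof -
  obtain B x1 where B: "x1 > 0" "B \<ge> 0"
    "\<And>y. y \<in> {-x1<..<0} \<Longrightarrow> \<bar>surv \<theta>0 y / \<bar>y\<bar> - \<theta>0\<bar> \<le> B * \<bar>y\<bar> powr \<delta>"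
    using surv_tail[OF theta0] by blast
  have "\<forall>\<^sub>F n in sequentially. - x1 < c n" by (rule order_tendstoD(1)[OF c_lim]) (use B in simp)
  then have "\<forall>\<^sub>F n in sequentially. norm (a n * (\<pi>0 n - \<theta>0)) \<le> B * (a n * \<bar>c n\<bar> powr \<delta>)"
  proof eventually_elim
    fix n assume "- x1 < c n"
    then have "\<bar>\<pi>0 n - \<theta>0\<bar> \<le> B * \<bar>c n\<bar> powr \<delta>" unfolding \<pi>0_def using c_neg[of n] by (intro B(3)) auto
    then have "a n * \<bar>\<pi>0 n - \<theta>0\<bar> \<le> a n * (B * \<bar>c n\<bar> powr \<delta>)"
      by (rule mult_left_mono) (simp add: a_def)
    then show "norm (a n * (\<pi>0 n - \<theta>0)) \<le> B * (a n * \<bar>c n\<bar> powr \<delta>)"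
      by (simp add: abs_mult a_def mult_ac)
  qed
  moreover have "(\<lambda>n. B * (a n * \<bar>c n\<bar> powr \<delta>)) \<longlonglongrightarrow> 0"
    by (rule tendsto_mult_right_zero[OF a_powr_lim]) simp
  ultimately show ?thesis by (rule Lim_null_comparison)
qed

text \<open>The distance of the local parameter from \<open>\<theta>0\<close> is
  \<open>\<bar>\<xi>\<bar> / a n\<close>, so the uniform little-o of (D) costs half of
  \<open>\<eta> / a n\<close>, and the term in \<open>\<gamma>\<close> at most the other half by
  \<open>a_powr_lim\<close>.\<close>

lemma close_local:
  assumes \<eta>: "\<eta> > 0"
  shows "\<forall>\<^sub>F n in sequentially. close_law (lp \<xi> n) (c n) (\<eta> / a n)"
proof -
  obtain c1 \<kappa> B where c1: "c1 < 0" "\<kappa> > 0" "B \<ge> 0"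
    and c1': "\<forall>\<epsilon>>0. \<exists>\<kappa>'>0. \<forall>y\<in>{c1..<0}. \<forall>\<theta>\<in>{0<..<1}.
     \<bar>\<theta> - \<theta>0\<bar> < min \<kappa> \<kappa>' \<longrightarrow> close_law \<theta> y (\<epsilon> * \<bar>\<theta> - \<theta>0\<bar> + B * \<bar>y\<bar> powr \<gamma>)"
    using close_laws by blast
  \<comment> \<open>The \<open>+ 1\<close> allows \<open>\<xi> = 0\<close>.\<close>
  define \<epsilon> where "\<epsilon> = \<eta> / (2 * (\<bar>\<xi>\<bar> + 1))"
  have \<epsilon>: "\<epsilon> > 0" using \<eta> by (simp add: \<epsilon>_def)
  have \<epsilon>\<xi>: "\<epsilon> * \<bar>\<xi>\<bar> \<le> \<eta> / 2" using \<eta> by (simp add: \<epsilon>_def field_simps)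
  obtain \<kappa>' where \<kappa>': "\<kappa>' > 0" "\<And>y \<theta>. y \<in> {c1..<0} \<Longrightarrow> \<theta> \<in> {0<..<1} \<Longrightarrow>
     \<bar>\<theta> - \<theta>0\<bar> < min \<kappa> \<kappa>' \<Longrightarrow> close_law \<theta> y (\<epsilon> * \<bar>\<theta> - \<theta>0\<bar> + B * \<bar>y\<bar> powr \<gamma>)"
    using c1'[rule_format, OF \<epsilon>] by blast
  have "(\<lambda>n. \<bar>lp \<xi> n - \<theta>0\<bar>) \<longlonglongrightarrow> 0"
    by (rule tendsto_rabs_zero[OF LIM_zero[OF lp_lim]])
  then have 1: "\<forall>\<^sub>F n in sequentially. \<bar>lp \<xi> n - \<theta>0\<bar> < min \<kappa> \<kappa>'"
    by (rule order_tendstoD(2)) (use c1 \<kappa>' in simp)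
  have 2: "\<forall>\<^sub>F n in sequentially. c1 < c n" by (rule order_tendstoD(1)[OF c_lim c1(1)])
  have "(\<lambda>n. B * (a n * \<bar>c n\<bar> powr \<gamma>)) \<longlonglongrightarrow> 0"
    by (rule tendsto_mult_right_zero[OF a_powr_lim]) simp
  then have 3: "\<forall>\<^sub>F n in sequentially. B * (a n * \<bar>c n\<bar> powr \<gamma>) < \<eta> / 2"
    by (rule order_tendstoD(2)) (use \<eta> in simp)
  show ?thesis
    using 1 2 3 lp_ev[of \<xi>] eventually_gt_at_top[of 0]
  proof eventually_elim
    fix n assume n: "\<bar>lp \<xi> n - \<theta>0\<bar> < min \<kappa> \<kappa>'" "c1 < c n" "B * (a n * \<bar>c n\<bar> powr \<gamma>) < \<eta> / 2"
      "lp \<xi> n \<in> {0<..<1}" "0 < n"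
    have an: "a n > 0" by (rule a_pos[OF n(5)])
    have "close_law (lp \<xi> n) (c n) (\<epsilon> * \<bar>lp \<xi> n - \<theta>0\<bar> + B * \<bar>c n\<bar> powr \<gamma>)"
      using n c_neg[of n] by (intro \<kappa>'(2)) auto
    then show "close_law (lp \<xi> n) (c n) (\<eta> / a n)"
    proof (rule close_law_mono)
      show "0 \<le> \<epsilon> * \<bar>lp \<xi> n - \<theta>0\<bar> + B * \<bar>c n\<bar> powr \<gamma>" using \<epsilon> c1 by simp
      have "\<epsilon> * \<bar>lp \<xi> n - \<theta>0\<bar> + B * \<bar>c n\<bar> powr \<gamma> =
          (\<epsilon> * \<bar>\<xi>\<bar> + B * (a n * \<bar>c n\<bar> powr \<gamma>)) / a n"
        using an by (simp add: lp_eq field_simps abs_divide)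
      also have "\<dots> \<le> \<eta> / a n"
        using n(3) \<epsilon>\<xi> an by (intro divide_right_mono) auto
      finally show "\<epsilon> * \<bar>lp \<xi> n - \<theta>0\<bar> + B * \<bar>c n\<bar> powr \<gamma> \<le> \<eta> / a n" .
    qed
  qed
qed

text \<open>The error splits into the bias at \<open>\<theta>0\<close>, which vanishes by
  \<open>\<pi>0_rate\<close>, the term \<open>\<xi> * (L * \<pi>0 n - 1)\<close>, which vanishes
  because \<open>L * \<theta>0 = 1\<close>, and the remainder of (D), at most \<open>e / 2\<close>
  by \<open>close_local\<close>. This avoids any rate in (C) at the moving parameter.\<close>

lemma surv_local_rate: "(\<lambda>n. a n * (surv (lp \<xi> n) (c n) / \<bar>c n\<bar> - lp \<xi> n)) \<longlonglongrightarrow> 0"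
proof (rule LIMSEQ_I)
  fix e :: real assume e: "0 < e"
  have "(\<lambda>n. \<xi> * (L * \<pi>0 n - 1)) \<longlonglongrightarrow> \<xi> * (L * \<theta>0 - 1)"
    by (intro tendsto_intros \<pi>0_lim)
  from tendsto_add[OF \<pi>0_rate this]
  have l1: "(\<lambda>n. a n * (\<pi>0 n - \<theta>0) + \<xi> * (L * \<pi>0 n - 1)) \<longlonglongrightarrow> 0"
    using L_eq theta0 by simp
  have 1: "\<forall>\<^sub>F n in sequentially. \<bar>a n * (\<pi>0 n - \<theta>0) + \<xi> * (L * \<pi>0 n - 1)\<bar> < e / 2"
    by (rule order_tendstoD(2)[OF tendsto_rabs_zero[OF l1]]) (use e in simp)
  have 2: "\<forall>\<^sub>F n in sequentially. \<pi>0 n < 1"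
    by (rule order_tendstoD(2)[OF \<pi>0_lim]) (use theta0 in simp)
  have "\<forall>\<^sub>F n in sequentially. norm (a n * (surv (lp \<xi> n) (c n) / \<bar>c n\<bar> - lp \<xi> n) - 0) < e"
    using 1 2 close_local[of "e / 2" \<xi>, OF half_gt_zero[OF e]] eventually_gt_at_top[of 0]
  proof eventually_elim
    fix n assume n: "\<bar>a n * (\<pi>0 n - \<theta>0) + \<xi> * (L * \<pi>0 n - 1)\<bar> < e / 2" "\<pi>0 n < 1"
      "close_law (lp \<xi> n) (c n) (e / 2 / a n)" "0 < n"
    have an: "a n > 0" by (rule a_pos[OF n(4)])
    define S where "S = surv (lp \<xi> n) (c n) / \<bar>c n\<bar>"
    have "\<bar>surv (lp \<xi> n) (c n) - (1 + L * (\<xi> / a n)) * surv \<theta>0 (c n)\<bar> \<le> (e / 2 / a n) * surv \<theta>0 (c n)"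
      using n(3) by (simp add: close_law_def lp_eq)
    then have "\<bar>surv (lp \<xi> n) (c n) - (1 + L * (\<xi> / a n)) * surv \<theta>0 (c n)\<bar> / \<bar>c n\<bar>
        \<le> (e / 2 / a n) * surv \<theta>0 (c n) / \<bar>c n\<bar>"
      by (rule divide_right_mono) simp
    moreover have "\<bar>surv (lp \<xi> n) (c n) - (1 + L * (\<xi> / a n)) * surv \<theta>0 (c n)\<bar> / \<bar>c n\<bar> =
        \<bar>S - (1 + L * (\<xi> / a n)) * \<pi>0 n\<bar>"
      unfolding S_def \<pi>0_def by (simp add: diff_divide_distrib[symmetric] abs_divide)
    ultimately have "\<bar>S - (1 + L * (\<xi> / a n)) * \<pi>0 n\<bar> \<le> (e / 2 / a n) * \<pi>0 n"
      by (simp add: \<pi>0_def)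
    then have "a n * \<bar>S - (1 + L * (\<xi> / a n)) * \<pi>0 n\<bar> \<le> a n * ((e / 2 / a n) * \<pi>0 n)"
      using an by (intro mult_left_mono) auto
    also have "\<dots> = e / 2 * \<pi>0 n" using an by simp
    also have "\<dots> \<le> e / 2" using n(2) e by simp
    finally have r: "\<bar>a n * (S - (1 + L * (\<xi> / a n)) * \<pi>0 n)\<bar> \<le> e / 2"
      using an by (simp add: abs_mult)
    have "a n * (S - lp \<xi> n) =
        (a n * (\<pi>0 n - \<theta>0) + \<xi> * (L * \<pi>0 n - 1)) + a n * (S - (1 + L * (\<xi> / a n)) * \<pi>0 n)"
      using an by (simp add: lp_eq field_simps)
    moreover have "\<bar>u\<bar> < e / 2 \<Longrightarrow> \<bar>v\<bar> \<le> e / 2 \<Longrightarrow> \<bar>u + v\<bar> < e" for u v by linarith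
    ultimately have "\<bar>a n * (S - lp \<xi> n)\<bar> < e" using r n(1) by simp
    then show "norm (a n * (surv (lp \<xi> n) (c n) / \<bar>c n\<bar> - lp \<xi> n) - 0) < e" by (simp add: S_def)
  qed
  then show "\<exists>no. \<forall>n\<ge>no. norm (a n * (surv (lp \<xi> n) (c n) / \<bar>c n\<bar> - lp \<xi> n) - 0) < e"
    by (simp add: eventually_sequentially)
qed

lemma surv_local_lim: "(\<lambda>n. surv (lp \<xi> n) (c n) / \<bar>c n\<bar>) \<longlonglongrightarrow> \<theta>0"
proof -
  have "(\<lambda>n. (1 / a n) * (a n * (surv (lp \<xi> n) (c n) / \<bar>c n\<bar> - lp \<xi> n)) + lp \<xi> n) \<longlonglongrightarrow> 0 * 0 + \<theta>0"
    by (intro tendsto_add tendsto_mult a_inv surv_local_rate lp_lim)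
  moreover have "\<forall>\<^sub>F n in sequentially. (1 / a n) * (a n * (surv (lp \<xi> n) (c n) / \<bar>c n\<bar> - lp \<xi> n)) + lp \<xi> n =
      surv (lp \<xi> n) (c n) / \<bar>c n\<bar>"
    using eventually_gt_at_top[of 0]
  proof eventually_elim
    fix n :: nat assume "0 < n"
    with a_pos[OF this] show "(1 / a n) * (a n * (surv (lp \<xi> n) (c n) / \<bar>c n\<bar> - lp \<xi> n)) + lp \<xi> n =
      surv (lp \<xi> n) (c n) / \<bar>c n\<bar>" by simp
  qed
  ultimately have "(\<lambda>n. surv (lp \<xi> n) (c n) / \<bar>c n\<bar>) \<longlonglongrightarrow> 0 * 0 + \<theta>0"
    by (rule Lim_transform_eventually)
  then show ?thesis by simp
qed

section \<open>The normal limit of the relative number of exceedances\<close>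

definition limit_law :: "real measure" where
  "limit_law = distr std_normal_distribution borel (\<lambda>x. sqrt \<theta>0 * x)"

lemma limit_law: "real_distribution limit_law" "has_variance limit_law \<theta>0"
  "char limit_law t = of_real (exp (- (t\<^sup>2 * \<theta>0 / 2)))"
proof -
  interpret n: real_distribution std_normal_distribution by (rule real_dist_normal_dist)
  show rd: "real_distribution limit_law"
    unfolding limit_law_def by (rule n.real_distribution_distr) simp
  have th: "0 \<le> \<theta>0" using theta0 by simp
  have sq: "integrable std_normal_distribution (\<lambda>x. (sqrt \<theta>0 * x)\<^sup>2)"
    "(LINT x|std_normal_distribution. (sqrt \<theta>0 * x)\<^sup>2) = \<theta>0"
    using integrable_std_normal_distribution_moment[of 2] std_normal_distribution_even_moments[of 1] th
    by (simp_all add: power_mult_distrib)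
  have mean: "(LINT x|limit_law. x) = 0"
    using integral_std_normal_distribution_moment_odd[of 1]
    unfolding limit_law_def by (subst integral_distr) simp_all
  show "has_variance limit_law \<theta>0"
    unfolding has_variance_def mean
    unfolding limit_law_def using sq by (simp add: integrable_distr_eq integral_distr)
  show "char limit_law t = of_real (exp (- (t\<^sup>2 * \<theta>0 / 2)))"
  proof -
    have "char limit_law t = char std_normal_distribution (t * sqrt \<theta>0)"
      unfolding char_def limit_law_def by (subst integral_distr) (simp_all add: mult_ac)
    then show ?thesis using th by (simp add: char_std_normal_distribution power_mult_distrib)
  qed
qed

text \<open>With \<open>p\<close> the exceedance probability, the variance of the scaled count is
  asymptotically \<open>p n / \<bar>c n\<bar>\<close>, which tends to \<open>\<theta>0\<close>, and
  its centring error is the sequence of \<open>surv_local_rate\<close>. Neither limit depends on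
  \<open>\<xi>\<close>, which is regularity.\<close>

lemma est_weak_conv:
  "weak_conv_m (\<lambda>n. distr (P (lp \<xi> n)) borel (\<lambda>\<omega>. (real n * \<bar>c n\<bar>) powr (1 / 2) *
     (real (exceedance_count Xs n (c n) \<omega>) / (real n * \<bar>c n\<bar>) - lp \<xi> n))) limit_law"
proof (rule levy_continuity_eventually)
  define \<mu> where "\<mu> n = distr (P (lp \<xi> n)) borel (\<lambda>\<omega>. (real n * \<bar>c n\<bar>) powr (1 / 2) *
     (real (exceedance_count Xs n (c n) \<omega>) / (real n * \<bar>c n\<bar>) - lp \<xi> n))" for n
  have meas: "(\<lambda>\<omega>. real (exceedance_count Xs n (c n) \<omega>)) \<in> borel_measurable (P (lp \<xi> n))"
    if "lp \<xi> n \<in> {0<..<1}" for n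
    by (rule exceedance_count_measurable[OF copies[OF that] c_neg])
  show "\<forall>\<^sub>F n in sequentially. real_distribution (\<mu> n)"
    using lp_ev[of \<xi>] eventually_gt_at_top[of 0]
  proof eventually_elim
    fix n assume n: "lp \<xi> n \<in> {0<..<1}" "0 < n"
    interpret prob_space "P (lp \<xi> n)" by (rule copies_distr(1)[OF copies[OF n(1)] X_process[OF n(1)] n(2)])
    note [measurable] = meas[OF n(1)]
    show "real_distribution (\<mu> n)" unfolding \<mu>_def by (rule real_distribution_distr) measurable
  qed
  show "real_distribution limit_law" by (rule limit_law)
  fix t
  \<comment> \<open>\<open>binomial_char_limit\<close> wants probabilities for every
    \<open>n\<close>; the default 0 serves the finitely many \<open>n\<close> whose local parameter
    is outside (0,1).\<close>
  define p where "p n = (if lp \<xi> n \<in> {0<..<1} then surv (lp \<xi> n) (c n) else 0)" for n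
  define b where "b n = a n * lp \<xi> n" for n
  have pev: "\<forall>\<^sub>F n in sequentially. p n = surv (lp \<xi> n) (c n)"
    using lp_ev[of \<xi>] by eventually_elim (simp add: p_def)
  have plim: "(\<lambda>n. p n / \<bar>c n\<bar>) \<longlonglongrightarrow> \<theta>0"
    by (rule Lim_transform_eventually[OF surv_local_lim[of \<xi>]])
       (use pev in eventually_elim, simp)
  have "(\<lambda>n. iexp (- (t * b n)) * (1 + of_real (p n) * (iexp (t / a n) - 1)) ^ n)
    \<longlonglongrightarrow> of_real (exp (- (t\<^sup>2 * \<theta>0 / 2)))"
  proof (rule binomial_char_limit[OF _ _ a_top])
    show "0 \<le> p n" "p n \<le> 1" for n using surv_bounds by (simp_all add: p_def)
    have "(\<lambda>n. p n / \<bar>c n\<bar> * \<bar>c n\<bar>) \<longlonglongrightarrow> \<theta>0 * 0" by (intro tendsto_mult plim c_abs)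
    then show "p \<longlonglongrightarrow> 0" using c_neg by (simp add: less_imp_neq)
    show "(\<lambda>n. real n * p n / (a n)\<^sup>2) \<longlonglongrightarrow> \<theta>0"
      by (rule Lim_transform_eventually[OF plim])
         (use eventually_gt_at_top[of 0] in eventually_elim, simp add: a_sq)
    show "(\<lambda>n. real n * p n / a n - b n) \<longlonglongrightarrow> 0"
    proof (rule Lim_transform_eventually[OF surv_local_rate[of \<xi>]])
      show "\<forall>\<^sub>F n in sequentially. a n * (surv (lp \<xi> n) (c n) / \<bar>c n\<bar> - lp \<xi> n) = real n * p n / a n - b n"
        using pev eventually_gt_at_top[of 0]
      proof eventually_elim
        fix n assume n: "p n = surv (lp \<xi> n) (c n)" "0 < n"
        have "a n > 0" by (rule a_pos[OF n(2)])
        have "real n = (a n)\<^sup>2 / \<bar>c n\<bar>" using c_neg[of n] by (simp add: a_sq)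
        then have "real n * p n / a n = (a n)\<^sup>2 / \<bar>c n\<bar> * p n / a n" by simp
        also have "\<dots> = a n * (p n / \<bar>c n\<bar>)" using \<open>a n > 0\<close> by (simp add: power2_eq_square)
        finally show "a n * (surv (lp \<xi> n) (c n) / \<bar>c n\<bar> - lp \<xi> n) = real n * p n / a n - b n"
          by (simp add: b_def n(1) right_diff_distrib)
      qed
    qed
  qed
  then have "(\<lambda>n. iexp (- (t * b n)) * (1 + of_real (p n) * (iexp (t / a n) - 1)) ^ n) \<longlonglongrightarrow> char limit_law t"
    by (simp only: limit_law(3))
  then show "(\<lambda>n. char (\<mu> n) t) \<longlonglongrightarrow> char limit_law t"
  proof (rule Lim_transform_eventually)
    show "\<forall>\<^sub>F n in sequentially. iexp (- (t * b n)) * (1 + of_real (p n) * (iexp (t / a n) - 1)) ^ n = char (\<mu> n) t"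
      using lp_ev[of \<xi>] eventually_gt_at_top[of 0]
    proof eventually_elim
      fix n assume n: "lp \<xi> n \<in> {0<..<1}" "0 < n"
      note [measurable] = meas[OF n(1)]
      have an: "a n > 0" by (rule a_pos[OF n(2)])
      have e: "iexp (t * (a n * (x / (a n)\<^sup>2 - lp \<xi> n))) = iexp (- (t * b n)) * iexp (t / a n * x)" for x
      proof -
        have "t * (a n * (x / (a n)\<^sup>2 - lp \<xi> n)) = - (t * b n) + t / a n * x"
          using an by (simp add: b_def field_simps power2_eq_square)
        then show ?thesis by (simp only: of_real_add distrib_left exp_add)
      qed
      have "char (\<mu> n) t = (CLINT \<omega>|P (lp \<xi> n). iexp (t * (a n * (real (exceedance_count Xs n (c n) \<omega>) / (a n)\<^sup>2 - lp \<xi> n))))"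
        unfolding char_def \<mu>_def by (subst integral_distr) (simp_all add: a_def[symmetric] a_sq)
      also have "\<dots> = iexp (- (t * b n)) * (CLINT \<omega>|P (lp \<xi> n). iexp (t / a n * real (exceedance_count Xs n (c n) \<omega>)))"
        unfolding e by (rule integral_mult_right_zero)
      also have "(CLINT \<omega>|P (lp \<xi> n). iexp (t / a n * real (exceedance_count Xs n (c n) \<omega>))) =
          (1 + of_real (p n) * (iexp (t / a n) - 1)) ^ n"
        using exceedance_count_char[OF copies[OF n(1)] X_process[OF n(1)] n(2) c_neg, where s="t / a n"] n(1)
        by (simp only: p_def surv_def if_True)
      finally show "iexp (- (t * b n)) * (1 + of_real (p n) * (iexp (t / a n) - 1)) ^ n = char (\<mu> n) t" ..
    qed
  qed
qed

end

section \<open>Regularity and the lower bound for the limit variance\<close>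

context exceedance_sampling
begin

lemma est_regular:
  "regular_estimator P Xs \<theta>0 c
     (\<lambda>n \<omega>. real (exceedance_count Xs n (c n) \<omega>) / (real n * \<bar>c n\<bar>)) limit_law"
  unfolding regular_estimator_def
proof (intro conjI allI limit_law(1) est_weak_conv)
  fix n
  define T where "T N = N {0..<1::real} / (real n * \<bar>c n\<bar>)" for N :: "real set \<Rightarrow> real"
  have "(\<lambda>N. N {0..<1}) \<in> borel_measurable point_measure_space"
    unfolding point_measure_space_def by (rule measurable_component_singleton) simp
  then have "T \<in> borel_measurable point_measure_space"
    unfolding T_def by (rule borel_measurable_divide) simp
  moreover have "real (exceedance_count Xs n (c n) \<omega>) / (real n * \<bar>c n\<bar>) = T (exceedance_process Xs n (c n) \<omega>)"
    if "\<theta> \<in> {0<..<1}" "\<omega> \<in> space (P \<theta>)" for \<theta> \<omega>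
    unfolding T_def exceedance_count_copies(2)[OF copies[OF that(1)] c_neg that(2)] ..
  ultimately show "\<exists>T\<in>borel_measurable point_measure_space. \<forall>\<theta>\<in>{0<..<1}. \<forall>\<omega>\<in>space (P \<theta>).
      real (exceedance_count Xs n (c n) \<omega>) / (real n * \<bar>c n\<bar>) = T (exceedance_process Xs n (c n) \<omega>)"
    by (intro bexI[of _ T]) simp_all
qed

text \<open>Chapman-Robbins compares the local parameter with \<open>\<theta>0\<close> for the
  function \<open>h\<close> of the error centred at \<open>\<theta>0\<close>. Under the local
  parameter this error is the regular one plus \<open>\<xi>\<close>, so regularity yields
  \<open>Q\<close> shifted by \<open>\<xi>\<close>, and \<open>Q\<close> itself under
  \<open>\<theta>0\<close>; since \<open>h\<close> is bounded and continuous, all three expectations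
  converge. The slack \<open>\<eta>\<close> absorbs the remainder of (D).\<close>

lemma regular_bounded_ineq:
  assumes reg: "regular_estimator P Xs \<theta>0 c est Q"
    and h: "\<And>x. isCont h x" "\<And>x::real. \<bar>h x\<bar> \<le> k" and \<eta>: "\<eta> > 0"
  shows "((LINT x|Q. h (x + \<xi>)) - (LINT x|Q. h x))\<^sup>2 \<le>
    (LINT x|Q. (h x)\<^sup>2) * (exp (\<theta>0 * (\<bar>L * \<xi>\<bar> + \<eta>)\<^sup>2) - 1)"
proof -
  have Q: "real_distribution Q" using reg by (simp add: regular_estimator_def)
  have wc: "weak_conv_m (\<lambda>n. distr (P (lp \<xi> n)) borel (\<lambda>\<omega>. a n * (est n \<omega> - lp \<xi> n))) Q" for \<xi>
    using reg by (simp add: regular_estimator_def a_def)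
  have "\<forall>n. \<exists>T. T \<in> borel_measurable point_measure_space \<and> (\<forall>\<theta>\<in>{0<..<1}. \<forall>\<omega>\<in>space (P \<theta>).
      est n \<omega> = T (exceedance_process Xs n (c n) \<omega>))"
    using reg unfolding regular_estimator_def Bex_def by (rule conjunct1)
  then obtain T where T [measurable]: "\<And>n. T n \<in> borel_measurable point_measure_space"
    and estT: "\<And>n \<theta> \<omega>. \<theta> \<in> {0<..<1} \<Longrightarrow> \<omega> \<in> space (P \<theta>) \<Longrightarrow> est n \<omega> = T n (exceedance_process Xs n (c n) \<omega>)"
    unfolding choice_iff by blast
  define W where "W n \<omega> = (\<lambda>i\<in>{..<n}. clipped_sup (c n) (path01 (Xs i) \<omega>))" for n \<omega>
  define g where "g n w = T n (count_measure_of n w)" for n w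
  have g [measurable]: "g n \<in> borel_measurable (\<Pi>\<^sub>M i\<in>{..<n}. borel)" for n
    unfolding g_def by measurable
  have estg: "est n \<omega> = g n (W n \<omega>)" if "\<theta> \<in> {0<..<1}" "\<omega> \<in> space (P \<theta>)" for n \<theta> \<omega>
    unfolding estT[OF that] g_def W_def exceedance_count_copies(1)[OF copies[OF that(1)] c_neg that(2)] ..
  have Wm: "W n \<in> P \<theta> \<rightarrow>\<^sub>M (\<Pi>\<^sub>M i\<in>{..<n}. borel)" "prob_space (P \<theta>)"
    "distr (P \<theta>) (\<Pi>\<^sub>M i\<in>{..<n}. borel) (W n) = (\<Pi>\<^sub>M i\<in>{..<n}. law \<theta> (c n))"
    if "\<theta> \<in> {0<..<1}" "0 < n" for n \<theta>
    unfolding W_def[abs_def] law_def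
    by (rule copies_distr[OF copies[OF that(1)] X_process[OF that(1)] that(2)])+
  have estm: "est n \<in> borel_measurable (P \<theta>)" if "\<theta> \<in> {0<..<1}" "0 < n" for n \<theta>
  proof -
    have "(\<lambda>\<omega>. g n (W n \<omega>)) \<in> borel_measurable (P \<theta>)"
      by (rule measurable_compose[OF Wm(1)[OF that] g])
    then show ?thesis
      by (rule measurable_cong[THEN iffD1, rotated]) (simp add: estg[OF that(1)])
  qed
  have transfer: "(LINT \<omega>|P \<theta>. F (a n * (est n \<omega> - \<theta>0))) =
      (LINT w|(\<Pi>\<^sub>M i\<in>{..<n}. law \<theta> (c n)). F (a n * (g n w - \<theta>0)))"
    if "\<theta> \<in> {0<..<1}" "0 < n" and [measurable]: "F \<in> borel_measurable borel" for F :: "real \<Rightarrow> real" and n \<theta>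
  proof -
    have "(LINT \<omega>|P \<theta>. F (a n * (est n \<omega> - \<theta>0))) = (LINT \<omega>|P \<theta>. F (a n * (g n (W n \<omega>) - \<theta>0)))"
      by (rule Bochner_Integration.integral_cong[OF refl]) (simp add: estg[OF that(1)])
    also have "\<dots> = (LINT w|distr (P \<theta>) (\<Pi>\<^sub>M i\<in>{..<n}. borel) (W n). F (a n * (g n w - \<theta>0)))"
      by (rule integral_distr[symmetric, OF Wm(1)[OF that(1,2)]]) measurable
    finally show ?thesis unfolding Wm(3)[OF that(1,2)] .
  qed
  have rd: "\<forall>\<^sub>F n in sequentially. real_distribution (distr (P (lp \<xi> n)) borel (\<lambda>\<omega>. a n * (est n \<omega> - lp \<xi> n)))" for \<xi>
    using lp_ev[of \<xi>] eventually_gt_at_top[of 0]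
  proof eventually_elim
    fix n assume n: "lp \<xi> n \<in> {0<..<1}" "0 < n"
    interpret prob_space "P (lp \<xi> n)" by (rule Wm(2)[OF n])
    note [measurable] = estm[OF n]
    show "real_distribution (distr (P (lp \<xi> n)) borel (\<lambda>\<omega>. a n * (est n \<omega> - lp \<xi> n)))"
      by (rule real_distribution_distr) measurable
  qed
  have lim: "(\<lambda>n. LINT \<omega>|P (lp \<xi> n). F (a n * (est n \<omega> - \<theta>0))) \<longlonglongrightarrow> (LINT x|Q. F (x + \<xi>))"
    if F: "\<And>x. isCont F x" "\<And>x. \<bar>F x\<bar> \<le> K" for F :: "real \<Rightarrow> real" and K \<xi>
  proof -
    have [measurable]: "F \<in> borel_measurable borel"
      by (intro borel_measurable_continuous_onI continuous_at_imp_continuous_on ballI F)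
    have "(\<lambda>n. LINT x|distr (P (lp \<xi> n)) borel (\<lambda>\<omega>. a n * (est n \<omega> - lp \<xi> n)). F (x + \<xi>)) \<longlonglongrightarrow> (LINT x|Q. F (x + \<xi>))"
    proof (rule weak_conv_integral_eventually[OF wc rd Q])
      show "isCont (\<lambda>x. F (x + \<xi>)) x" for x
        by (rule isCont_o2[where g=F]) (auto intro: F)
      show "\<bar>F (x + \<xi>)\<bar> \<le> K" for x by (rule F)
    qed
    moreover have "\<forall>\<^sub>F n in sequentially. (LINT x|distr (P (lp \<xi> n)) borel (\<lambda>\<omega>. a n * (est n \<omega> - lp \<xi> n)). F (x + \<xi>)) =
        (LINT \<omega>|P (lp \<xi> n). F (a n * (est n \<omega> - \<theta>0)))"
      using lp_ev[of \<xi>] eventually_gt_at_top[of 0]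
    proof eventually_elim
      fix n assume n: "lp \<xi> n \<in> {0<..<1}" "0 < n"
      note [measurable] = estm[OF n]
      have e: "a n * (x - lp \<xi> n) + \<xi> = a n * (x - \<theta>0)" for x
        using a_pos[OF n(2)] by (simp add: lp_eq field_simps)
      have "(LINT x|distr (P (lp \<xi> n)) borel (\<lambda>\<omega>. a n * (est n \<omega> - lp \<xi> n)). F (x + \<xi>)) =
          (LINT \<omega>|P (lp \<xi> n). F (a n * (est n \<omega> - lp \<xi> n) + \<xi>))"
        by (rule integral_distr) measurable
      then show "(LINT x|distr (P (lp \<xi> n)) borel (\<lambda>\<omega>. a n * (est n \<omega> - lp \<xi> n)). F (x + \<xi>)) =
        (LINT \<omega>|P (lp \<xi> n). F (a n * (est n \<omega> - \<theta>0)))"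
        unfolding e .
    qed
    ultimately show ?thesis by (rule Lim_transform_eventually)
  qed
  have lp0: "lp 0 n = \<theta>0" for n by (simp add: lp_eq)
  have [measurable]: "h \<in> borel_measurable borel"
    by (intro borel_measurable_continuous_onI continuous_at_imp_continuous_on ballI h)
  define E1 where "E1 n = (LINT \<omega>|P (lp \<xi> n). h (a n * (est n \<omega> - \<theta>0)))" for n
  define E0 where "E0 n = (LINT \<omega>|P \<theta>0. h (a n * (est n \<omega> - \<theta>0)))" for n
  define V0 where "V0 n = (LINT \<omega>|P \<theta>0. (h (a n * (est n \<omega> - \<theta>0)))\<^sup>2)" for n
  \<comment> \<open>A bound for \<open>n\<close> times the chi-square distance of one observation:
    the factor n / (a n)^2 = 1 / |c n| turns \<open>surv \<theta>0 (c n)\<close> into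
    \<open>\<pi>0 n\<close>.\<close>
  define b where "b n = (\<bar>L * \<xi>\<bar> + \<eta>)\<^sup>2 * \<pi>0 n / (1 - surv \<theta>0 (c n))" for n
  have E1: "E1 \<longlonglongrightarrow> (LINT x|Q. h (x + \<xi>))"
    unfolding E1_def by (rule lim[OF h])
  have E0: "E0 \<longlonglongrightarrow> (LINT x|Q. h x)"
    unfolding E0_def using lim[OF h, of 0] by (simp add: lp0)
  have V0: "V0 \<longlonglongrightarrow> (LINT x|Q. (h x)\<^sup>2)"
  proof -
    have "\<bar>(h x)\<^sup>2\<bar> \<le> k\<^sup>2" for x
      using power_mono[OF h(2)[of x], of 2] by simp
    then have "(\<lambda>n. LINT \<omega>|P (lp 0 n). (h (a n * (est n \<omega> - \<theta>0)))\<^sup>2) \<longlonglongrightarrow> (LINT x|Q. (h (x + 0))\<^sup>2)"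
      by (intro lim[where F="\<lambda>x. (h x)\<^sup>2" and K="k\<^sup>2"] isCont_power h(1))
    then show ?thesis unfolding V0_def by (simp add: lp0)
  qed
  have s0: "(\<lambda>n. surv \<theta>0 (c n)) \<longlonglongrightarrow> 0"
    by (rule filterlim_compose[OF surv_lim_zero[OF theta0] c_left])
  have "b \<longlonglongrightarrow> (\<bar>L * \<xi>\<bar> + \<eta>)\<^sup>2 * \<theta>0 / (1 - 0)"
    unfolding b_def by (intro tendsto_divide tendsto_mult tendsto_const \<pi>0_lim tendsto_diff s0) simp
  then have b: "b \<longlonglongrightarrow> \<theta>0 * (\<bar>L * \<xi>\<bar> + \<eta>)\<^sup>2" by (simp add: mult.commute)
  have "\<forall>\<^sub>F n in sequentially. (E1 n - E0 n)\<^sup>2 \<le> V0 n * (exp (b n) - 1)"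
    using close_local[OF \<eta>, of \<xi>] lp_ev[of \<xi>] eventually_gt_at_top[of 0]
  proof eventually_elim
    fix n assume cl: "close_law (lp \<xi> n) (c n) (\<eta> / a n)" and n: "lp \<xi> n \<in> {0<..<1}" "0 < n"
    have an: "a n > 0" by (rule a_pos[OF n(2)])
    obtain R C where R: "R \<in> borel_measurable borel" "\<And>u. 0 \<le> R u" "\<And>u. R u \<le> C"
        "law (lp \<xi> n) (c n) = density (law \<theta>0 (c n)) (\<lambda>u. ennreal (R u))"
      and chi: "(LINT u|law \<theta>0 (c n). (R u - 1)\<^sup>2) \<le>
          (\<bar>L * (lp \<xi> n - \<theta>0)\<bar> + \<eta> / a n)\<^sup>2 * surv \<theta>0 (c n) / (1 - surv \<theta>0 (c n))"
      using cl unfolding close_law_def by blast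
    define x2 where "x2 = (LINT u|law \<theta>0 (c n). (R u - 1)\<^sup>2)"
    interpret l0: real_distribution "law \<theta>0 (c n)" by (rule law_facts(1)[OF theta0 c_neg])
    interpret l1: real_distribution "law (lp \<xi> n) (c n)" by (rule law_facts(1)[OF n(1) c_neg])
    have CR: "(E1 n - E0 n)\<^sup>2 \<le> V0 n * ((1 + x2) ^ n - 1)"
    proof -
      have eq: "E1 n = (LINT w|(\<Pi>\<^sub>M i\<in>{..<n}. law (lp \<xi> n) (c n)). h (a n * (g n w - \<theta>0)))"
        "E0 n = (LINT w|(\<Pi>\<^sub>M i\<in>{..<n}. law \<theta>0 (c n)). h (a n * (g n w - \<theta>0)))"
        "V0 n = (LINT w|(\<Pi>\<^sub>M i\<in>{..<n}. law \<theta>0 (c n)). (h (a n * (g n w - \<theta>0)))\<^sup>2)"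
        unfolding E1_def E0_def V0_def
        by (rule transfer[OF n], measurable)
           (rule transfer[OF theta0 n(2)], measurable,
            rule transfer[OF theta0 n(2), where F="\<lambda>x. (h x)\<^sup>2"], measurable)
      show ?thesis
        unfolding eq x2_def
        by (rule product_chapman_robbins[OF l0.prob_space_axioms _ R(1,2,3) l1.prob_space_axioms R(4)])
           (use h(2) in simp_all)
    qed
    have x2: "0 \<le> x2" unfolding x2_def by (rule Bochner_Integration.integral_nonneg) simp
    have "real n * x2 \<le> real n * ((\<bar>L * (lp \<xi> n - \<theta>0)\<bar> + \<eta> / a n)\<^sup>2 * surv \<theta>0 (c n) / (1 - surv \<theta>0 (c n)))"
      unfolding x2_def by (rule mult_left_mono[OF chi]) simp
    also have "\<bar>L * (lp \<xi> n - \<theta>0)\<bar> + \<eta> / a n = (\<bar>L * \<xi>\<bar> + \<eta>) / a n"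
      using an by (simp add: lp_eq abs_mult abs_divide add_divide_distrib)
    also have "real n * (((\<bar>L * \<xi>\<bar> + \<eta>) / a n)\<^sup>2 * surv \<theta>0 (c n) / (1 - surv \<theta>0 (c n))) = b n"
      using n(2) unfolding b_def \<pi>0_def power_divide a_sq by simp
    finally have nb: "real n * x2 \<le> b n" .
    have "(1 + x2) ^ n \<le> exp x2 ^ n" using x2 by (intro power_mono exp_ge_add_one_self) simp
    also have "\<dots> = exp (real n * x2)" by (rule exp_of_nat_mult[symmetric])
    also have "\<dots> \<le> exp (b n)" using nb by simp
    finally have pw: "(1 + x2) ^ n - 1 \<le> exp (b n) - 1" by simp
    have "0 \<le> V0 n" unfolding V0_def by (rule Bochner_Integration.integral_nonneg) simp
    then have "V0 n * ((1 + x2) ^ n - 1) \<le> V0 n * (exp (b n) - 1)" by (rule mult_left_mono[OF pw])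
    with CR show "(E1 n - E0 n)\<^sup>2 \<le> V0 n * (exp (b n) - 1)" by (rule order_trans)
  qed
  then show ?thesis
    by (rule tendsto_le[OF sequentially_bot _ _, rotated 2])
       (intro tendsto_intros E1 E0 V0 b)+
qed

text \<open>\<open>h k\<close> truncates \<open>x - m\<close> at \<open>-k\<close> and
  \<open>k\<close>, where \<open>m\<close> is the mean of \<open>Q\<close>. Dominated convergence
  turns the difference of the means into \<open>\<xi>\<close>, while for every \<open>k\<close> the
  second moment of \<open>h k\<close> is at most the variance because of the centring.\<close>

lemma regular_variance_ineq:
  assumes reg: "regular_estimator P Xs \<theta>0 c est Q" and v: "has_variance Q v" and \<eta>: "\<eta> > 0"
  shows "\<xi>\<^sup>2 \<le> v * (exp (\<theta>0 * (\<bar>L * \<xi>\<bar> + \<eta>)\<^sup>2) - 1)"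
proof -
  interpret Q: real_distribution Q using reg by (simp add: regular_estimator_def)
  have sq: "integrable Q (\<lambda>x. x\<^sup>2)" using v by (simp add: has_variance_def)
  have ix: "integrable Q (\<lambda>x. x)"
    by (rule Q.square_integrable_imp_integrable[OF _ sq]) simp
  define m where "m = (LINT x|Q. x)"
  have vm: "v = (LINT x|Q. (x - m)\<^sup>2)" using v by (simp add: has_variance_def m_def)
  have ivm: "integrable Q (\<lambda>x. (x - m)\<^sup>2)"
    using sq ix by (simp add: power2_diff)
  define h where "h k x = max (- real k) (min (real k) (x - m))" for k x
  have hb: "\<bar>h k x\<bar> \<le> real k" for k x unfolding h_def by auto
  have hx: "\<bar>h k x\<bar> \<le> \<bar>x - m\<bar>" for k x unfolding h_def by auto
  have [measurable]: "h k \<in> borel_measurable borel" for k unfolding h_def by measurable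
  have hlim: "(\<lambda>k. h k x) \<longlonglongrightarrow> x - m" for x
  proof (rule tendsto_eventually)
    obtain N :: nat where "\<bar>x - m\<bar> \<le> real N" using real_arch_simple by blast
    then show "\<forall>\<^sub>F k in sequentially. h k x = x - m"
      unfolding eventually_sequentially h_def
      by (intro exI[of _ N] allI impI) (auto simp: max_def min_def)
  qed
  have ix2: "integrable Q (\<lambda>x. \<bar>x + d - m\<bar>)" for d using ix by simp
  have dom: "(\<lambda>k. LINT x|Q. h k (x + d)) \<longlonglongrightarrow> (LINT x|Q. x + d - m)" for d
  proof (rule integral_dominated_convergence[where w="\<lambda>x. \<bar>x + d - m\<bar>"])
    show "AE x in Q. (\<lambda>k. h k (x + d)) \<longlonglongrightarrow> x + d - m" using hlim by simp
    show "AE x in Q. norm (h k (x + d)) \<le> \<bar>x + d - m\<bar>" for k using hx by simp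
  qed (use ix2 in simp_all)
  have "(\<lambda>k. ((LINT x|Q. h k (x + \<xi>)) - (LINT x|Q. h k x))\<^sup>2) \<longlonglongrightarrow>
      ((LINT x|Q. x + \<xi> - m) - (LINT x|Q. x + 0 - m))\<^sup>2"
    using dom[of 0] by (intro tendsto_intros dom) simp
  also have "(LINT x|Q. x + \<xi> - m) - (LINT x|Q. x + 0 - m) = \<xi>"
    using ix Q.prob_space by simp
  finally show ?thesis
  proof (rule LIMSEQ_le_const2, intro exI allI impI)
    fix k
    have "((LINT x|Q. h k (x + \<xi>)) - (LINT x|Q. h k x))\<^sup>2 \<le>
        (LINT x|Q. (h k x)\<^sup>2) * (exp (\<theta>0 * (\<bar>L * \<xi>\<bar> + \<eta>)\<^sup>2) - 1)"
    proof (rule regular_bounded_ineq[OF reg _ hb \<eta>])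
      show "isCont (h k) x" for x unfolding h_def by (intro continuous_intros)
    qed
    also have "\<dots> \<le> v * (exp (\<theta>0 * (\<bar>L * \<xi>\<bar> + \<eta>)\<^sup>2) - 1)"
    proof (rule mult_right_mono)
      show "(LINT x|Q. (h k x)\<^sup>2) \<le> v"
        unfolding vm
      proof (rule integral_mono[OF _ ivm])
        show sqle: "(h k x)\<^sup>2 \<le> (x - m)\<^sup>2" for x
          using power_mono[OF hx[of k x], of 2] by simp
        show "integrable Q (\<lambda>x. (h k x)\<^sup>2)"
          by (rule Bochner_Integration.integrable_bound[OF ivm]) (use sqle in simp_all)
      qed
      show "0 \<le> exp (\<theta>0 * (\<bar>L * \<xi>\<bar> + \<eta>)\<^sup>2) - 1" using theta0 by simp
    qed
    finally show "((LINT x|Q. h k (x + \<xi>)) - (LINT x|Q. h k x))\<^sup>2 \<le> v * (exp (\<theta>0 * (\<bar>L * \<xi>\<bar> + \<eta>)\<^sup>2) - 1)" .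
  qed
qed

text \<open>The choice \<open>\<xi> = sqrt (s n)\<close> and \<open>\<eta> = s n * \<xi>\<close>
  makes the slack negligible against \<open>\<xi>\<close>: the exponent becomes
  \<open>A n * s n\<close> with \<open>A n\<close> tending to \<theta>0 L^2 = 1 / \<theta>0. The
  estimate exp x - 1 \<le> x + x^2 on [0,1] and division by \<open>s n\<close>, the square of
  \<open>\<xi>\<close>, leave \<open>1 \<le> v / \<theta>0\<close> in the limit.\<close>

lemma regular_variance_ge:
  assumes reg: "regular_estimator P Xs \<theta>0 c est Q" and v: "has_variance Q v"
  shows "\<theta>0 \<le> v"
proof -
  have v0: "0 \<le> v"
    using v by (auto simp: has_variance_def intro!: Bochner_Integration.integral_nonneg)
  have L0: "L > 0" using theta0 by (simp add: L_eq)
  define s where "s n = 1 / real (Suc n)" for n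
  have s0: "s n > 0" for n by (simp add: s_def)
  have slim: "s \<longlonglongrightarrow> 0" unfolding s_def[abs_def] using LIMSEQ_inverse_real_of_nat by (simp add: inverse_eq_divide)
  define A where "A n = \<theta>0 * (L + s n)\<^sup>2" for n
  have Alim: "A \<longlonglongrightarrow> \<theta>0 * (L + 0)\<^sup>2" unfolding A_def by (intro tendsto_intros slim)
  have "(\<lambda>n. A n * s n) \<longlonglongrightarrow> \<theta>0 * (L + 0)\<^sup>2 * 0" by (intro tendsto_mult Alim slim)
  then have "\<forall>\<^sub>F n in sequentially. A n * s n < 1" by (intro order_tendstoD(2)) auto
  then have "\<forall>\<^sub>F n in sequentially. 1 \<le> v * (A n + (A n)\<^sup>2 * s n)"
  proof eventually_elim
    fix n assume small: "A n * s n < 1"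
    have A0: "0 \<le> A n" using theta0 by (simp add: A_def)
    define \<xi> where "\<xi> = sqrt (s n)"
    have \<xi>: "\<xi> > 0" "\<xi>\<^sup>2 = s n" using s0[of n] by (simp_all add: \<xi>_def)
    have "\<bar>L * \<xi>\<bar> + s n * \<xi> = (L + s n) * \<xi>" using L0 \<xi> by (simp add: algebra_simps)
    then have "\<theta>0 * (\<bar>L * \<xi>\<bar> + s n * \<xi>)\<^sup>2 = A n * s n"
      by (simp add: A_def power_mult_distrib \<xi>)
    then have "s n \<le> v * (exp (A n * s n) - 1)"
      using regular_variance_ineq[OF reg v mult_pos_pos[OF s0[of n] \<xi>(1)], of \<xi>] \<xi>(2) by simp
    also have "\<dots> \<le> v * (A n * s n + (A n * s n)\<^sup>2)"
      using exp_bound[of "A n * s n"] small A0 s0[of n] v0 by (intro mult_left_mono) auto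
    also have "\<dots> = s n * (v * (A n + (A n)\<^sup>2 * s n))"
      by (simp add: power2_eq_square algebra_simps)
    finally have "s n * 1 \<le> s n * (v * (A n + (A n)\<^sup>2 * s n))" by simp
    then show "1 \<le> v * (A n + (A n)\<^sup>2 * s n)" by (rule mult_left_le_imp_le[OF _ s0])
  qed
  moreover have "(\<lambda>n. v * (A n + (A n)\<^sup>2 * s n)) \<longlonglongrightarrow>
      v * (\<theta>0 * (L + 0)\<^sup>2 + (\<theta>0 * (L + 0)\<^sup>2)\<^sup>2 * 0)"
    by (intro tendsto_intros Alim slim)
  ultimately have "1 \<le> v * (\<theta>0 * (L + 0)\<^sup>2 + (\<theta>0 * (L + 0)\<^sup>2)\<^sup>2 * 0)"
    by (intro tendsto_lowerbound[OF _ _ sequentially_bot])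
  also have "\<dots> = v / \<theta>0" using theta0 by (simp add: L_eq power2_eq_square)
  finally show ?thesis using theta0 by (simp add: le_divide_eq)
qed

end

theorem corollary4p2:
  fixes \<psi> :: "real \<Rightarrow> real"
    and \<delta> \<gamma> \<theta>0 L :: real
    and M :: "real \<Rightarrow> 'a measure" and X :: "real \<Rightarrow> 'a \<Rightarrow> real"
    and P :: "real \<Rightarrow> 'w measure" and Xs :: "nat \<Rightarrow> real \<Rightarrow> 'w \<Rightarrow> real"
    and c :: "nat \<Rightarrow> real"
  assumes psi_cont: "continuous_on UNIV \<psi>"
    and psi_pos: "\<And>s. \<psi> s > 0"
    and psi_density: "integrable lborel \<psi>" "(LINT s|lborel. \<psi> s) = 1"
    and psi_even: "\<And>s. \<psi> s = \<psi> (- s)"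
    and psi_decreasing: "antimono_on {0..} \<psi>"
    and delta: "\<delta> > 0" and gamma: "\<gamma> > 0" and theta0: "\<theta>0 \<in> {0<..<1}"
    and X_process: "\<And>\<theta>. \<theta> \<in> {0<..<1} \<Longrightarrow> nonpos_continuous_process (M \<theta>) X"
    and X_C: "\<And>\<theta>. \<theta> \<in> {0<..<1} \<Longrightarrow> condition_C \<psi> (beta_of \<psi> \<theta>) \<delta> (M \<theta>) X"
    and X_D: "condition_D \<theta>0 L \<gamma> M X"
    and copies: "\<And>\<theta>. \<theta> \<in> {0<..<1} \<Longrightarrow> independent_copies (P \<theta>) Xs (M \<theta>) X"
    and c_neg: "\<And>n. c n < 0" and c_incseq: "incseq c" and c_lim: "c \<longlonglongrightarrow> 0"
    and nc_infinity: "filterlim (\<lambda>n. real n * \<bar>c n\<bar>) at_top sequentially"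
    and nc_powr: "(\<lambda>n. real n * \<bar>c n\<bar> powr (1 + 2 * min \<delta> \<gamma>)) \<longlonglongrightarrow> 0"
    and cases_ab:
      "(\<forall>\<theta>\<in>{0<..<1}. standard_gpp \<psi> (beta_of \<psi> \<theta>) (M \<theta>) X) \<or>
       (\<forall>\<theta>\<in>{0<..<1}. ratio_process \<psi> (beta_of \<psi> \<theta>) \<delta> (M \<theta>) X)"
  shows "\<exists>Q. regular_estimator P Xs \<theta>0 c
               (\<lambda>n \<omega>. real (exceedance_count Xs n (c n) \<omega>) / (real n * \<bar>c n\<bar>)) Q \<and>
             has_variance Q \<theta>0 \<and>
             (\<forall>est' Q' v'. regular_estimator P Xs \<theta>0 c est' Q' \<and> has_variance Q' v' \<longrightarrow>
                \<theta>0 \<le> v')"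
proof -
  interpret exceedance_sampling \<psi> \<delta> \<gamma> \<theta>0 L M X P Xs c
  proof
    show "continuous_process (M \<theta>) X" if "\<theta> \<in> {0<..<1}" for \<theta>
      using X_process[OF that] by (simp add: nonpos_continuous_process_def)
  qed (fact psi_cont psi_pos psi_density psi_even psi_decreasing delta gamma theta0 X_C X_D
      copies c_neg c_lim nc_infinity nc_powr)+
  show ?thesis
    using est_regular limit_law(2) regular_variance_ge by blast
qed

end
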